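(* Let $n,m$ be positive integers and $r$ a nonnegative integer with $r\le\min\{n,m\}$. Let $<$ be any diagonal monomial order on the monomials of $\mathbb{C}[\mathbf{x}_{n\times m}]$. Then the family of monomials $\{\mathfrak{es}(\mathcal{R}) : \mathcal{R}\in\mathcal{UZ}_{n,m,r}\}$ descends to the standard monomial basis of $\mathbb{C}[\mathbf{x}_{n\times m}]/I_{n,m,r}$ with respect to $<$; that is, the set $\{\mathfrak{es}(\mathcal{R}) : \mathcal{R}\in\mathcal{UZ}_{n,m,r}\}$ is exactly the set of monomials not lying in the initial ideal $\mathrm{in}_{<}\, I_{n,m,r}$. Furthermore, $\mathrm{gr}\,\mathbf{I}(\mathcal{UZ}_{n,m,r}) = I_{n,m,r}$.
   Context: Notation: $[n]=\{1,\dots,n\}$; $\mathbb{C}[\mathbf{x}_{n\times m}]$ is the polynomial ring in variables $x_{i,j}$, $1\le i\le n$, $1\le j\le m$. Rook placements: a rook placement on the $n\times m$ board is a subset $\mathcal{R}\subseteq[n]\times[m]$ such that any two distinct elements differ in both coordinates; its size is its cardinality. It is identified with the $0/1$ matrix in $\mathrm{Mat}_{n\times m}(\mathbb{C})$ having a $1$ in position $(i,j)$ iff $(i,j)\in\mathcal{R}$. $\mathcal{UZ}_{n,m,r}\subseteq\mathrm{Mat}_{n\times m}(\mathbb{C})$ is the finite set of all rook placements of size at least $r$. Ideals: $\mathbf{I}(\mathcal{UZ}_{n,m,r})$ is the ideal of polynomials vanishing on $\mathcal{UZ}_{n,m,r}$. For nonzero $f$, $\tau(f)$ is the top-degree homogeneous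 component of $f$, and for an ideal $I$, $\mathrm{gr}\,I$ is the ideal generated by all $\tau(f)$, $f\in I\setminus\{0\}$. The ideal $I_{n,m,r}\subseteq\mathbb{C}[\mathbf{x}_{n\times m}]$ is generated by: all products $x_{i,j}x_{i,j'}$ ($1\le i\le n$, $1\le j,j'\le m$, $j=j'$ allowed); all products $x_{i,j}x_{i',j}$ ($1\le i,i'\le n$, $1\le j\le m$, $i=i'$ allowed); all products $\prod_{k=1}^{n-r+1}\big(\sum_{j=1}^m x_{i_k,j}\big)$ for $1\le i_1<\dots<i_{n-r+1}\le n$; and all products $\prod_{k=1}^{m-r+1}\big(\sum_{i=1}^n x_{i,j_k}\big)$ for $1\le j_1<\dots<j_{m-r+1}\le m$. Diagonal monomial orders: a monomial order on $\mathbb{C}[\mathbf{x}_{n\times m}]$ is diagonal if it is the lexicographic order induced by a total order on the variables satisfying $x_{i,j}>x_{i',j'}$ whenever $i+j<i'+j'$. (For variables $y_1>y_2>\dots>y_N$, the lexicographic order has $y_1^{a_1}\cdots y_N^{a_N}<y_1^{b_1}\cdots y_N^{b_N}$ iff there is $M$ with $a_i=b_i$ for $i<M$ and $a_M<b_M$.) Shadow construction: let $A$ be a finite set of points in a product of two totally ordered sets, no two sharing a first coordinate ($x$-coordinate) or a second coordinate ($y$-coordinate). Let $(a_1,b_1),\dots,(a_s,b_s)$ be the minimal elements of $A$ in the componentwise order, listed with $a_1<\dots<a_s$ (so $b_1>\dots>b_s$). The first shadow line $L_1$ is the boundary of the region of points weakly above and weakly to the right of some point of $A$; its northeast corners are $(a_{i+1},b_i)$,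 $1\le i\le s-1$. Delete these minimal elements from $A$ and repeat to get $L_2,L_3,\dots$ until no points remain. The shadow set $\mathcal{S}(A)$ is the set of all northeast corners of all the shadow lines. Extended shadow monomials: let $\mathcal{R}\in\mathcal{UZ}_{n,m,r}$ have size $r'$. Use column indices ($x$-coordinates) $\overline{1}<\dots<\overline{m-r}<1<\dots<n$ and row indices ($y$-coordinates) $\overline{1}<\dots<\overline{n-r}<1<\dots<m$. Let $i_1<\dots<i_{n-r'}$ be the elements of $[n]$ that are not first coordinates of rooks of $\mathcal{R}$, and $j_1<\dots<j_{m-r'}$ the elements of $[m]$ that are not second coordinates of rooks of $\mathcal{R}$. Then $\mathcal{EX}(\mathcal{R})=\mathcal{R}\cup\{(\overline{i},\overline{i}):1\le i\le r'-r\}\cup\{(\overline{r'-r+l},j_l):1\le l\le m-r'\}\cup\{(i_k,\overline{r'-r+k}):1\le k\le n-r'\}$, which has exactly one point in each column and each row. The extended shadow set is $\mathcal{ES}(\mathcal{R})=\mathcal{S}(\mathcal{EX}(\mathcal{R}))$; it is always a rook placement contained in $[n]\times[m]$. The extended shadow monomial is $\mathfrak{es}(\mathcal{R})=\prod_{(i,j)\in\mathcal{ES}(\mathcal{R})}x_{i,j}$. *)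

theory Defs
  imports Complex_Main "HOL-Library.Poly_Mapping" "HOL-Algebra.Ideal"
begin

section \<open>The polynomial ring in the variables of the \<open>n \<times> m\<close> board\<close>

text \<open>
  A monomial is represented by its exponent vector and a polynomial by its finitely supported
  coefficient function, so that multiplication of monomials is addition of exponent vectors.
  The underlying type has a variable for every pair of naturals; the ring
  with variables \<open>x\<^sub>i\<^sub>,\<^sub>j\<close>, \<open>(i, j) \<in> [n] \<times> [m]\<close>, is carved out by its carrier.
\<close>

type_synonym mon = "nat \<times> nat \<Rightarrow>\<^sub>0 nat"
type_synonym mpoly = "mon \<Rightarrow>\<^sub>0 complex"

definition board :: "nat \<Rightarrow> nat \<Rightarrow> (nat \<times> nat) set" where
  "board n m = {1..n} \<times> {1..m}"

definition mons :: "nat \<Rightarrow> nat \<Rightarrow> mon set" where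
  "mons n m = {a. Poly_Mapping.keys a \<subseteq> board n m}"

definition poly_ring :: "nat \<Rightarrow> nat \<Rightarrow> mpoly ring" where
  "poly_ring n m =
     \<lparr>carrier = {f. Poly_Mapping.keys f \<subseteq> mons n m}, mult = (*), one = 1, zero = 0, add = (+)\<rparr>"

definition var :: "nat \<times> nat \<Rightarrow> mpoly" where
  "var v = Poly_Mapping.single (Poly_Mapping.single v 1) 1"

definition mon_poly :: "mon \<Rightarrow> mpoly" where
  "mon_poly a = Poly_Mapping.single a 1"

definition eval_poly :: "(nat \<times> nat \<Rightarrow> complex) \<Rightarrow> mpoly \<Rightarrow> complex" where
  "eval_poly z f = (\<Sum>a\<in>Poly_Mapping.keys f.
     Poly_Mapping.lookup f a * (\<Prod>v\<in>Poly_Mapping.keys a. z v ^ Poly_Mapping.lookup a v))"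

lemma cring_poly_ring: "cring (poly_ring n m)"
proof (rule cringI)
  have add: "f + g \<in> carrier (poly_ring n m)"
    if "f \<in> carrier (poly_ring n m)" "g \<in> carrier (poly_ring n m)" for f g
    using that keys_add[of f g] by (auto simp: poly_ring_def)
  have mult: "f * g \<in> carrier (poly_ring n m)"
    if "f \<in> carrier (poly_ring n m)" "g \<in> carrier (poly_ring n m)" for f g
  proof -
    have "a + b \<in> mons n m" if "a \<in> mons n m" "b \<in> mons n m" for a b
      using that keys_add[of a b] by (auto simp: mons_def)
    then show ?thesis
      using that keys_mult[of f g] by (fastforce simp: poly_ring_def)
  qed
  have neg: "- f \<in> carrier (poly_ring n m)" if "f \<in> carrier (poly_ring n m)" for f
    using that by (auto simp: poly_ring_def)
  show "abelian_group (poly_ring n m)"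
  proof (rule abelian_groupI)
    fix f assume "f \<in> carrier (poly_ring n m)"
    then show "\<exists>g\<in>carrier (poly_ring n m). g \<oplus>\<^bsub>poly_ring n m\<^esub> f = \<zero>\<^bsub>poly_ring n m\<^esub>"
      by (intro bexI[of _ "- f"] neg) (simp_all add: poly_ring_def)
  qed (use add in \<open>simp_all add: poly_ring_def algebra_simps\<close>)
  show "comm_monoid (poly_ring n m)"
  proof (rule comm_monoidI)
    show "\<one>\<^bsub>poly_ring n m\<^esub> \<in> carrier (poly_ring n m)"
      by (simp add: poly_ring_def mons_def)
  qed (use mult in \<open>simp_all add: poly_ring_def algebra_simps\<close>)
qed (simp add: poly_ring_def algebra_simps)


section \<open>Diagonal monomial orders and initial ideals\<close>

text \<open>
  Orders on monomials are given by their strict part: \<open>(a, b) \<in> L\<close> means \<open>a < b\<close>.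
  The order on the variables is reflexive: \<open>(w, v) \<in> V\<close> means \<open>x\<^sub>w \<le> x\<^sub>v\<close>.
\<close>

definition lex_order :: "nat \<Rightarrow> nat \<Rightarrow> ((nat \<times> nat) \<times> (nat \<times> nat)) set \<Rightarrow> (mon \<times> mon) set" where
  "lex_order n m V = {(a, b). a \<in> mons n m \<and> b \<in> mons n m \<and>
     (\<exists>v\<in>board n m. Poly_Mapping.lookup a v < Poly_Mapping.lookup b v \<and>
        (\<forall>w\<in>board n m. (v, w) \<in> V \<and> w \<noteq> v \<longrightarrow>
           Poly_Mapping.lookup a w = Poly_Mapping.lookup b w))}"

definition diagonal_order :: "nat \<Rightarrow> nat \<Rightarrow> (mon \<times> mon) set \<Rightarrow> bool" where
  "diagonal_order n m L \<longleftrightarrow>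
     (\<exists>V. linear_order_on (board n m) V \<and>
        (\<forall>(i, j)\<in>board n m. \<forall>(i', j')\<in>board n m.
           i + j < i' + j' \<longrightarrow> ((i', j'), (i, j)) \<in> V) \<and>
        L = lex_order n m V)"

text \<open>Meaningful for \<open>f \<noteq> 0\<close> only.\<close>

definition lead_mon :: "(mon \<times> mon) set \<Rightarrow> mpoly \<Rightarrow> mon" where
  "lead_mon L f =
     (THE a. a \<in> Poly_Mapping.keys f \<and> (\<forall>b\<in>Poly_Mapping.keys f. b \<noteq> a \<longrightarrow> (b, a) \<in> L))"

definition initial_ideal :: "nat \<Rightarrow> nat \<Rightarrow> (mon \<times> mon) set \<Rightarrow> mpoly set \<Rightarrow> mpoly set" where
  "initial_ideal n m L I = Idl\<^bsub>poly_ring n m\<^esub> {mon_poly (lead_mon L f) | f. f \<in> I \<and> f \<noteq> 0}"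


section \<open>Vanishing ideals and associated graded ideals\<close>

definition vanishing_ideal :: "nat \<Rightarrow> nat \<Rightarrow> (nat \<times> nat \<Rightarrow> complex) set \<Rightarrow> mpoly set" where
  "vanishing_ideal n m Z = {f \<in> carrier (poly_ring n m). \<forall>z\<in>Z. eval_poly z f = 0}"

definition mon_degree :: "mon \<Rightarrow> nat" where
  "mon_degree a = (\<Sum>v\<in>Poly_Mapping.keys a. Poly_Mapping.lookup a v)"

definition top_component :: "mpoly \<Rightarrow> mpoly" where
  "top_component f =
     (\<Sum>a\<in>{a \<in> Poly_Mapping.keys f. mon_degree a = Max (mon_degree ` Poly_Mapping.keys f)}.
        Poly_Mapping.single a (Poly_Mapping.lookup f a))"

definition gr_ideal :: "nat \<Rightarrow> nat \<Rightarrow> mpoly set \<Rightarrow> mpoly set" where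
  "gr_ideal n m I = Idl\<^bsub>poly_ring n m\<^esub> {top_component f | f. f \<in> I \<and> f \<noteq> 0}"


section \<open>Rook placements and the ideal \<open>I\<^sub>n\<^sub>,\<^sub>m\<^sub>,\<^sub>r\<close>\<close>

definition rook_placement :: "nat \<Rightarrow> nat \<Rightarrow> (nat \<times> nat) set \<Rightarrow> bool" where
  "rook_placement n m R \<longleftrightarrow> R \<subseteq> board n m \<and>
     (\<forall>p\<in>R. \<forall>q\<in>R. p \<noteq> q \<longrightarrow> fst p \<noteq> fst q \<and> snd p \<noteq> snd q)"

definition UZ :: "nat \<Rightarrow> nat \<Rightarrow> nat \<Rightarrow> (nat \<times> nat) set set" where
  "UZ n m r = {R. rook_placement n m R \<and> r \<le> card R}"

text \<open>Matrices are functions on index pairs; entries outside the board play no role.\<close>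

definition rook_matrix :: "(nat \<times> nat) set \<Rightarrow> nat \<times> nat \<Rightarrow> complex" where
  "rook_matrix R = (\<lambda>v. if v \<in> R then 1 else 0)"

definition I_gens :: "nat \<Rightarrow> nat \<Rightarrow> nat \<Rightarrow> mpoly set" where
  "I_gens n m r =
     {var (i, j) * var (i, j') | i j j'. i \<in> {1..n} \<and> j \<in> {1..m} \<and> j' \<in> {1..m}} \<union>
     {var (i, j) * var (i', j) | i i' j. i \<in> {1..n} \<and> i' \<in> {1..n} \<and> j \<in> {1..m}} \<union>
     {\<Prod>i\<in>S. \<Sum>j\<in>{1..m}. var (i, j) | S. S \<subseteq> {1..n} \<and> card S = n - r + 1} \<union>
     {\<Prod>j\<in>S. \<Sum>i\<in>{1..n}. var (i, j) | S. S \<subseteq> {1..m} \<and> card S = m - r + 1}"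

definition I_ideal :: "nat \<Rightarrow> nat \<Rightarrow> nat \<Rightarrow> mpoly set" where
  "I_ideal n m r = Idl\<^bsub>poly_ring n m\<^esub> (I_gens n m r)"


section \<open>Shadow sets\<close>

definition minimal_points :: "('a::linorder \<times> 'b::linorder) set \<Rightarrow> ('a \<times> 'b) set" where
  "minimal_points A = {p \<in> A. \<not> (\<exists>q\<in>A. q \<noteq> p \<and> fst q \<le> fst p \<and> snd q \<le> snd p)}"

text \<open>
  The corners \<open>(a\<^sub>i\<^sub>+\<^sub>1, b\<^sub>i)\<close> of the shadow line through the minimal points \<open>M\<close>: \<open>p\<close> and \<open>q\<close> range
  over the pairs that are consecutive when \<open>M\<close> is listed by increasing first coordinate.
\<close>

definition northeast_corners :: "('a::linorder \<times> 'b::linorder) set \<Rightarrow> ('a \<times> 'b) set" where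
  "northeast_corners M = {(fst q, snd p) | p q. p \<in> M \<and> q \<in> M \<and> fst p < fst q \<and>
     \<not> (\<exists>s\<in>M. fst p < fst s \<and> fst s < fst q)}"

text \<open>
  The \<open>k\<close>-th iterate is what remains of \<open>A\<close> after \<open>k\<close> shadow lines; for finite \<open>A\<close> it is
  eventually empty and then contributes no corners.
\<close>

definition shadow_set :: "('a::linorder \<times> 'b::linorder) set \<Rightarrow> ('a \<times> 'b) set" where
  "shadow_set A =
     (\<Union>k. northeast_corners (minimal_points (((\<lambda>B. B - minimal_points B) ^^ k) A)))"


section \<open>Extended shadow monomials\<close>

text \<open>Indices \<open>Bar i\<close> (overlined) all precede the ordinary indices \<open>Reg i\<close>.\<close>

datatype ext_index = Bar nat | Reg nat

instantiation ext_index :: linorder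
begin

fun less_eq_ext_index :: "ext_index \<Rightarrow> ext_index \<Rightarrow> bool" where
  "Bar i \<le> Bar j \<longleftrightarrow> i \<le> j"
| "Bar i \<le> Reg j \<longleftrightarrow> True"
| "Reg i \<le> Bar j \<longleftrightarrow> False"
| "Reg i \<le> Reg j \<longleftrightarrow> i \<le> j"

definition less_ext_index :: "ext_index \<Rightarrow> ext_index \<Rightarrow> bool" where
  "less_ext_index x y \<longleftrightarrow> x \<le> y \<and> \<not> y \<le> x"

instance
proof
  fix x y z :: ext_index
  show "x < y \<longleftrightarrow> x \<le> y \<and> \<not> y \<le> x" by (simp add: less_ext_index_def)
  show "x \<le> x" by (cases x) auto
  show "x \<le> y \<Longrightarrow> y \<le> z \<Longrightarrow> x \<le> z" by (cases x; cases y; cases z) auto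
  show "x \<le> y \<Longrightarrow> y \<le> x \<Longrightarrow> x = y" by (cases x; cases y) auto
  show "x \<le> y \<or> y \<le> x" by (cases x; cases y) auto
qed

end

text \<open>
  The lists \<open>cs\<close> and \<open>rs\<close> enumerate increasingly the rook-free first and second coordinates.
  List positions start at \<open>0\<close>, hence the shifts by one.
\<close>

definition EXR :: "nat \<Rightarrow> nat \<Rightarrow> nat \<Rightarrow> (nat \<times> nat) set \<Rightarrow> (ext_index \<times> ext_index) set" where
  "EXR n m r R =
     (let r' = card R;
          cs = sorted_list_of_set ({1..n} - fst ` R);
          rs = sorted_list_of_set ({1..m} - snd ` R)
      in {(Reg i, Reg j) | i j. (i, j) \<in> R} \<union>
         {(Bar i, Bar i) | i. i \<in> {1..r' - r}} \<union>
         {(Bar (r' - r + l), Reg (rs ! (l - 1))) | l. l \<in> {1..m - r'}} \<union>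
         {(Reg (cs ! (k - 1)), Bar (r' - r + k)) | k. k \<in> {1..n - r'}})"

text \<open>
  The corners of a shadow line lie in \<open>[n] \<times> [m]\<close>: the points of \<open>EXR\<close> with overlined first
  coordinate form an increasing chain, as do those with overlined second coordinate, so no two
  of either kind are minimal together.  Taking the preimage below therefore loses no corner.
\<close>

definition ES :: "nat \<Rightarrow> nat \<Rightarrow> nat \<Rightarrow> (nat \<times> nat) set \<Rightarrow> (nat \<times> nat) set" where
  "ES n m r R = {(i, j). (Reg i, Reg j) \<in> shadow_set (EXR n m r R)}"

definition es :: "nat \<Rightarrow> nat \<Rightarrow> nat \<Rightarrow> (nat \<times> nat) set \<Rightarrow> mpoly" where
  "es n m r R = (\<Prod>v\<in>ES n m r R. var v)"

end

theory Submission
  imports Defs "HOL-Library.Function_Algebras"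
begin

text \<open>
  Call a rook placement \<open>Q\<close> on the board good if every increasing chain of \<open>k\<close> rooks ending in
  column \<open>b\<close> has at least \<open>k - (n - r)\<close> rook-free columns to its left, and symmetrically for rows.
  Three facts give the theorem.

  (1) Reverse Schensted insertion shows that every good \<open>Q\<close> is an extended shadow set.

  (2) If a chain \<open>C\<close> of \<open>Q\<close> violates the bound, replace in \<open>Q\<close> the factor of \<open>C\<close> by the sum of
  all injections of its rows into its columns and the columns to the right of it.  Expanding the
  row sums over the remaining columns shows that this polynomial lies in \<open>I\<close>, and for a diagonal
  order its leading monomial is that of \<open>Q\<close>.  Hence the good monomials span modulo \<open>I\<close>.

  (3) The generators of \<open>I\<close> are top components of polynomials vanishing on \<open>UZ\<close>, so by induction
  on the degree the good monomials also span the functions on \<open>UZ\<close>.  By (1) there are at most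
  \<open>|UZ|\<close> of them, so they are a basis; this makes them linearly independent modulo \<open>I\<close> and
  forces every top component of a vanishing polynomial into \<open>I\<close>.
\<close>

section \<open>Shadow lines and insertion\<close>

text \<open>The constant \<open>n - r\<close> has two origins that agree. It is the number of
  overlined second coordinates: once \<open>Q\<close> is read inside the extended index set, these
  are free values below all regular ones, and the bound holds there with constant 0. It is also one
  less than the number of row sums multiplied in a generator of the ideal, so a chain that violates
  the bound has just enough rows for a generator to act on it. The same holds for
  \<open>m - r\<close> with the coordinates exchanged. Only one inclusion is proved combinatorially:
  good placements are extended shadow sets. That every extended shadow monomial is good is deduced
  at the end by comparing cardinalities. The obstacle in (1) is that reverse insertion yields merely
  some set with one point in each column and row; it has to be recognised as an extended placement.
  This works because a descent among overlined points would create a corner with an overlined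
  coordinate. In (3) a reduction modulo the ideal must preserve the degree and descend in the
  monomial order at once: the degree ties the ideal to the vanishing polynomials, the order ties it
  to the initial ideal.\<close>

definition increasing_chain :: "('a::linorder \<times> 'b::linorder) set \<Rightarrow> bool" where
  "increasing_chain C \<longleftrightarrow> (\<forall>p\<in>C. \<forall>q\<in>C. fst p < fst q \<longleftrightarrow> snd p < snd q)"

text \<open>\<open>Y\<close> is the supply of second coordinates, and \<open>c\<close> is an
  allowance for further free values below them. Only second coordinates are counted; the companion
  bound is the same statement for the swapped set. The empty chain has no endpoint \<open>e\<close>
  and gives no condition.\<close>

definition chain_bound :: "nat \<Rightarrow> 'b set \<Rightarrow> ('a::linorder \<times> 'b::linorder) set \<Rightarrow> bool" where
  "chain_bound c Y Q \<longleftrightarrow>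
     (\<forall>C e. C \<subseteq> Q \<longrightarrow> increasing_chain C \<longrightarrow> e \<in> C \<longrightarrow> (\<forall>p\<in>C. snd p \<le> snd e) \<longrightarrow>
        card C \<le> c + card {y \<in> Y - snd ` Q. y < snd e})"

lemma shadow_set_empty [simp]: "shadow_set {} = {}"
proof -
  have "((\<lambda>B. B - minimal_points B) ^^ k) {} = {}" for k
    by (induction k) auto
  then show ?thesis
    by (auto simp: shadow_set_def northeast_corners_def minimal_points_def)
qed

section \<open>Peeling off shadow lines\<close>

lemma shadow_set_rec:
  "shadow_set A = northeast_corners (minimal_points A) \<union> shadow_set (A - minimal_points A)"
proof -
  have "shadow_set A = northeast_corners (minimal_points (((\<lambda>B. B - minimal_points B) ^^ 0) A)) \<union>
    (\<Union>k. northeast_corners (minimal_points (((\<lambda>B. B - minimal_points B) ^^ Suc k) A)))"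
    unfolding shadow_set_def
  proof (intro equalityI subsetI)
    fix p assume "p \<in> (\<Union>k. northeast_corners (minimal_points (((\<lambda>B. B - minimal_points B) ^^ k) A)))"
    then obtain k where k: "p \<in> northeast_corners (minimal_points (((\<lambda>B. B - minimal_points B) ^^ k) A))"
      by blast
    then show "p \<in> northeast_corners (minimal_points (((\<lambda>B. B - minimal_points B) ^^ 0) A)) \<union>
      (\<Union>k. northeast_corners (minimal_points (((\<lambda>B. B - minimal_points B) ^^ Suc k) A)))"
      by (cases k) blast+
  qed blast
  then show ?thesis
    by (simp add: shadow_set_def funpow_Suc_right del: funpow.simps(2))
qed

lemma minimal_points_subset: "minimal_points A \<subseteq> A"
  by (auto simp: minimal_points_def)

text \<open>The leftmost among the points weakly below and to the left of \<open>p\<close> is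
  minimal in \<open>A\<close>; injectivity of \<open>fst\<close> excludes a tie.\<close>

lemma minimal_point_below:
  assumes "finite A" "inj_on fst A" "p \<in> A"
  obtains q where "q \<in> minimal_points A" "fst q \<le> fst p" "snd q \<le> snd p"
proof -
  let ?B = "{q \<in> A. fst q \<le> fst p \<and> snd q \<le> snd p}"
  have B: "finite (fst ` ?B)" using assms by auto
  moreover have "fst ` ?B \<noteq> {}" using assms by blast
  ultimately obtain q where q: "q \<in> ?B" "fst q = Min (fst ` ?B)"
    using Min_in by (metis (no_types, lifting) imageE)
  have "q \<in> minimal_points A"
    unfolding minimal_points_def
  proof (intro CollectI conjI notI)
    show "q \<in> A" using q by auto
    assume "\<exists>s\<in>A. s \<noteq> q \<and> fst s \<le> fst q \<and> snd s \<le> snd q"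
    then obtain s where s: "s \<in> A" "s \<noteq> q" "fst s \<le> fst q" "snd s \<le> snd q" by blast
    then have "s \<in> ?B" using q by auto
    then have "fst q = fst s" using Min_le[OF B] q(2) s(3) by (metis (no_types, lifting) antisym imageI)
    then show False using s q assms(2) by (metis (no_types, lifting) inj_onD mem_Collect_eq)
  qed
  then show ?thesis using q that by auto
qed

lemma minimal_points_antichain:
  assumes "p \<in> minimal_points A" "q \<in> minimal_points A" "fst p < fst q"
  shows "snd q < snd p"
proof (rule ccontr)
  assume "\<not> snd q < snd p"
  then have "p \<in> A" "p \<noteq> q" "fst p \<le> fst q" "snd p \<le> snd q"
    using assms minimal_points_subset by auto
  then show False using assms(2) unfolding minimal_points_def by blast
qed

text \<open>The nearest point to the left of \<open>q\<close> supplies the corner. Dually, in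
  \<open>corner_above\<close>, the nearest point to the right of \<open>p\<close> gives a corner at
  the height of \<open>p\<close>.\<close>

lemma corner_right:
  assumes "finite M" "p \<in> M" "q \<in> M" "fst p < fst q"
  shows "\<exists>y. (fst q, y) \<in> northeast_corners M"
proof -
  let ?B = "{s \<in> M. fst s < fst q}"
  have B: "finite (fst ` ?B)" using assms by auto
  moreover have "fst ` ?B \<noteq> {}" using assms by blast
  ultimately obtain s where s: "s \<in> ?B" "fst s = Max (fst ` ?B)"
    using Max_in by (metis (no_types, lifting) imageE)
  have "\<not> (fst s < fst t \<and> fst t < fst q)" if "t \<in> M" for t
    using B(1) s(2) that Max_ge[OF B(1), of "fst t"] by fastforce
  then have "(fst q, snd s) \<in> northeast_corners M"
    using s assms unfolding northeast_corners_def by blast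
  then show ?thesis by blast
qed

lemma corner_above:
  assumes "finite M" "p \<in> M" "q \<in> M" "fst p < fst q"
  shows "\<exists>x. (x, snd p) \<in> northeast_corners M"
proof -
  let ?B = "{s \<in> M. fst p < fst s}"
  have B: "finite (fst ` ?B)" using assms by auto
  moreover have "fst ` ?B \<noteq> {}" using assms by blast
  ultimately obtain s where s: "s \<in> ?B" "fst s = Min (fst ` ?B)"
    using Min_in by (metis (no_types, lifting) imageE)
  have "\<not> (fst p < fst t \<and> fst t < fst s)" if "t \<in> M" for t
    using B(1) s(2) that Min_le[OF B(1), of "fst t"] by fastforce
  then have "(fst s, snd p) \<in> northeast_corners M"
    using s assms unfolding northeast_corners_def by blast
  then show ?thesis by blast
qed

text \<open>Induction along the shadow lines: a nonempty finite \<open>A\<close> has a minimal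
  point, so deleting the first line makes it smaller, and both injectivity conditions pass to
  subsets.\<close>

lemma peel_induct [consumes 3, case_names empty peel]:
  fixes A :: "('a::linorder \<times> 'b::linorder) set"
  assumes "finite A" "inj_on fst A" "inj_on snd A" 
    and empty: "P {}"
    and peel: "\<And>A. \<lbrakk>finite A; inj_on fst A; inj_on snd A; A \<noteq> {}; minimal_points A \<noteq> {};
      P (A - minimal_points A)\<rbrakk> \<Longrightarrow> P A"
  shows "P A"
  using assms(1-3)
proof (induction "card A" arbitrary: A rule: less_induct)
  case less
  show ?case
  proof (cases "A = {}")
    case False
    then have M: "minimal_points A \<noteq> {}"
      using minimal_point_below[OF less(2,3)] by (metis all_not_in_conv)
    have "A - minimal_points A \<subset> A" using M minimal_points_subset[of A] by blast
    then have "card (A - minimal_points A) < card A" using less(2) by (rule psubset_card_mono[rotated])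
    then have "P (A - minimal_points A)"
      using less by (meson finite_Diff inj_on_diff)
    then show ?thesis using peel less M False by blast
  qed (use empty in simp)
qed

lemma shadow_set_subset:
  assumes "finite A" "inj_on fst A" "inj_on snd A"
  shows "shadow_set A \<subseteq> fst ` A \<times> snd ` A"
  using assms
proof (induction rule: peel_induct)
  case (peel A)
  have "northeast_corners (minimal_points A) \<subseteq> fst ` A \<times> snd ` A"
    using minimal_points_subset[of A] unfolding northeast_corners_def by blast
  moreover have "shadow_set (A - minimal_points A) \<subseteq> fst ` A \<times> snd ` A"
    using peel(6) by blast
  ultimately show ?case using shadow_set_rec[of A] by blast
qed simp

section \<open>The bottom row and Schensted insertion\<close>

text \<open>The entries of the first row of the Schensted insertion tableau.\<close>

definition bottom_row :: "('a::linorder \<times> 'b::linorder) set \<Rightarrow> 'b set" where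
  "bottom_row A = snd ` A - snd ` shadow_set A"

lemma Min_snd_minimal_points:
  assumes "finite A" "inj_on fst A" "A \<noteq> {}"
  shows "Min (snd ` minimal_points A) = Min (snd ` A)"
proof -
  have fin: "finite (snd ` A)" "finite (snd ` minimal_points A)"
    using assms finite_subset[OF minimal_points_subset] by auto
  obtain p where p: "p \<in> A" "snd p = Min (snd ` A)"
    using Min_in[OF fin(1)] assms(3) by fastforce
  obtain q where q: "q \<in> minimal_points A" "snd q \<le> snd p"
    using minimal_point_below[OF assms(1,2) p(1)] by blast
  show ?thesis
  proof (rule Min_eqI[OF fin(2)])
    show "Min (snd ` A) \<in> snd ` minimal_points A"
      using p q fin minimal_points_subset[of A]
      by (metis Min_le antisym image_eqI subsetD)
    show "Min (snd ` A) \<le> y" if "y \<in> snd ` minimal_points A" for y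
      using that fin minimal_points_subset[of A] by (intro Min_le) auto
  qed
qed

text \<open>A shadow line descends from left to right, and each of its points except the last has a
  corner at its own height. The last point is the lowest, and its height is the minimum over all of
  \<open>A\<close>.\<close>

lemma snd_corners:
  assumes "finite A" "inj_on fst A" "A \<noteq> {}"
  shows "snd ` northeast_corners (minimal_points A) = snd ` minimal_points A - {Min (snd ` A)}"
    (is "snd ` northeast_corners ?M = _")
proof
  have fin: "finite ?M" "finite (snd ` ?M)"
    using assms finite_subset[OF minimal_points_subset] by auto
  show "snd ` northeast_corners ?M \<subseteq> snd ` ?M - {Min (snd ` A)}"
  proof
    fix y assume "y \<in> snd ` northeast_corners ?M"
    then obtain p q where pq: "p \<in> ?M" "q \<in> ?M" "fst p < fst q" "y = snd p"
      unfolding northeast_corners_def by auto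
    have "snd q < snd p" using minimal_points_antichain pq by blast
    moreover have "Min (snd ` A) \<le> snd q"
      using pq minimal_points_subset[of A] assms(1) by (intro Min_le) auto
    ultimately show "y \<in> snd ` ?M - {Min (snd ` A)}" using pq by auto
  qed
  show "snd ` ?M - {Min (snd ` A)} \<subseteq> snd ` northeast_corners ?M"
  proof
    fix y assume y: "y \<in> snd ` ?M - {Min (snd ` A)}"
    then obtain p where p: "p \<in> ?M" "y = snd p" by auto
    obtain q where q: "q \<in> ?M" "snd q = Min (snd ` ?M)"
      using Min_in[OF fin(2)] p(1) by (metis empty_iff imageE imageI)
    have lt: "snd q < snd p"
      using y p q fin Min_snd_minimal_points[OF assms] 
      by (metis (no_types, lifting) DiffD2 Min_le image_eqI insertCI order_le_imp_less_or_eq)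
    then have "fst p < fst q"
    proof (cases "fst p" "fst q" rule: linorder_cases)
      case equal
      then have "p = q" using assms(2) p q minimal_points_subset[of A] by (meson inj_onD subsetD)
      then show ?thesis using lt by simp
    next
      case greater
      then show ?thesis using minimal_points_antichain[OF q(1) p(1)] lt by simp
    qed simp
    then show "y \<in> snd ` northeast_corners ?M"
      using corner_above[OF fin(1) p(1) q(1)] p(2) by (metis imageI snd_conv)
  qed
qed

text \<open>Each shadow line leaves exactly one entry in the bottom row, the height of its lowest
  point; successive lines give the row in increasing order.\<close>

lemma bottom_row_rec:
  assumes "finite A" "inj_on fst A" "inj_on snd A" "A \<noteq> {}"
  shows "bottom_row A = insert (Min (snd ` A)) (bottom_row (A - minimal_points A))"
    (is "_ = insert ?y (bottom_row (A - ?M))")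
proof -
  have sub: "?M \<subseteq> A" by (rule minimal_points_subset)
  have S: "snd ` shadow_set A = (snd ` ?M - {?y}) \<union> snd ` shadow_set (A - ?M)"
    by (subst shadow_set_rec) (simp add: image_Un snd_corners[OF assms(1,2,4)])
  have "shadow_set (A - ?M) \<subseteq> fst ` (A - ?M) \<times> snd ` (A - ?M)"
    using assms(1-3) by (intro shadow_set_subset finite_Diff inj_on_diff)
  then have sub': "snd ` shadow_set (A - ?M) \<subseteq> snd ` (A - ?M)" by auto
  have disj: "snd ` (A - ?M) \<inter> snd ` ?M = {}"
    using assms(3) sub by (auto dest: inj_onD)
  have y: "?y \<in> snd ` ?M"
  proof -
    have "?M \<noteq> {}" using minimal_point_below[OF assms(1,2)] assms(4) by (metis ex_in_conv)
    then show ?thesis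
      using Min_in[of "snd ` ?M"] finite_subset[OF sub assms(1)]
      unfolding Min_snd_minimal_points[OF assms(1,2,4)] by simp
  qed
  have A: "snd ` A = snd ` (A - ?M) \<union> snd ` ?M" using sub by blast
  have "(P \<union> M) - ((M - {z}) \<union> P') = insert z (P - P')"
    if "P' \<subseteq> P" "P \<inter> M = {}" "z \<in> M" for P P' M :: "'b set" and z
    using that by blast
  from this[OF sub' disj y] show ?thesis
    unfolding bottom_row_def S using A by simp
qed

lemma finite_bottom_row: "finite A \<Longrightarrow> finite (bottom_row A)"
  by (simp add: bottom_row_def)

text \<open>Schensted row insertion: a new point to the right of everything inserts \<open>y\<close>
  into the bottom row. The least entry above \<open>y\<close>, if there is one, is bumped and
  becomes the height of the only new corner. The induction follows the new point through the lines
  until it joins one.\<close>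

lemma shadow_set_insert:
  assumes "finite A" "inj_on fst A" "inj_on snd A"
    and "\<And>p. p \<in> A \<Longrightarrow> fst p < x" "y \<notin> snd ` A"
  shows "shadow_set (insert (x, y) A) = shadow_set A \<union>
    (let B = {b \<in> bottom_row A. y < b} in if B = {} then {} else {(x, Min B)})"
  using assms
proof (induction rule: peel_induct)
  case empty
  have "minimal_points {(x, y)} = {(x, y)}" by (auto simp: minimal_points_def)
  then have "shadow_set {(x, y)} = northeast_corners {(x, y)}"
    by (subst shadow_set_rec) simp
  then show ?case by (simp add: bottom_row_def northeast_corners_def)
next
  case (peel A)
  let ?p = "(x, y)" and ?M = "minimal_points A" and ?m = "Min (snd ` A)"
  have sub: "?M \<subseteq> A" by (rule minimal_points_subset)
  have fin: "finite ?M" "finite (snd ` A)" using peel(1) finite_subset[OF sub] by auto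
  \<comment> \<open>\<open>s\<close> is the lowest and also the last point of the first line, so a
    new corner on this line can only lie between \<open>s\<close> and the new point.\<close>
  obtain s where s: "s \<in> ?M" "snd s = ?m"
    using Min_in[of "snd ` ?M"] fin Min_snd_minimal_points[OF peel(1,2,4)] peel(5) by fastforce
  have le_m: "?m \<le> snd q" if "q \<in> A" for q using that fin by auto
  have s_last: "fst q \<le> fst s" if "q \<in> ?M" for q
  proof (rule ccontr)
    assume "\<not> fst q \<le> fst s"
    then have "snd q < snd s" using that s minimal_points_antichain[of s A q] by simp
    then show False using le_m[of q] that s sub by auto
  qed
  have ym: "y \<noteq> ?m" using s(1) sub peel(8) by (metis imageI s(2) subsetD)
  have notin: "?p \<notin> A" using peel(7) by fastforce
  show ?case
  proof (cases "y < ?m")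
    \<comment> \<open>The new point lies below all of \<open>A\<close>: it prolongs the first line
      beyond \<open>s\<close>, the other lines stay as they were, and \<open>?m\<close> is the least
      bottom-row entry above \<open>y\<close>.\<close>
    case True
    have "minimal_points (insert ?p A) = insert ?p ?M"
    proof (intro equalityI subsetI)
      fix q assume "q \<in> minimal_points (insert ?p A)"
      then show "q \<in> insert ?p ?M" unfolding minimal_points_def by blast
    next
      fix q assume q: "q \<in> insert ?p ?M"
      show "q \<in> minimal_points (insert ?p A)"
      proof (cases "q = ?p")
        case True
        then show ?thesis
          using \<open>y < ?m\<close> le_m unfolding minimal_points_def by force
      next
        case False
        then have "\<not> fst ?p \<le> fst q" using q sub peel(7)[of q] by auto
        then show ?thesis using False q unfolding minimal_points_def by blast
      qed
    qed
    moreover have "insert ?p A - insert ?p ?M = A - ?M" using notin by blast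
    moreover have "northeast_corners (insert ?p ?M) = insert (x, ?m) (northeast_corners ?M)"
    proof (intro equalityI subsetI)
      fix c assume "c \<in> northeast_corners (insert ?p ?M)"
      then obtain a b where c: "a \<in> insert ?p ?M" "b \<in> insert ?p ?M" "fst a < fst b" "c = (fst b, snd a)"
        "\<forall>t\<in>insert ?p ?M. \<not> (fst a < fst t \<and> fst t < fst b)"
        unfolding northeast_corners_def by blast
      have a: "a \<in> ?M" using c sub peel(7) by (metis fst_conv insert_iff less_asym subsetD order_less_irrefl)
      show "c \<in> insert (x, ?m) (northeast_corners ?M)"
      proof (cases "b = ?p")
        case True
        have "fst s < fst b" using True s(1) sub peel(7)[of s] by auto
        then have "\<not> fst a < fst s" using c(5) s(1) by blast
        then have "fst a = fst s" using s_last[OF a] by simp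
        then have "a = s" using peel(2) a s sub by (meson inj_onD subsetD)
        then show ?thesis using True c s by simp
      next
        case False
        then show ?thesis using a c unfolding northeast_corners_def by blast
      qed
    next
      fix c assume c: "c \<in> insert (x, ?m) (northeast_corners ?M)"
      show "c \<in> northeast_corners (insert ?p ?M)"
      proof (cases "c = (x, ?m)")
        case True
        have "fst s < fst ?p" using s sub peel(7)[of s] by auto
        moreover have "\<not> (fst s < fst t \<and> fst t < fst ?p)" if "t \<in> insert ?p ?M" for t
          using that s_last by fastforce
        ultimately show ?thesis
          using s True unfolding northeast_corners_def
          by (intro CollectI exI[of _ s] exI[of _ ?p]) auto
      next
        case False
        then obtain a b where c: "a \<in> ?M" "b \<in> ?M" "fst a < fst b" "c = (fst b, snd a)"
          "\<forall>t\<in>?M. \<not> (fst a < fst t \<and> fst t < fst b)"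
          using c unfolding northeast_corners_def by blast
        moreover have "\<not> fst ?p < fst b" using c(2) sub peel(7)[of b] by auto
        ultimately show ?thesis unfolding northeast_corners_def by blast
      qed
    qed
    moreover have "{b \<in> bottom_row A. y < b} \<noteq> {}" "Min {b \<in> bottom_row A. y < b} = ?m"
    proof -
      have m: "?m \<in> bottom_row A" using bottom_row_rec[OF peel(1-4)] by simp
      then show "{b \<in> bottom_row A. y < b} \<noteq> {}" using True by blast
      show "Min {b \<in> bottom_row A. y < b} = ?m"
        using m True finite_bottom_row[OF peel(1)] fin
        by (intro Min_eqI) (auto simp: bottom_row_def)
    qed
    ultimately show ?thesis
      using shadow_set_rec[of "insert ?p A"] shadow_set_rec[of A] by (auto simp: Let_def)
  next
    \<comment> \<open>\<open>s\<close> lies below and to the left of the new point, which is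
      therefore passed on to the later lines. The entry \<open>?m\<close> contributed by the first
      line is below \<open>y\<close> and does not affect which entry is bumped.\<close>
    case False
    then have "?m < y" using ym by simp
    have "?p \<notin> minimal_points (insert ?p A)"
    proof -
      have "s \<in> A" "s \<noteq> ?p" "fst s \<le> fst ?p" "snd s \<le> snd ?p"
        using s sub notin \<open>?m < y\<close> peel(7)[of s] by auto
      then show ?thesis unfolding minimal_points_def by blast
    qed
    moreover have "minimal_points (insert ?p A) - {?p} = ?M"
    proof (intro equalityI subsetI)
      fix q assume "q \<in> minimal_points (insert ?p A) - {?p}"
      then show "q \<in> ?M" unfolding minimal_points_def by blast
    next
      fix q assume q: "q \<in> ?M"
      then have "\<not> fst ?p \<le> fst q" "q \<noteq> ?p" using sub peel(7)[of q] notin by auto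
      then show "q \<in> minimal_points (insert ?p A) - {?p}"
        using q unfolding minimal_points_def by blast
    qed
    ultimately have "minimal_points (insert ?p A) = ?M" by blast
    moreover have "insert ?p A - ?M = insert ?p (A - ?M)" using notin sub by blast
    moreover have "{b \<in> bottom_row A. y < b} = {b \<in> bottom_row (A - ?M). y < b}"
      using bottom_row_rec[OF peel(1-4)] \<open>?m < y\<close> by auto
    moreover have "shadow_set (insert ?p (A - ?M)) = shadow_set (A - ?M) \<union>
      (let B = {b \<in> bottom_row (A - ?M). y < b} in if B = {} then {} else {(x, Min B)})"
      using peel by blast
    ultimately show ?thesis
      using shadow_set_rec[of "insert ?p A"] shadow_set_rec[of A] by (simp add: Un_assoc)
  qed
qed

section \<open>Chain bounds and reverse insertion\<close>

text \<open>This symmetry is the reason for the equivalence in the definition of a chain; on a rook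
  placement it amounts to strict increase in both coordinates.\<close>

lemma increasing_chain_swap: "increasing_chain (prod.swap ` C) \<longleftrightarrow> increasing_chain C"
  by (auto simp: increasing_chain_def)

lemma chain_boundD:
  assumes "chain_bound c Y Q" "C \<subseteq> Q" "increasing_chain C" "e \<in> C" "\<And>p. p \<in> C \<Longrightarrow> snd p \<le> snd e"
  shows "card C \<le> c + card {y \<in> Y - snd ` Q. y < snd e}"
  using assms unfolding chain_bound_def by blast

text \<open>
  The inverse of the Schensted insertion: the columns are removed from right to left, and at a
  column occupied by a point of \<open>Q\<close> that point is bumped back into the bottom row.  The chain
  bounds are what keeps this reverse bumping possible.
\<close>

theorem shadow_set_surj:
  fixes X :: "'a::linorder set" and Y :: "'b::linorder set"
  assumes "finite X" "finite Y" "card X = card Y" "Q \<subseteq> X \<times> Y" "inj_on fst Q" "inj_on snd Q"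
    and "chain_bound 0 Y Q" "chain_bound 0 X (prod.swap ` Q)"
  obtains A where "finite A" "fst ` A = X" "snd ` A = Y" "inj_on fst A" "inj_on snd A"
    "shadow_set A = Q"
proof -
  have "\<exists>A. finite A \<and> fst ` A = X \<and> snd ` A = Y \<and> inj_on fst A \<and> inj_on snd A \<and> shadow_set A = Q"
    using assms
  proof (induction X arbitrary: Y Q rule: finite_linorder_max_induct)
    case empty
    then show ?case by (intro exI[of _ "{}"]) auto
  next
    case (insert x X)
    note Y = insert.prems(1) and card = insert.prems(2) and Q = insert.prems(3)
      and inj = insert.prems(4,5) and ybound = insert.prems(6) and xbound = insert.prems(7)
    \<comment> \<open>\<open>U\<close> is the bottom row that the set sought must have, as its
      second coordinates are to be \<open>Y\<close> and its corners \<open>Q\<close>.\<close>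
    define U where "U = Y - snd ` Q"
    have finQ: "finite Q" using Q Y insert(1) by (meson finite_SigmaI finite_insert finite_subset)
    have finU: "finite U" using Y by (simp add: U_def)
    have x: "x \<notin> X" using insert(2) by auto
    have "card U = card Y - card Q"
      using Q finQ inj unfolding U_def by (subst card_Diff_subset) (auto simp: card_image)
    moreover have "card (insert x X - fst ` Q) = card (insert x X) - card Q"
      using Q finQ inj by (subst card_Diff_subset) (auto simp: card_image)
    ultimately have cardU: "card (insert x X - fst ` Q) = card U" using card by simp
    \<comment> \<open>In a chain the point with the largest second coordinate also has the largest
      first coordinate, so the swapped bound applies with the same endpoint.\<close>
    have xb: "card C \<le> card {u \<in> insert x X - fst ` Q. u < fst e}"
      if "C \<subseteq> Q" "increasing_chain C" "e \<in> C" "\<And>p. p \<in> C \<Longrightarrow> snd p \<le> snd e" for C e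
    proof -
      have "\<not> fst e < fst p" if "p \<in> C" for p
        using that \<open>\<And>p. p \<in> C \<Longrightarrow> snd p \<le> snd e\<close>[of p] \<open>e \<in> C\<close> \<open>increasing_chain C\<close>
        unfolding increasing_chain_def by (metis leD)
      then have "card (prod.swap ` C) \<le> 0 + card {u \<in> insert x X - snd ` prod.swap ` Q. u < snd (prod.swap e)}"
        using that by (intro chain_boundD[OF xbound]) (auto simp: increasing_chain_swap not_less)
      then show ?thesis by (simp add: card_image image_image)
    qed
    show ?case
    proof (cases "x \<in> fst ` Q")
      \<comment> \<open>No corner in column \<open>x\<close>: the last insertion bumped nothing, so
        the entry to remove is the largest one of the bottom row.\<close>
      case False
      have QX: "Q \<subseteq> X \<times> Y" using Q False by force
      have "card U \<noteq> 0" using False insert(1) unfolding cardU[symmetric] by auto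
      then have "U \<noteq> {}" by auto
      define y where "y = Max U"
      have y: "y \<in> U" "\<And>u. u \<in> U \<Longrightarrow> u \<le> y"
        using finU \<open>U \<noteq> {}\<close> by (auto simp: y_def)
      have yY: "y \<in> Y" "y \<notin> snd ` Q" using y by (auto simp: U_def)
      have U': "Y - {y} - snd ` Q = U - {y}" by (auto simp: U_def)
      have "\<exists>A. finite A \<and> fst ` A = X \<and> snd ` A = Y - {y} \<and> inj_on fst A \<and> inj_on snd A \<and> shadow_set A = Q"
      proof (rule insert.IH)
        show "card X = card (Y - {y})" using card yY(1) x insert(1) by simp
        show "Q \<subseteq> X \<times> (Y - {y})" using QX yY by force
        show "chain_bound 0 X (prod.swap ` Q)"
          unfolding chain_bound_def
        proof (intro allI impI)
          fix C e assume C: "C \<subseteq> prod.swap ` Q" "increasing_chain C" "e \<in> C" "\<forall>p\<in>C. snd p \<le> snd e"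
          have "snd e < x" using C(1,3) QX insert(2) by force
          then have "{u \<in> insert x X - snd ` prod.swap ` Q. u < snd e} = {u \<in> X - snd ` prod.swap ` Q. u < snd e}"
            by auto
          then show "card C \<le> 0 + card {u \<in> X - snd ` prod.swap ` Q. u < snd e}"
            using chain_boundD[OF xbound C(1-3)] C(4) by simp
        qed
        show "chain_bound 0 (Y - {y}) Q"
          unfolding chain_bound_def U'
        proof (intro allI impI)
          fix C e assume C: "C \<subseteq> Q" "increasing_chain C" "e \<in> C" "\<forall>p\<in>C. snd p \<le> snd e"
          show "card C \<le> 0 + card {u \<in> U - {y}. u < snd e}"
          proof (cases "y < snd e")
            \<comment> \<open>All of \<open>U\<close> lies below the endpoint, so removing
              \<open>y\<close> costs one free value. The other bound pays for it: \<open>x\<close>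
              is a free first coordinate beyond the endpoint, so the count given by
              \<open>xb\<close> is already strictly below \<open>card U\<close>.\<close>
            case True
            then have eq: "{u \<in> U - {y}. u < snd e} = U - {y}" using y by force
            have "fst e < x" using C(1,3) QX insert(2) by force
            have "card C \<le> card {u \<in> insert x X - fst ` Q. u < fst e}" using xb C by blast
            also have "\<dots> < card (insert x X - fst ` Q)"
            proof (rule psubset_card_mono)
              have "x \<in> insert x X - fst ` Q" "x \<notin> {u \<in> insert x X - fst ` Q. u < fst e}"
                using False \<open>fst e < x\<close> by auto
              then show "{u \<in> insert x X - fst ` Q. u < fst e} \<subset> insert x X - fst ` Q" by blast
            qed (use insert(1) in simp)
            finally show ?thesis using cardU eq y(1) finU by simp
          next
            case False
            then have "{u \<in> U - {y}. u < snd e} = {u \<in> U. u < snd e}" by auto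
            then show ?thesis using chain_boundD[OF ybound C(1-3)] C(4) by (simp add: U_def)
          qed
        qed
      qed (use Y inj in auto)
      then obtain A where A: "finite A" "fst ` A = X" "snd ` A = Y - {y}" "inj_on fst A" "inj_on snd A"
        "shadow_set A = Q" by blast
      have "{b \<in> bottom_row A. y < b} = {}"
        using y(2) by (force simp: bottom_row_def A(3,6) U')
      then have "shadow_set (insert (x, y) A) = Q"
        using shadow_set_insert[OF A(1,4,5), of x y] insert(2) A by auto
      moreover have "inj_on fst (insert (x, y) A)" "inj_on snd (insert (x, y) A)"
        using A x by auto
      ultimately show ?thesis using A yY by (intro exI[of _ "insert (x, y) A"]) auto
    next
      \<comment> \<open>Here the last insertion bumped \<open>b\<close>. Undoing it takes the
        largest bottom-row entry below \<open>b\<close> out of the row and puts \<open>b\<close>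
        back in its place.\<close>
      case True
      then obtain b where b: "(x, b) \<in> Q" by auto
      define Q' where "Q' = Q - {(x, b)}"
      define D where "D = {u \<in> U. u < b}"
      have Q': "fst p < x \<and> snd p \<noteq> b" if "p \<in> Q'" for p
      proof -
        have "p \<in> Q" "p \<noteq> (x, b)" using that by (auto simp: Q'_def)
        then have "fst p \<noteq> x" "snd p \<noteq> b"
          using inj_onD[OF inj(1) _ _ b, of p] inj_onD[OF inj(2) _ _ b, of p] by auto
        then show ?thesis using \<open>p \<in> Q\<close> Q insert(2) by auto
      qed
      have finD: "finite D" using finU by (simp add: D_def)
      \<comment> \<open>Appending \<open>(x, b)\<close> to a chain below \<open>b\<close> gives a
        longer chain of \<open>Q\<close>, so such chains have one free value to spare. For the empty
        chain this says that \<open>D\<close> is nonempty, so there is an entry to exchange for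
        \<open>b\<close>.\<close>
      have ext: "Suc (card C) \<le> card D"
        if "C \<subseteq> Q'" "increasing_chain C" "\<And>p. p \<in> C \<Longrightarrow> snd p < b" for C
      proof -
        have key: "fst c < x" "snd c < b" "\<not> x < fst c" "\<not> b < snd c" if "c \<in> C" for c
          using Q'[of c] \<open>C \<subseteq> Q'\<close> \<open>\<And>p. p \<in> C \<Longrightarrow> snd p < b\<close>[OF that] that
          by (auto dest: less_asym)
        have "increasing_chain (insert (x, b) C)"
          unfolding increasing_chain_def
        proof (intro ballI)
          fix p q assume "p \<in> insert (x, b) C" "q \<in> insert (x, b) C"
          then show "(fst p < fst q) = (snd p < snd q)"
            using that(2) key[of p] key[of q] unfolding increasing_chain_def
            by (elim insertE) simp_all
        qed
        then have "card (insert (x, b) C) \<le> 0 + card {u \<in> Y - snd ` Q. u < snd (x, b)}"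
          using that b by (intro chain_boundD[OF ybound]) (auto simp: Q'_def less_imp_le)
        moreover have "(x, b) \<notin> C" "finite C" using that(1) finQ by (auto simp: Q'_def dest: finite_subset)
        ultimately show ?thesis by (simp add: D_def U_def)
      qed
      have "D \<noteq> {}" using ext[of "{}"] by (auto simp: increasing_chain_def)
      define y where "y = Max D"
      have y: "y \<in> D" "\<And>u. u \<in> D \<Longrightarrow> u \<le> y"
        using finD \<open>D \<noteq> {}\<close> by (auto simp: y_def)
      have yb: "y < b" "y \<in> U" "y \<in> Y" "y \<notin> snd ` Q" using y(1) by (auto simp: D_def U_def)
      have bY: "b \<in> Y" "b \<notin> U" using b Q by (force simp: U_def)+
      have U': "Y - {y} - snd ` Q' = insert b (U - {y})"
      proof -
        have "snd ` Q = insert b (snd ` Q')" using b by (force simp: Q'_def)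
        moreover have "b \<notin> snd ` Q'" using Q' by auto
        ultimately show ?thesis using bY yb by (auto simp: U_def)
      qed
      have fst': "X - fst ` Q' = insert x X - fst ` Q"
      proof -
        have "fst ` Q = insert x (fst ` Q')" using b by (force simp: Q'_def)
        then show ?thesis using x by auto
      qed
      have "\<exists>A. finite A \<and> fst ` A = X \<and> snd ` A = Y - {y} \<and> inj_on fst A \<and> inj_on snd A \<and> shadow_set A = Q'"
      proof (rule insert.IH)
        show "card X = card (Y - {y})" using card yb(3) x insert(1) by simp
        show "Q' \<subseteq> X \<times> (Y - {y})" using Q Q' yb by (force simp: Q'_def)
        show "inj_on fst Q'" "inj_on snd Q'" using inj by (auto simp: Q'_def intro: inj_on_diff)
        show "chain_bound 0 X (prod.swap ` Q')"
          unfolding chain_bound_def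
        proof (intro allI impI)
          fix C e assume C: "C \<subseteq> prod.swap ` Q'" "increasing_chain C" "e \<in> C" "\<forall>p\<in>C. snd p \<le> snd e"
          then have "C \<subseteq> prod.swap ` Q" by (auto simp: Q'_def)
          then show "card C \<le> 0 + card {u \<in> X - snd ` prod.swap ` Q'. u < snd e}"
            using chain_boundD[OF xbound _ C(2,3)] C(4) fst' by (simp add: image_image)
        qed
        show "chain_bound 0 (Y - {y}) Q'"
          unfolding chain_bound_def U'
        proof (intro allI impI)
          fix C e assume C: "C \<subseteq> Q'" "increasing_chain C" "e \<in> C" "\<forall>p\<in>C. snd p \<le> snd e"
          have CQ: "C \<subseteq> Q" using C(1) by (auto simp: Q'_def)
          have bound: "card C \<le> card {u \<in> U. u < snd e}"
            using chain_boundD[OF ybound CQ C(2,3)] C(4) by (simp add: U_def)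
          have "snd e \<noteq> b" using Q' C by blast
          then consider "b < snd e" | "snd e < b" "y < snd e" | "snd e < b" "snd e \<le> y"
            by fastforce
          then show "card C \<le> 0 + card {u \<in> insert b (U - {y}). u < snd e}"
          proof cases
            \<comment> \<open>Exchanging \<open>y\<close> for \<open>b\<close> keeps the number of
              free values below the endpoint.\<close>
            case 1
            have "{u \<in> insert b (U - {y}). u < snd e} = insert b ({u \<in> U. u < snd e} - {y})"
              using 1 by auto
            moreover have "y \<in> {u \<in> U. u < snd e}" using yb 1 by auto
            moreover have "card (insert b (S - {y})) = card S" if "y \<in> S" "b \<notin> S" "finite S" for S
              using that card_Suc_Diff1[of S y] by simp
            ultimately have "card {u \<in> insert b (U - {y}). u < snd e} = card {u \<in> U. u < snd e}"
              using bY finU by simp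
            then show ?thesis using bound by simp
          next
            \<comment> \<open>No free value lies strictly between \<open>y\<close> and
              \<open>b\<close>, so the loss of \<open>y\<close> is paid by the spare value from
              \<open>ext\<close>.\<close>
            case 2
            have "D = {u \<in> U. u < snd e}" using 2 y by (force simp: D_def)
            moreover have "{u \<in> insert b (U - {y}). u < snd e} = {u \<in> U. u < snd e} - {y}"
              using 2 by auto
            moreover have "Suc (card C) \<le> card D"
              using ext C 2(1) by (meson le_less_trans)
            ultimately show ?thesis using y(1) finD by simp
          next
            case 3
            then have "{u \<in> insert b (U - {y}). u < snd e} = {u \<in> U. u < snd e}" by auto
            then show ?thesis using bound by simp
          qed
        qed
      qed (use Y in auto)
      then obtain A where A: "finite A" "fst ` A = X" "snd ` A = Y - {y}" "inj_on fst A" "inj_on snd A"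
        "shadow_set A = Q'" by blast
      \<comment> \<open>In the restored row the least entry above \<open>y\<close> is
        \<open>b\<close>, so inserting \<open>y\<close> bumps precisely \<open>b\<close>.\<close>
      have row: "{u \<in> bottom_row A. y < u} = insert b {u \<in> U. b < u}"
        using y yb bY by (force simp: bottom_row_def A(3,6) U' D_def)
      have "Min (insert b {u \<in> U. b < u}) = b"
        using finU by (intro Min_eqI) auto
      then have "shadow_set (insert (x, y) A) = Q' \<union> {(x, b)}"
        using shadow_set_insert[OF A(1,4,5), of x y] insert(2) A row by (auto simp: Let_def)
      then have "shadow_set (insert (x, y) A) = Q" using b by (auto simp: Q'_def)
      moreover have "inj_on fst (insert (x, y) A)" "inj_on snd (insert (x, y) A)"
        using A x by auto
      ultimately show ?thesis using A yb by (intro exI[of _ "insert (x, y) A"]) auto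
    qed
  qed
  then show ?thesis using that by blast
qed

text \<open>At the first peeling step that removes \<open>p\<close> or \<open>q\<close>, the shadow
  line contains a point weakly below and left of \<open>p\<close> and, further right, a point weakly
  below and left of \<open>q\<close>; the corners next to them give both claims. This is what will
  exclude descents among overlined points.\<close>

lemma descent_corners:
  assumes "finite A" "inj_on fst A" "inj_on snd A"
    and "p \<in> A" "q \<in> A" "fst p < fst q" "snd q < snd p"
  shows "(\<exists>c\<in>shadow_set A. fst c \<le> fst q) \<and> (\<exists>c\<in>shadow_set A. snd c \<le> snd p)"
  using assms
proof (induction rule: peel_induct)
  case (peel A)
  let ?M = "minimal_points A"
  have fin: "finite ?M" using peel(1) minimal_points_subset finite_subset by blast
  have S: "northeast_corners ?M \<subseteq> shadow_set A" "shadow_set (A - ?M) \<subseteq> shadow_set A"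
    using shadow_set_rec[of A] by auto
  have *: ?case if M: "p' \<in> ?M" "q' \<in> ?M" "fst p' < fst q'" "fst q' \<le> fst q" "snd p' \<le> snd p" for p' q'
  proof -
    obtain y x where c: "(fst q', y) \<in> shadow_set A" "(x, snd p') \<in> shadow_set A"
      using corner_right[OF fin M(1-3)] corner_above[OF fin M(1-3)] S(1) by blast
    show ?thesis using bexI[OF _ c(1)] bexI[OF _ c(2)] M(4,5) by simp
  qed
  consider "p \<notin> ?M" "q \<notin> ?M" | "q \<in> ?M" | "p \<in> ?M" "q \<notin> ?M" by blast
  then show ?case
  proof cases
    case 1
    then show ?thesis using peel.IH peel.prems S(2) by blast
  next
    case 2
    obtain p' where "p' \<in> ?M" "fst p' \<le> fst p" "snd p' \<le> snd p"
      using minimal_point_below[OF peel(1,2) peel.prems(1)] by blast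
    then show ?thesis using 2 peel.prems(3) by (intro *[of p' q]) auto
  next
    case 3
    obtain q' where q': "q' \<in> ?M" "fst q' \<le> fst q" "snd q' \<le> snd q"
      using minimal_point_below[OF peel(1,2) peel.prems(2)] by blast
    have "\<not> fst q' < fst p" 
      using minimal_points_antichain[OF q'(1) 3(1)] q'(3) peel.prems(4) by auto
    moreover have "fst q' \<noteq> fst p"
    proof
      assume "fst q' = fst p"
      then have "q' = p" using peel(2) q'(1) peel.prems(1) minimal_points_subset[of A]
        by (meson inj_onD subsetD)
      then show False using q'(3) peel.prems(4) by simp
    qed
    ultimately show ?thesis using 3 q' by (intro *[of p q']) auto
  qed
qed simp

section \<open>Recognising extended placements\<close>

lemma Bar_less [simp]: "Bar i < Bar j \<longleftrightarrow> i < j" "Bar i < Reg j" "\<not> Reg i < Bar j"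
  "Reg i < Reg j \<longleftrightarrow> i < j"
  by (auto simp: less_ext_index_def)

lemma nat_initial_segment:
  fixes S :: "nat set"
  assumes "finite S" "0 \<notin> S" "\<And>j j'. \<lbrakk>j \<in> S; 0 < j'; j' < j\<rbrakk> \<Longrightarrow> j' \<in> S"
  shows "S = {1..card S}"
proof (cases "S = {}")
  case False
  have "S = {1..Max S}"
  proof (intro equalityI subsetI)
    fix j assume "j \<in> S"
    then show "j \<in> {1..Max S}" using assms(1,2) by (metis Max_ge atLeastAtMost_iff less_one not_le)
  next
    fix j assume "j \<in> {1..Max S}"
    then show "j \<in> S" using assms(3)[of "Max S" j] Max_in[OF assms(1) False]
      by (cases "j = Max S") auto
  qed
  then show ?thesis by (metis card_atLeastAtMost diff_Suc_1)
qed simp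

text \<open>The list of values of \<open>f\<close> and the listing of the target set are both
  strictly sorted with the same elements, hence equal; overlined indices come ahead of regular
  ones.\<close>

lemma increasing_enumeration:
  fixes f :: "nat \<Rightarrow> ext_index"
  assumes "strict_mono_on {1..K} f" "f ` {1..K} = Bar ` {1..s} \<union> Reg ` H" "finite H"
  shows "K = s + card H" "\<And>i. i \<in> {1..s} \<Longrightarrow> f i = Bar i"
    "\<And>l. l \<in> {1..card H} \<Longrightarrow> f (s + l) = Reg (sorted_list_of_set H ! (l - 1))"
proof -
  let ?l1 = "map f [1..<Suc K]" and ?l2 = "map Bar [1..<Suc s] @ map Reg (sorted_list_of_set H)"
  have "sorted_wrt (<) ?l1"
    unfolding sorted_wrt_map
    by (rule sorted_wrt_mono_rel[OF _ sorted_wrt_upt])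
      (use assms(1) in \<open>auto simp: strict_mono_on_def\<close>)
  moreover have "sorted_wrt (<) ?l2"
    by (auto simp: sorted_wrt_append sorted_wrt_map)
  moreover have "set ?l1 = set ?l2"
    using assms(2,3) by (simp add: atLeastLessThanSuc_atLeastAtMost del: upt_Suc)
  ultimately have eq: "?l1 = ?l2"
    by (metis strict_sorted_equal)
  then have "length ?l1 = length ?l2" by (rule arg_cong)
  then show K: "K = s + card H" by (simp del: upt_Suc)
  have nth: "f i = ?l2 ! (i - 1)" if "i \<in> {1..K}" for i
  proof -
    have "f i = ?l1 ! (i - 1)" using that by (subst nth_map) (auto simp del: upt_Suc)
    then show ?thesis unfolding eq .
  qed
  show "f i = Bar i" if "i \<in> {1..s}" for i
    using that K nth[of i] by (auto simp: nth_append simp del: upt_Suc)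
  show "f (s + l) = Reg (sorted_list_of_set H ! (l - 1))" if "l \<in> {1..card H}" for l
    using that K nth[of "s + l"] by (auto simp: nth_append simp del: upt_Suc)
qed

text \<open>A regular second coordinate missed by \<open>R\<close> must be taken in an overlined
  column, and monotonicity then fixes the order of all overlined columns. Applied to
  \<open>A\<close> and to its swap, this yields the two enumerations in \<open>EXR\<close>.\<close>

lemma increasing_bars:
  assumes "finite A" "inj_on fst A" "inj_on snd A"
    and "fst ` A = Bar ` {1..K} \<union> Reg ` {1..n}"
    and "snd ` A = Bar ` {1..K'} \<union> Reg ` {1..m}"
    and inc: "\<And>p q. \<lbrakk>p \<in> A; q \<in> A; fst p \<in> range Bar; fst q \<in> range Bar; fst p < fst q\<rbrakk> \<Longrightarrow> snd p < snd q"
    and R: "R = {(i, j). (Reg i, Reg j) \<in> A}"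
    and s: "{j. \<exists>i. (Bar i, Bar j) \<in> A} = {1..s}"
  shows "K = s + card ({1..m} - snd ` R)"
    "\<And>i y. (Bar i, y) \<in> A \<longleftrightarrow> i \<in> {1..s} \<and> y = Bar i \<or>
       (\<exists>l\<in>{1..card ({1..m} - snd ` R)}. i = s + l \<and>
          y = Reg (sorted_list_of_set ({1..m} - snd ` R) ! (l - 1)))"
proof -
  let ?H = "{1..m} - snd ` R"
  have "\<forall>i\<in>{1..K}. \<exists>y. (Bar i, y) \<in> A"
  proof
    fix i assume "i \<in> {1..K}"
    then have "Bar i \<in> fst ` A" using assms(4) by blast
    then show "\<exists>y. (Bar i, y) \<in> A" by force
  qed
  then obtain f where f: "\<And>i. i \<in> {1..K} \<Longrightarrow> (Bar i, f i) \<in> A" by metis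
  have iff: "(Bar i, y) \<in> A \<longleftrightarrow> i \<in> {1..K} \<and> y = f i" for i y
  proof
    assume a: "(Bar i, y) \<in> A"
    then have "Bar i \<in> fst ` A" by force
    then have "i \<in> {1..K}" using assms(4) by auto
    then show "i \<in> {1..K} \<and> y = f i" using inj_onD[OF assms(2) _ a f] by auto
  qed (use f in auto)
  have "strict_mono_on {1..K} f"
    using inc f unfolding strict_mono_on_def by (metis Bar_less(1) fst_conv rangeI snd_conv)
  moreover have "f ` {1..K} = Bar ` {1..s} \<union> Reg ` ?H"
  proof (intro equalityI subsetI)
    fix y assume "y \<in> f ` {1..K}"
    then obtain i where i: "(Bar i, y) \<in> A" using f by blast
    then have y: "y \<in> snd ` A" by force
    show "y \<in> Bar ` {1..s} \<union> Reg ` ?H"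
    proof (cases y)
      case (Bar j)
      then show ?thesis using i s by blast
    next
      case (Reg j)
      have "j \<notin> snd ` R"
      proof
        assume "j \<in> snd ` R"
        then obtain i' where "(Reg i', Reg j) \<in> A" using R by auto
        then show False using inj_onD[OF assms(3) _ i, of "(Reg i', Reg j)"] Reg by auto
      qed
      then show ?thesis using Reg y assms(5) by auto
    qed
  next
    fix y assume "y \<in> Bar ` {1..s} \<union> Reg ` ?H"
    then consider j where "y = Bar j" "j \<in> {1..s}" | j where "y = Reg j" "j \<in> ?H" by blast
    then obtain i where "(Bar i, y) \<in> A"
    proof cases
      case 1
      then show ?thesis using s that by blast
    next
      case 2
      then have "y \<in> snd ` A" using assms(5) by blast
      then obtain x where x: "(x, y) \<in> A" by force
      show ?thesis
      proof (cases x)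
        case (Reg i)
        then have "j \<in> snd ` R" using x 2 unfolding R by force
        then show ?thesis using 2 by simp
      qed (use x that in auto)
    qed
    then show "y \<in> f ` {1..K}" using iff by blast
  qed
  ultimately have "strict_mono_on {1..K} f \<and> f ` {1..K} = Bar ` {1..s} \<union> Reg ` ?H"
    by blast
  note * = increasing_enumeration[OF conjunct1[OF this] conjunct2[OF this] finite_Diff[OF finite_atLeastAtMost]]
  show "K = s + card ?H" by (rule *(1))
  show "(Bar i, y) \<in> A \<longleftrightarrow> i \<in> {1..s} \<and> y = Bar i \<or>
       (\<exists>l\<in>{1..card ?H}. i = s + l \<and> y = Reg (sorted_list_of_set ?H ! (l - 1)))" for i y
  proof (cases "i \<in> {1..K}")
    case True
    show ?thesis
    proof (cases "i \<le> s")
      case True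
      then show ?thesis using iff *(2)[of i] \<open>i \<in> {1..K}\<close> by auto
    next
      case False
      then obtain l where "i = s + l" "l \<in> {1..card ?H}"
        using True *(1) by (intro that[of "i - s"]) auto
      then show ?thesis using iff *(3)[of l] True False by auto
    qed
  qed (use iff *(1) in auto)
qed

text \<open>Counting the overlined first coordinates gives \<open>m - r = s + (m - card R)\<close>,
  where \<open>s\<close> is the number of points with both coordinates overlined. So
  \<open>s = card R - r\<close>, and \<open>r \<le> card R\<close> comes out of the same
  count.\<close>

lemma EXR_characterization:
  assumes "r \<le> n" "r \<le> m" "finite A" "inj_on fst A" "inj_on snd A"
    and X: "fst ` A = Bar ` {1..m - r} \<union> Reg ` {1..n}"
    and Y: "snd ` A = Bar ` {1..n - r} \<union> Reg ` {1..m}"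
    and incx: "\<And>p q. \<lbrakk>p \<in> A; q \<in> A; fst p \<in> range Bar; fst q \<in> range Bar; fst p < fst q\<rbrakk> \<Longrightarrow> snd p < snd q"
    and incy: "\<And>p q. \<lbrakk>p \<in> A; q \<in> A; snd p \<in> range Bar; snd q \<in> range Bar; snd p < snd q\<rbrakk> \<Longrightarrow> fst p < fst q"
    and R: "R = {(i, j). (Reg i, Reg j) \<in> A}"
  shows "R \<in> UZ n m r" "EXR n m r R = A"
proof -
  let ?B = "{p \<in> A. fst p \<in> range Bar \<and> snd p \<in> range Bar}"
  let ?G = "{j. \<exists>i. (Bar i, Bar j) \<in> A}" and ?G' = "{i. \<exists>j. (Bar i, Bar j) \<in> A}"
  have bij: "Bar ` ?G = snd ` ?B" "Bar ` ?G' = fst ` ?B" by force+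
  have inj: "inj Bar" by (auto intro: injI)
  have card: "card ?G = card ?B" "card ?G' = card ?B"
    using bij assms(4,5) card_image[OF inj_on_subset[OF inj]] by (metis (no_types, lifting)
      card_image inj_on_subset mem_Collect_eq subsetI subset_UNIV)+
  have fin: "finite ?G" "finite ?G'"
    using bij assms(3) inj finite_imageD[of Bar] by (metis (no_types, lifting) finite_imageI
      finite_subset mem_Collect_eq subsetI inj_on_subset subset_UNIV)+
  have memX: "i \<in> {1..m - r}" if "(Bar i, y) \<in> A" for i y
  proof -
    have "Bar i \<in> fst ` A" using that by force
    then show ?thesis using X by auto
  qed
  have memY: "j \<in> {1..n - r}" if "(x, Bar j) \<in> A" for j x
  proof -
    have "Bar j \<in> snd ` A" using that by force
    then show ?thesis using Y by auto
  qed
  \<comment> \<open>Everything below an overlined index is overlined, so by monotonicity the doubly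
    overlined points occupy initial segments in both coordinates.\<close>
  have G: "?G = {1..card ?G}"
  proof (rule nat_initial_segment[OF fin(1)])
    show "0 \<notin> ?G" using memY by fastforce
    fix j j' assume "j \<in> ?G" "0 < j'" "j' < j"
    then obtain i where i: "(Bar i, Bar j) \<in> A" by blast
    have "j' \<in> {1..n - r}" using memY[OF i] \<open>0 < j'\<close> \<open>j' < j\<close> by auto
    then have "Bar j' \<in> snd ` A" using Y by blast
    then obtain x where x: "(x, Bar j') \<in> A" by force
    have "x < Bar i" using incy[OF x i] \<open>j' < j\<close> by auto
    then show "j' \<in> ?G" using x by (cases x) auto
  qed
  have G': "?G' = {1..card ?G'}"
  proof (rule nat_initial_segment[OF fin(2)])
    show "0 \<notin> ?G'" using memX by fastforce
    fix i i' assume "i \<in> ?G'" "0 < i'" "i' < i"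
    then obtain j where j: "(Bar i, Bar j) \<in> A" by blast
    have "i' \<in> {1..m - r}" using memX[OF j] \<open>0 < i'\<close> \<open>i' < i\<close> by auto
    then have "Bar i' \<in> fst ` A" using X by blast
    then obtain y where y: "(Bar i', y) \<in> A" by force
    have "y < Bar j" using incx[OF y j] \<open>i' < i\<close> by auto
    then show "i' \<in> ?G'" using y by (cases y) auto
  qed
  define s where "s = card ?B"
  have s: "{j. \<exists>i. (Bar i, Bar j) \<in> A} = {1..s}"
    "{j. \<exists>i. (Bar i, Bar j) \<in> prod.swap ` A} = {1..s}"
    using G G' card by (auto simp: s_def)
  let ?H = "{1..m} - snd ` R" and ?H' = "{1..n} - fst ` R"
  have rook: "rook_placement n m R"
    unfolding rook_placement_def
  proof (intro conjI ballI impI)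
    show "R \<subseteq> board n m"
    proof
      fix p assume "p \<in> R"
      then obtain i j where p: "p = (i, j)" "(Reg i, Reg j) \<in> A" using R by auto
      then have "Reg i \<in> fst ` A" "Reg j \<in> snd ` A" by force+
      then show "p \<in> board n m" using X Y p by (auto simp: board_def)
    qed
    show "fst p \<noteq> fst q" "snd p \<noteq> snd q" if "p \<in> R" "q \<in> R" "p \<noteq> q" for p q
    proof -
      obtain i j i' j' where ij: "p = (i, j)" "q = (i', j')" by (cases p; cases q)
      have A: "(Reg i, Reg j) \<in> A" "(Reg i', Reg j') \<in> A" using \<open>p \<in> R\<close> \<open>q \<in> R\<close> R ij by auto
      show "fst p \<noteq> fst q" using inj_onD[OF assms(4) _ A] \<open>p \<noteq> q\<close> ij by auto
      show "snd p \<noteq> snd q" using inj_onD[OF assms(5) _ A] \<open>p \<noteq> q\<close> ij by auto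
    qed
  qed
  have R_card: "finite R" "card (fst ` R) = card R" "card (snd ` R) = card R"
    "fst ` R \<subseteq> {1..n}" "snd ` R \<subseteq> {1..m}"
    using rook finite_subset[of R "board n m"] unfolding rook_placement_def
    by (auto simp: board_def intro!: card_image inj_onI)
  have H: "card ?H = m - card R" "card ?H' = n - card R"
    using R_card by (simp_all add: card_Diff_subset)
  have "card R \<le> m" using R_card by (metis card_atLeastAtMost card_mono diff_Suc_1 finite_atLeastAtMost)
  note bars = increasing_bars[OF assms(3-5) X Y incx R s(1)]
  \<comment> \<open>The first coordinates of the regular part are the second coordinates of the
    swapped one, so both applications of \<open>increasing_bars\<close> can be expressed through the
    same \<open>R\<close>.\<close>
  have eqR: "(fst ` {(i, j). (Reg i, Reg j) \<in> A}) = snd ` {(i, j). (Reg i, Reg j) \<in> prod.swap ` A}"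
    by force
  have swap: "finite (prod.swap ` A)" "inj_on fst (prod.swap ` A)" "inj_on snd (prod.swap ` A)"
    "fst ` prod.swap ` A = Bar ` {1..n - r} \<union> Reg ` {1..m}"
    "snd ` prod.swap ` A = Bar ` {1..m - r} \<union> Reg ` {1..n}"
    using assms(3-5) X Y by (auto simp: image_image inj_on_def)
  have "\<And>p q. \<lbrakk>p \<in> prod.swap ` A; q \<in> prod.swap ` A; fst p \<in> range Bar; fst q \<in> range Bar; fst p < fst q\<rbrakk>
    \<Longrightarrow> snd p < snd q"
    using incy by auto
  note bars' = increasing_bars[OF swap this refl s(2), folded eqR R]
  have star1: "(Bar i, y) \<in> A \<longleftrightarrow> i \<in> {1..s} \<and> y = Bar i \<or> (\<exists>l\<in>{1..m - card R}. i = s + l \<and>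
          y = Reg (sorted_list_of_set ?H ! (l - 1)))" for i y
    using bars(2) unfolding H by blast
  have star2: "(x, Bar j) \<in> A \<longleftrightarrow> j \<in> {1..s} \<and> x = Bar j \<or> (\<exists>l\<in>{1..n - card R}. j = s + l \<and>
          x = Reg (sorted_list_of_set ?H' ! (l - 1)))" for j x
    using bars'(2)[of j x] unfolding H by simp
  have sr: "s = card R - r" "r \<le> card R"
    using bars(1) H(1) \<open>card R \<le> m\<close> assms(2) by auto
  then show "R \<in> UZ n m r" using rook by (simp add: UZ_def)
  show "EXR n m r R = A"
  proof (rule Set.set_eqI)
    fix p :: "ext_index \<times> ext_index"
    obtain x y where p: "p = (x, y)" by (cases p)
    show "p \<in> EXR n m r R \<longleftrightarrow> p \<in> A"
    proof (cases x)
      case (Bar i)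
      show ?thesis
        unfolding p Bar star1 sr(1)[symmetric] EXR_def Let_def by auto
    next
      case (Reg i)
      show ?thesis
      proof (cases y)
        case (Bar j)
        show ?thesis
          unfolding p Bar star2 sr(1)[symmetric] EXR_def Let_def using Reg by auto
      next
        case (Reg j)
        show ?thesis
          unfolding p \<open>x = Reg i\<close> Reg EXR_def Let_def using R by auto
      qed
    qed
  qed
qed

section \<open>Good placements are extended shadow sets\<close>

definition good_placement :: "nat \<Rightarrow> nat \<Rightarrow> nat \<Rightarrow> (nat \<times> nat) set \<Rightarrow> bool" where
  "good_placement n m r Q \<longleftrightarrow> rook_placement n m Q \<and>
     chain_bound (n - r) {1..m} Q \<and> chain_bound (m - r) {1..n} (prod.swap ` Q)"

text \<open>The \<open>K\<close> overlined indices are free and lie below every regular one, so each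
  set of free values grows by exactly \<open>K\<close> and the allowance moves into the index
  set.\<close>

lemma chain_bound_extend:
  assumes "chain_bound K {1..M} Q"
  shows "chain_bound 0 (Bar ` {1..K} \<union> Reg ` {1..M}) (map_prod Reg Reg ` Q)"
  unfolding chain_bound_def
proof (intro allI impI)
  fix C e assume C: "C \<subseteq> map_prod Reg Reg ` Q" "increasing_chain C" "e \<in> C" "\<forall>p\<in>C. snd p \<le> snd e"
  obtain C0 where C0: "C0 \<subseteq> Q" "C = map_prod Reg Reg ` C0"
    using C(1) by (rule subset_imageE)
  obtain e0 where e0: "e0 \<in> C0" "e = map_prod Reg Reg e0" by (metis C(3) C0(2) imageE)
  let ?S = "{u \<in> {1..M} - snd ` Q. u < snd e0}"
  have "increasing_chain C0"
    using C(2) unfolding C0 increasing_chain_def by simp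
  then have "card C0 \<le> K + card ?S"
    using C0 e0 C(4) by (intro chain_boundD[OF assms]) auto
  moreover have "card C \<le> card C0"
  \<comment> \<open>\<open>card\<close> of an infinite set is 0, so an infinite chain has to be
    matched with an infinite one.\<close>
  proof (cases "finite C0")
    case False
    have "inj (map_prod Reg Reg)" by (auto intro: injI)
    then have "infinite C" using False C0(2) by (metis finite_imageD inj_on_subset subset_UNIV)
    then show ?thesis by simp
  qed (use C0 in \<open>simp add: card_image_le\<close>)
  moreover have "{y \<in> Bar ` {1..K} \<union> Reg ` {1..M} - snd ` map_prod Reg Reg ` Q. y < snd e} =
      Bar ` {1..K} \<union> Reg ` ?S"
    unfolding e0 by (auto simp: image_iff)
  moreover have "card (Bar ` {1..K} \<union> Reg ` ?S) = K + card ?S"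
    by (subst card_Un_disjoint) (auto simp: card_image inj_on_def)
  ultimately show "card C \<le> 0 + card {y \<in> Bar ` {1..K} \<union> Reg ` {1..M} - snd ` map_prod Reg Reg ` Q. y < snd e}"
    by simp
qed

text \<open>Both extended index sets have \<open>n + m - r\<close> elements, so reverse insertion
  applies. All corners of the resulting set are regular, whereas a descent between points with
  overlined first (or second) coordinates would force a corner weakly left of (or weakly below) an
  overlined index. Hence the set is an extended placement.\<close>

lemma good_placement_ES:
  assumes "r \<le> n" "r \<le> m" "good_placement n m r Q"
  obtains R where "R \<in> UZ n m r" "ES n m r R = Q"
proof -
  let ?X = "Bar ` {1..m - r} \<union> Reg ` {1..n}" and ?Y = "Bar ` {1..n - r} \<union> Reg ` {1..m}"
  let ?Q = "map_prod Reg Reg ` Q"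
  have rook: "rook_placement n m Q" and cb: "chain_bound (n - r) {1..m} Q"
    "chain_bound (m - r) {1..n} (prod.swap ` Q)"
    using assms(3) by (auto simp: good_placement_def)
  have card: "card (Bar ` {1..k} \<union> Reg ` {1..l}) = k + l" for k l
    by (subst card_Un_disjoint) (auto simp: card_image inj_on_def)
  have inj: "inj_on fst Q" "inj_on snd Q"
    using rook unfolding rook_placement_def by (auto intro!: inj_onI)
  have "prod.swap ` ?Q = map_prod Reg Reg ` prod.swap ` Q" by force
  then have cb': "chain_bound 0 ?Y ?Q" "chain_bound 0 ?X (prod.swap ` ?Q)"
    using chain_bound_extend[OF cb(1)] chain_bound_extend[OF cb(2)] by auto
  obtain A where A: "finite A" "fst ` A = ?X" "snd ` A = ?Y" "inj_on fst A" "inj_on snd A"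
    "shadow_set A = ?Q"
  proof (rule shadow_set_surj[of ?X ?Y ?Q])
    show "card ?X = card ?Y" using assms(1,2) card by simp
    show "?Q \<subseteq> ?X \<times> ?Y" using rook by (auto simp: rook_placement_def board_def)
    show "inj_on fst ?Q" "inj_on snd ?Q" using inj by (auto simp: inj_on_def)
  qed (use cb' in auto)
  have neq: "snd p \<noteq> snd q" "fst p \<noteq> fst q" if "p \<in> A" "q \<in> A" "p \<noteq> q" for p q
    using that A(4,5) by (auto dest: inj_onD)
  have noBar: "\<not> (fst c \<le> Bar i)" "\<not> (snd c \<le> Bar i)" if "c \<in> shadow_set A" for c i
    using that unfolding A(6) by auto
  have incx: "snd p < snd q"
    if "p \<in> A" "q \<in> A" "fst p \<in> range Bar" "fst q \<in> range Bar" "fst p < fst q" for p q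
  proof (rule ccontr)
    assume "\<not> snd p < snd q"
    then have "snd q < snd p" using that neq(1)[of p q] by fastforce
    then show False
      using descent_corners[OF A(1,4,5) that(1,2,5)] noBar(1) that(4) by (metis imageE)
  qed
  have incy: "fst p < fst q"
    if "p \<in> A" "q \<in> A" "snd p \<in> range Bar" "snd q \<in> range Bar" "snd p < snd q" for p q
  proof (rule ccontr)
    assume "\<not> fst p < fst q"
    then have "fst q < fst p" using that neq(2)[of p q] by fastforce
    then show False
      using descent_corners[OF A(1,4,5) that(2,1) _ that(5)] noBar(2) that(4) by (metis imageE)
  qed
  let ?R = "{(i, j). (Reg i, Reg j) \<in> A}"
  have R: "?R \<in> UZ n m r" "EXR n m r ?R = A"
    using EXR_characterization[OF assms(1,2) A(1,4,5,2,3) incx incy refl] by blast+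
  have "ES n m r ?R = Q"
    unfolding ES_def R(2) A(6) by auto
  then show ?thesis using that R(1) by blast
qed

section \<open>The polynomial ring\<close>

abbreviation "mkeys \<equiv> Poly_Mapping.keys"

lemma keys_add_nat: "mkeys (a + b) = mkeys a \<union> mkeys b"
  for a b :: "'a \<Rightarrow>\<^sub>0 nat"
  by (auto simp: in_keys_iff lookup_add)

lemma mon_add_iff: "a + b \<in> mons n m \<longleftrightarrow> a \<in> mons n m \<and> b \<in> mons n m"
  by (auto simp: mons_def keys_add_nat)

lemma mon_zero [simp]: "0 \<in> mons n m"
  by (simp add: mons_def)

lemma carrier_iff: "f \<in> carrier (poly_ring n m) \<longleftrightarrow> mkeys f \<subseteq> mons n m"
  by (simp add: poly_ring_def)

lemma poly_ring_simps [simp]: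
  "x \<oplus>\<^bsub>poly_ring n m\<^esub> y = x + y" "x \<otimes>\<^bsub>poly_ring n m\<^esub> y = x * y"
  "\<zero>\<^bsub>poly_ring n m\<^esub> = 0" "\<one>\<^bsub>poly_ring n m\<^esub> = 1"
  by (simp_all add: poly_ring_def)

lemma carrier_zero [simp]: "0 \<in> carrier (poly_ring n m)"
  and carrier_one [simp]: "1 \<in> carrier (poly_ring n m)"
  by (simp_all add: carrier_iff)

lemma carrier_add: "\<lbrakk>f \<in> carrier (poly_ring n m); g \<in> carrier (poly_ring n m)\<rbrakk> \<Longrightarrow> f + g \<in> carrier (poly_ring n m)"
  and carrier_mult: "\<lbrakk>f \<in> carrier (poly_ring n m); g \<in> carrier (poly_ring n m)\<rbrakk> \<Longrightarrow> f * g \<in> carrier (poly_ring n m)"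
  using cring.cring_simprules(1,5)[OF cring_poly_ring[of n m]] by simp_all

lemma carrier_uminus: "f \<in> carrier (poly_ring n m) \<Longrightarrow> - f \<in> carrier (poly_ring n m)"
  by (simp add: carrier_iff)

lemma carrier_diff: "\<lbrakk>f \<in> carrier (poly_ring n m); g \<in> carrier (poly_ring n m)\<rbrakk> \<Longrightarrow> f - g \<in> carrier (poly_ring n m)"
  using carrier_add[of f n m "- g"] by (simp add: carrier_uminus)

lemma carrier_sum: "(\<And>i. i \<in> S \<Longrightarrow> f i \<in> carrier (poly_ring n m)) \<Longrightarrow> sum f S \<in> carrier (poly_ring n m)"
  by (induction S rule: infinite_finite_induct) (auto intro: carrier_add)

lemma carrier_prod: "(\<And>i. i \<in> S \<Longrightarrow> f i \<in> carrier (poly_ring n m)) \<Longrightarrow> prod f S \<in> carrier (poly_ring n m)"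
  by (induction S rule: infinite_finite_induct) (auto intro: carrier_mult)

lemma carrier_single: "a \<in> mons n m \<Longrightarrow> Poly_Mapping.single a c \<in> carrier (poly_ring n m)"
  by (simp add: carrier_iff)

lemma carrier_var: "v \<in> board n m \<Longrightarrow> var v \<in> carrier (poly_ring n m)"
  by (simp add: var_def carrier_single mons_def)

lemmas carrier_intros = carrier_add carrier_mult carrier_uminus carrier_diff carrier_sum
  carrier_prod carrier_single carrier_var

lemma sum_monomials: "f = (\<Sum>a\<in>mkeys f. Poly_Mapping.single a (Poly_Mapping.lookup f a))"
  for f :: "'a \<Rightarrow>\<^sub>0 'b::comm_monoid_add"
  by (rule poly_mapping_eqI) (auto simp: lookup_sum lookup_single when_def in_keys_iff)

lemma single_mult_sum:
  "Poly_Mapping.single a c * f =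
     (\<Sum>b\<in>mkeys f. Poly_Mapping.single (a + b) (c * Poly_Mapping.lookup f b))"
  for f :: mpoly
  by (subst (1) sum_monomials[of f]) (simp add: sum_distrib_left mult_single)

lemma lookup_single_mult [simp]:
  "Poly_Mapping.lookup (Poly_Mapping.single a c * f) (a + b) = c * Poly_Mapping.lookup f b"
  for f :: mpoly
  by (auto simp: single_mult_sum lookup_sum lookup_single when_def in_keys_iff)

lemma keys_single_mult:
  assumes "x \<in> mkeys (Poly_Mapping.single a c * f)"
  obtains b where "b \<in> mkeys f" "x = a + b"
  using assms keys_mult[of "Poly_Mapping.single a c" f] by (fastforce split: if_splits)

lemma mon_degree_superset:
  assumes "finite S" "mkeys a \<subseteq> S"
  shows "mon_degree a = (\<Sum>v\<in>S. Poly_Mapping.lookup a v)"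
  unfolding mon_degree_def using assms by (intro sum.mono_neutral_left) (auto simp: in_keys_iff)

lemma mon_degree_add: "mon_degree (a + b) = mon_degree a + mon_degree b"
  using mon_degree_superset[of "mkeys a \<union> mkeys b" a] mon_degree_superset[of "mkeys a \<union> mkeys b" b]
    mon_degree_superset[of "mkeys a \<union> mkeys b" "a + b"]
  by (simp add: keys_add_nat lookup_add sum.distrib)

lemma mon_degree_single [simp]: "mon_degree (Poly_Mapping.single v k) = k"
  by (simp add: mon_degree_def)

lemma mon_degree_zero [simp]: "mon_degree 0 = 0"
  by (simp add: mon_degree_def)

section \<open>Evaluation\<close>

definition eval_mon :: "(nat \<times> nat \<Rightarrow> complex) \<Rightarrow> mon \<Rightarrow> complex" where
  "eval_mon z a = (\<Prod>v\<in>mkeys a. z v ^ Poly_Mapping.lookup a v)"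

lemma eval_mon_superset:
  assumes "finite S" "mkeys a \<subseteq> S"
  shows "eval_mon z a = (\<Prod>v\<in>S. z v ^ Poly_Mapping.lookup a v)"
  unfolding eval_mon_def using assms by (intro prod.mono_neutral_left) (auto simp: in_keys_iff)

lemma eval_mon_add: "eval_mon z (a + b) = eval_mon z a * eval_mon z b"
  using eval_mon_superset[of "mkeys a \<union> mkeys b" a] eval_mon_superset[of "mkeys a \<union> mkeys b" b]
    eval_mon_superset[of "mkeys a \<union> mkeys b" "a + b"]
  by (simp add: keys_add_nat lookup_add power_add prod.distrib)

lemma eval_poly_superset:
  assumes "finite S" "mkeys f \<subseteq> S"
  shows "eval_poly z f = (\<Sum>a\<in>S. Poly_Mapping.lookup f a * eval_mon z a)"
  unfolding eval_poly_def eval_mon_def[symmetric]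
  using assms by (intro sum.mono_neutral_left) (auto simp: in_keys_iff)

lemma eval_add: "eval_poly z (f + g) = eval_poly z f + eval_poly z g"
  using eval_poly_superset[of "mkeys f \<union> mkeys g" f] eval_poly_superset[of "mkeys f \<union> mkeys g" g]
    eval_poly_superset[of "mkeys f \<union> mkeys g" "f + g"] keys_add[of f g]
  by (simp add: lookup_add distrib_right sum.distrib)

lemma eval_single: "eval_poly z (Poly_Mapping.single a c) = c * eval_mon z a"
  using eval_poly_superset[of "{a}" "Poly_Mapping.single a c"] by simp

lemma eval_zero [simp]: "eval_poly z 0 = 0"
  by (simp add: eval_poly_def)

lemma eval_one [simp]: "eval_poly z 1 = 1"
  using eval_single[of z 0 1] by (simp add: eval_mon_def)

lemma eval_sum: "eval_poly z (sum f S) = (\<Sum>i\<in>S. eval_poly z (f i))"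
  by (induction S rule: infinite_finite_induct) (auto simp: eval_add)

lemma eval_uminus: "eval_poly z (- f) = - eval_poly z f"
  using eval_add[of z f "- f"] by (simp add: eq_neg_iff_add_eq_0 add.commute)

lemma eval_diff: "eval_poly z (f - g) = eval_poly z f - eval_poly z g"
  using eval_add[of z f "- g"] by (simp add: eval_uminus)

lemma eval_mult: "eval_poly z (f * g) = eval_poly z f * eval_poly z g"
proof -
  have single: "eval_poly z (Poly_Mapping.single a c * g) = c * eval_mon z a * eval_poly z g" for a c
    unfolding single_mult_sum eval_poly_superset[OF finite_keys order.refl, of z g]
    by (simp add: eval_sum eval_single eval_mon_add sum_distrib_left mult_ac)
  have "eval_poly z (f * g) =
      eval_poly z (\<Sum>a\<in>mkeys f. Poly_Mapping.single a (Poly_Mapping.lookup f a) * g)"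
    by (subst (1) sum_monomials[of f]) (simp add: sum_distrib_right)
  also have "\<dots> = eval_poly z f * eval_poly z g"
    unfolding eval_poly_superset[OF finite_keys order.refl, of z f]
    by (simp add: eval_sum single sum_distrib_right)
  finally show ?thesis .
qed

lemma eval_prod: "eval_poly z (prod f S) = (\<Prod>i\<in>S. eval_poly z (f i))"
  by (induction S rule: infinite_finite_induct) (auto simp: eval_mult)

lemma eval_var: "eval_poly z (var v) = z v"
  by (simp add: var_def eval_single eval_mon_def)

section \<open>Ideals of the polynomial ring\<close>

text \<open>Multiplication by single terms suffices because every polynomial is a finite sum of
  terms; additive inverses come from the factor \<open>- 1\<close>.\<close>

lemma poly_idealI:
  assumes sub: "I \<subseteq> carrier (poly_ring n m)" and zero: "0 \<in> I"
    and add: "\<And>f g. \<lbrakk>f \<in> I; g \<in> I\<rbrakk> \<Longrightarrow> f + g \<in> I"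
    and mult: "\<And>a c f. \<lbrakk>a \<in> mons n m; f \<in> I\<rbrakk> \<Longrightarrow> Poly_Mapping.single a c * f \<in> I"
  shows "ideal I (poly_ring n m)"
proof -
  interpret R: cring "poly_ring n m" by (rule cring_poly_ring)
  have "sum h S \<in> I" if "\<And>i. i \<in> S \<Longrightarrow> h i \<in> I" for h and S :: "mon set"
    using that by (induction S rule: infinite_finite_induct) (auto intro: zero add)
  note sum = this
  have mult': "g * f \<in> I" if "g \<in> carrier (poly_ring n m)" "f \<in> I" for f g
  proof -
    have "(\<Sum>a\<in>mkeys g. Poly_Mapping.single a (Poly_Mapping.lookup g a) * f) \<in> I"
      using that by (intro sum mult) (auto simp: carrier_iff)
    then show ?thesis by (subst sum_monomials[of g]) (simp add: sum_distrib_right)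
  qed
  show ?thesis
  proof (rule idealI)
    show "ring (poly_ring n m)" by (rule R.ring_axioms)
    show "subgroup I (add_monoid (poly_ring n m))"
    proof (rule R.add.subgroupI)
      show "I \<subseteq> carrier (poly_ring n m)" by (rule sub)
      show "I \<noteq> {}" using zero by blast
      fix f assume f: "f \<in> I"
      have "f \<in> carrier (poly_ring n m)" using f sub by blast
      then have "\<ominus>\<^bsub>poly_ring n m\<^esub> f = - f"
        by (intro R.minus_equality) (auto intro: carrier_uminus)
      moreover have "(- 1) * f \<in> I" using f by (intro mult') (auto intro: carrier_uminus)
      ultimately show "\<ominus>\<^bsub>poly_ring n m\<^esub> f \<in> I" by simp
    qed (use add in auto)
    show "g \<otimes>\<^bsub>poly_ring n m\<^esub> f \<in> I" "f \<otimes>\<^bsub>poly_ring n m\<^esub> g \<in> I"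
      if "f \<in> I" "g \<in> carrier (poly_ring n m)" for f g
      using mult'[OF that(2,1)] by (simp_all add: ac_simps)
  qed
qed

text \<open>Restates the closure laws of an ideal with the operations of the type
  \<open>mpoly\<close> itself, so that \<open>sum\<close> and \<open>prod\<close> can be
  used.\<close>

locale poly_ideal =
  fixes n m :: nat and I :: "mpoly set"
  assumes is_ideal: "ideal I (poly_ring n m)"
begin

lemma in_carrier: "f \<in> I \<Longrightarrow> f \<in> carrier (poly_ring n m)"
  using ideal.Icarr[OF is_ideal] .

lemma zero_closed [simp]: "0 \<in> I"
  using additive_subgroup.zero_closed[OF ideal.axioms(1)[OF is_ideal]] by simp

lemma add_closed: "\<lbrakk>f \<in> I; g \<in> I\<rbrakk> \<Longrightarrow> f + g \<in> I"
  using additive_subgroup.a_closed[OF ideal.axioms(1)[OF is_ideal]] by simp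

lemma mult_closed: "\<lbrakk>f \<in> carrier (poly_ring n m); g \<in> I\<rbrakk> \<Longrightarrow> f * g \<in> I"
  using ideal.I_l_closed[OF is_ideal] by simp

lemma mult_right_closed: "\<lbrakk>f \<in> I; g \<in> carrier (poly_ring n m)\<rbrakk> \<Longrightarrow> f * g \<in> I"
  using mult_closed[of g f] by (simp add: mult.commute)

lemma uminus_closed: "f \<in> I \<Longrightarrow> - f \<in> I"
  using mult_closed[of "- 1" f] by (simp add: carrier_uminus)

lemma diff_closed: "\<lbrakk>f \<in> I; g \<in> I\<rbrakk> \<Longrightarrow> f - g \<in> I"
  using add_closed[of f "- g"] by (simp add: uminus_closed)

lemma sum_closed: "(\<And>i. i \<in> S \<Longrightarrow> f i \<in> I) \<Longrightarrow> sum f S \<in> I"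
  by (induction S rule: infinite_finite_induct) (auto intro: add_closed)

lemma prod_pair:
  assumes "finite S" "a \<in> S" "b \<in> S" "a \<noteq> b" "f a * f b \<in> I" "\<And>i. i \<in> S \<Longrightarrow> f i \<in> carrier (poly_ring n m)"
  shows "prod f S \<in> I"
proof -
  have "prod f S = f a * f b * prod f (S - {a} - {b})"
    using assms by (simp add: prod.remove[of S a] prod.remove[of "S - {a}" b] mult.assoc)
  then show ?thesis using assms by (auto intro!: mult_right_closed carrier_prod)
qed

end

lemma vanishing_ideal_is_ideal: "poly_ideal n m (vanishing_ideal n m Z)"
  unfolding poly_ideal_def
  by (rule poly_idealI) (auto simp: vanishing_ideal_def eval_add eval_mult intro: carrier_intros)

lemma genideal_poly_ideal:
  assumes "S \<subseteq> carrier (poly_ring n m)"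
  shows "poly_ideal n m (Idl\<^bsub>poly_ring n m\<^esub> S)"
  using ring.genideal_ideal[OF cring.axioms(1)[OF cring_poly_ring] assms] by (simp add: poly_ideal_def)

lemma genideal_subset:
  assumes "poly_ideal n m J" "S \<subseteq> J"
  shows "Idl\<^bsub>poly_ring n m\<^esub> S \<subseteq> J"
  using ring.genideal_minimal[OF cring.axioms(1)[OF cring_poly_ring]] assms by (simp add: poly_ideal_def)

lemma genideal_generator:
  assumes "S \<subseteq> carrier (poly_ring n m)" "g \<in> S"
  shows "g \<in> Idl\<^bsub>poly_ring n m\<^esub> S"
  using ring.genideal_self[OF cring.axioms(1)[OF cring_poly_ring] assms(1)] assms(2) by blast

section \<open>Homogeneous components\<close>

definition hom_component :: "nat \<Rightarrow> mpoly \<Rightarrow> mpoly" where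
  "hom_component d f =
     (\<Sum>a\<in>{a \<in> mkeys f. mon_degree a = d}. Poly_Mapping.single a (Poly_Mapping.lookup f a))"

lemma lookup_hom_component:
  "Poly_Mapping.lookup (hom_component d f) a = (if mon_degree a = d then Poly_Mapping.lookup f a else 0)"
  unfolding hom_component_def
  by (auto simp: lookup_sum lookup_single when_def in_keys_iff)

lemma keys_hom_component:
  "mkeys (hom_component d f) = {a \<in> mkeys f. mon_degree a = d}"
  by (auto simp: in_keys_iff lookup_hom_component split: if_splits)

lemma hom_component_zero [simp]: "hom_component d 0 = 0"
  by (simp add: hom_component_def)

lemma hom_component_add: "hom_component d (f + g) = hom_component d f + hom_component d g"
  by (rule poly_mapping_eqI) (simp add: lookup_hom_component lookup_add)

lemma hom_component_single_mult:
  "hom_component d (Poly_Mapping.single a c * f) =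
     (if mon_degree a \<le> d then Poly_Mapping.single a c * hom_component (d - mon_degree a) f else 0)"
proof (rule poly_mapping_eqI)
  fix x
  show "Poly_Mapping.lookup (hom_component d (Poly_Mapping.single a c * f)) x =
    Poly_Mapping.lookup (if mon_degree a \<le> d then Poly_Mapping.single a c * hom_component (d - mon_degree a) f else 0) x"
  proof (cases "\<exists>b. x = a + b")
    case True
    then obtain b where "x = a + b" by blast
    then show ?thesis by (auto simp: lookup_hom_component mon_degree_add)
  next
    case False
    then have "Poly_Mapping.lookup (Poly_Mapping.single a c * g) x = 0" for g :: mpoly
      by (metis in_keys_iff keys_single_mult)
    then show ?thesis by (auto simp: lookup_hom_component)
  qed
qed

definition low_degree :: "nat \<Rightarrow> mpoly \<Rightarrow> bool" where
  "low_degree d f \<longleftrightarrow> (\<forall>a\<in>mkeys f. mon_degree a < d)"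

definition homogeneous :: "nat \<Rightarrow> mpoly \<Rightarrow> bool" where
  "homogeneous d f \<longleftrightarrow> (\<forall>a\<in>mkeys f. mon_degree a = d)"

lemma low_degree_zero [simp]: "low_degree d 0" and homogeneous_zero [simp]: "homogeneous d 0"
  by (simp_all add: low_degree_def homogeneous_def)

lemma low_degree_add: "low_degree d f \<Longrightarrow> low_degree d g \<Longrightarrow> low_degree d (f + g)"
  using keys_add[of f g] by (auto simp: low_degree_def)

lemma low_degree_uminus: "low_degree d f \<Longrightarrow> low_degree d (- f)"
  by (auto simp: low_degree_def)

lemma low_degree_diff: "low_degree d f \<Longrightarrow> low_degree d g \<Longrightarrow> low_degree d (f - g)"
  using low_degree_add[of d f "- g"] by (simp add: low_degree_uminus)

lemma low_degree_mult:
  assumes "low_degree d f" "homogeneous e g \<or> low_degree e g"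
  shows "low_degree (d + e) (f * g)"
  using assms keys_mult[of f g] unfolding low_degree_def homogeneous_def
  by (fastforce simp: mon_degree_add)

lemma homogeneous_add: "homogeneous d f \<Longrightarrow> homogeneous d g \<Longrightarrow> homogeneous d (f + g)"
  using keys_add[of f g] by (auto simp: homogeneous_def)

lemma homogeneous_sum: "(\<And>i. i \<in> S \<Longrightarrow> homogeneous d (f i)) \<Longrightarrow> homogeneous d (sum f S)"
  by (induction S rule: infinite_finite_induct) (auto intro: homogeneous_add)

lemma homogeneous_mult:
  assumes "homogeneous d f" "homogeneous e g"
  shows "homogeneous (d + e) (f * g)"
  using assms keys_mult[of f g] unfolding homogeneous_def by (fastforce simp: mon_degree_add)

lemma homogeneous_hom_component [simp]: "homogeneous d (hom_component d f)"
  by (simp add: homogeneous_def keys_hom_component)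

lemma hom_component_homogeneous:
  assumes "homogeneous d f"
  shows "hom_component e f = (if e = d then f else 0)"
  using assms by (intro poly_mapping_eqI) (auto simp: lookup_hom_component homogeneous_def in_keys_iff)

text \<open>\<open>g\<close> may be 0, in which case \<open>q\<close> merely has degree below
  \<open>d\<close>. This keeps the relation additive even when top terms cancel, where
  \<open>top_component\<close> would drop to a lower degree.\<close>

definition leading_form :: "nat \<Rightarrow> mpoly \<Rightarrow> mpoly \<Rightarrow> bool" where
  "leading_form d g q \<longleftrightarrow> homogeneous d g \<and> low_degree d (q - g)"

lemma leading_form_mult:
  assumes "leading_form d g q" "leading_form e g' q'"
  shows "leading_form (d + e) (g * g') (q * q')"
proof -
  have "q * q' - g * g' = (q - g) * g' + ((q' - g') * g + (q - g) * (q' - g'))"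
    by (simp add: algebra_simps)
  moreover have "low_degree (d + e) ((q - g) * g' + ((q' - g') * g + (q - g) * (q' - g')))"
    using assms low_degree_mult[of e "q' - g'" d g] unfolding leading_form_def
    by (intro low_degree_add) (auto intro: low_degree_mult simp: add.commute)
  ultimately show ?thesis using assms by (auto simp: leading_form_def intro: homogeneous_mult)
qed

lemma leading_form_prod:
  assumes "finite S" "\<And>i. i \<in> S \<Longrightarrow> leading_form 1 (g i) (q i)"
  shows "leading_form (card S) (prod g S) (prod q S)"
  using assms
proof (induction S rule: finite_induct)
  case (insert i S)
  then show ?case using leading_form_mult[of 1 "g i" "q i" "card S" "prod g S" "prod q S"] by simp
qed (auto simp: leading_form_def homogeneous_def)

lemma homogeneous_var: "homogeneous 1 (var v)"
  by (simp add: homogeneous_def var_def)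

lemma leading_form_self: "homogeneous d g \<Longrightarrow> leading_form d g g"
  by (simp add: leading_form_def)

lemma top_component_leading_form:
  assumes "leading_form d g q" "g \<noteq> 0"
  shows "top_component q = g" "q \<noteq> 0"
proof -
  have g: "homogeneous d g" and l: "low_degree d (q - g)" using assms(1) by (auto simp: leading_form_def)
  have q: "hom_component d q = g"
    using l by (intro poly_mapping_eqI)
      (use g l in \<open>fastforce simp: lookup_hom_component homogeneous_def low_degree_def in_keys_iff lookup_minus\<close>)
  then show "q \<noteq> 0" using assms(2) by auto
  have "mon_degree a \<le> d" if "a \<in> mkeys q" for a
  proof (cases "a \<in> mkeys g")
    case True
    then show ?thesis using g by (simp add: homogeneous_def)
  next
    case False
    then have "a \<in> mkeys (q - g)" using that by (simp add: in_keys_iff lookup_minus)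
    then show ?thesis using l by (auto simp: low_degree_def intro: less_imp_le)
  qed
  moreover have "d \<in> mon_degree ` mkeys q"
    using q assms(2) keys_hom_component[of d q] by (metis (mono_tags, lifting) Collect_empty_eq
      image_eqI keys_eq_empty)
  ultimately have "Max (mon_degree ` mkeys q) = d"
    by (intro Max_eqI) auto
  then show "top_component q = g"
    using q by (simp add: top_component_def hom_component_def)
qed

section \<open>Diagonal lexicographic orders\<close>

locale diagonal_lex =
  fixes n m :: nat and V :: "((nat \<times> nat) \<times> (nat \<times> nat)) set" and L :: "(mon \<times> mon) set"
  assumes linear: "linear_order_on (board n m) V"
    and diagonal: "\<And>i j i' j'. \<lbrakk>(i, j) \<in> board n m; (i', j') \<in> board n m; i + j < i' + j'\<rbrakk>
      \<Longrightarrow> ((i', j'), (i, j)) \<in> V"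
    and L_def: "L = lex_order n m V"
begin

lemma V_trans: "(u, v) \<in> V \<Longrightarrow> (v, w) \<in> V \<Longrightarrow> (u, w) \<in> V"
  using linear unfolding linear_order_on_def partial_order_on_def preorder_on_def by (meson transD)

lemma V_antisym: "(u, v) \<in> V \<Longrightarrow> (v, u) \<in> V \<Longrightarrow> u = v"
  using linear unfolding linear_order_on_def partial_order_on_def by (meson antisymD)

lemma V_total: "u \<in> board n m \<Longrightarrow> v \<in> board n m \<Longrightarrow> (u, v) \<in> V \<or> (v, u) \<in> V"
  using linear unfolding linear_order_on_def partial_order_on_def preorder_on_def
  by (metis refl_onD total_on_def)

lemma V_max:
  assumes "finite S" "S \<noteq> {}" "S \<subseteq> board n m"
  obtains v where "v \<in> S" "\<And>w. w \<in> S \<Longrightarrow> (w, v) \<in> V"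
proof -
  have "\<exists>v\<in>S. \<forall>w\<in>S. (w, v) \<in> V"
    using assms
  proof (induction S rule: finite_ne_induct)
    case (singleton x)
    then show ?case using V_total[of x x] by auto
  next
    case (insert x S)
    then obtain v where v: "v \<in> S" "\<forall>w\<in>S. (w, v) \<in> V" by auto
    have xv: "x \<in> board n m" "v \<in> board n m" using insert v by auto
    show ?case
    proof (cases "(x, v) \<in> V")
      case False
      then have "(v, x) \<in> V" "(x, x) \<in> V" using V_total xv by blast+
      then have "\<forall>w\<in>insert x S. (w, x) \<in> V" using v(2) V_trans by blast
      then show ?thesis by blast
    qed (use v in blast)
  qed
  then show ?thesis using that by blast
qed

lemma lessI:
  assumes "a \<in> mons n m" "b \<in> mons n m" "v \<in> board n m"
    "Poly_Mapping.lookup a v < Poly_Mapping.lookup b v"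
    "\<And>w. \<lbrakk>w \<in> board n m; (v, w) \<in> V; w \<noteq> v\<rbrakk> \<Longrightarrow> Poly_Mapping.lookup a w = Poly_Mapping.lookup b w"
  shows "(a, b) \<in> L"
  using assms unfolding L_def lex_order_def by blast

lemma lessE:
  assumes "(a, b) \<in> L"
  obtains v where "a \<in> mons n m" "b \<in> mons n m" "v \<in> board n m"
    "Poly_Mapping.lookup a v < Poly_Mapping.lookup b v"
    "\<And>w. \<lbrakk>w \<in> board n m; (v, w) \<in> V; w \<noteq> v\<rbrakk> \<Longrightarrow> Poly_Mapping.lookup a w = Poly_Mapping.lookup b w"
  using assms unfolding L_def lex_order_def by blast

lemma less_irrefl: "(a, a) \<notin> L"
  by (auto elim: lessE)

lemma less_trans:
  assumes "(a, b) \<in> L" "(b, c) \<in> L"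
  shows "(a, c) \<in> L"
proof -
  obtain v where v: "a \<in> mons n m" "b \<in> mons n m" "v \<in> board n m"
    "Poly_Mapping.lookup a v < Poly_Mapping.lookup b v"
    "\<And>w. \<lbrakk>w \<in> board n m; (v, w) \<in> V; w \<noteq> v\<rbrakk> \<Longrightarrow> Poly_Mapping.lookup a w = Poly_Mapping.lookup b w"
    using lessE[OF assms(1)] by blast
  obtain w where w: "c \<in> mons n m" "w \<in> board n m"
    "Poly_Mapping.lookup b w < Poly_Mapping.lookup c w"
    "\<And>u. \<lbrakk>u \<in> board n m; (w, u) \<in> V; u \<noteq> w\<rbrakk> \<Longrightarrow> Poly_Mapping.lookup b u = Poly_Mapping.lookup c u"
    using lessE[OF assms(2)] by blast
  consider "v = w" | "v \<noteq> w" "(v, w) \<in> V" | "v \<noteq> w" "(w, v) \<in> V"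
    using V_total v(3) w(2) by blast
  then show ?thesis
  proof cases
    case 1
    then show ?thesis using v w by (intro lessI[of a c v]) auto
  next
    case 2
    then have "Poly_Mapping.lookup a u = Poly_Mapping.lookup c u" if "u \<in> board n m" "(w, u) \<in> V" "u \<noteq> w" for u
      using that v(5)[of u] w(4)[of u] V_trans[of v w u] V_antisym[of v w] by metis
    then show ?thesis using 2 v w by (intro lessI[of a c w]) auto
  next
    case 3
    then have "Poly_Mapping.lookup a u = Poly_Mapping.lookup c u" if "u \<in> board n m" "(v, u) \<in> V" "u \<noteq> v" for u
      using that v(5)[of u] w(4)[of u] V_trans[of w v u] V_antisym[of v w] by metis
    then show ?thesis using 3 v w(1) w(4)[of v] by (intro lessI[of a c v]) auto
  qed
qed

lemma less_asym: "(a, b) \<in> L \<Longrightarrow> (b, a) \<notin> L"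
  using less_trans less_irrefl by blast

lemma less_total:
  assumes "a \<in> mons n m" "b \<in> mons n m" "a \<noteq> b"
  shows "(a, b) \<in> L \<or> (b, a) \<in> L"
proof -
  let ?S = "{v \<in> board n m. Poly_Mapping.lookup a v \<noteq> Poly_Mapping.lookup b v}"
  obtain v where "Poly_Mapping.lookup a v \<noteq> Poly_Mapping.lookup b v"
    using assms(3) by (meson poly_mapping_eqI)
  moreover from this have "v \<in> board n m"
    using assms(1,2) unfolding mons_def by (metis (mono_tags, lifting) in_keys_iff mem_Collect_eq subsetD)
  ultimately have "?S \<noteq> {}" by blast
  moreover have "finite ?S" by (simp add: board_def)
  ultimately obtain u where u: "u \<in> ?S" "\<And>w. w \<in> ?S \<Longrightarrow> (w, u) \<in> V"
    using V_max[of ?S] by blast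
  have eq: "Poly_Mapping.lookup a w = Poly_Mapping.lookup b w" if "w \<in> board n m" "(u, w) \<in> V" "w \<noteq> u" for w
    using that u(2)[of w] V_antisym by blast
  show ?thesis
  proof (cases "Poly_Mapping.lookup a u < Poly_Mapping.lookup b u")
    case True
    then show ?thesis using lessI[OF assms(1,2) _ True eq] u(1) by blast
  next
    case False
    then have lt: "Poly_Mapping.lookup b u < Poly_Mapping.lookup a u" using u(1) by auto
    have "(b, a) \<in> L" using u(1) eq by (intro lessI[OF assms(2,1) _ lt]) auto
    then show ?thesis ..
  qed
qed

lemma less_mons: "(a, b) \<in> L \<Longrightarrow> a \<in> mons n m \<and> b \<in> mons n m"
  by (auto elim: lessE)

lemma less_add:
  assumes "(a, b) \<in> L" "c \<in> mons n m"
  shows "(c + a, c + b) \<in> L"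
  using assms(1)
proof (rule lessE)
  fix v
  assume "a \<in> mons n m" "b \<in> mons n m" "v \<in> board n m"
    "Poly_Mapping.lookup a v < Poly_Mapping.lookup b v"
    "\<And>w. \<lbrakk>w \<in> board n m; (v, w) \<in> V; w \<noteq> v\<rbrakk> \<Longrightarrow> Poly_Mapping.lookup a w = Poly_Mapping.lookup b w"
  then show ?thesis using assms(2)
    by (intro lessI[of _ _ v]) (auto simp: mon_add_iff lookup_add)
qed

lemma lead_mon_eqI:
  assumes "a \<in> mkeys f" "\<And>b. \<lbrakk>b \<in> mkeys f; b \<noteq> a\<rbrakk> \<Longrightarrow> (b, a) \<in> L"
  shows "lead_mon L f = a"
  unfolding lead_mon_def
proof (rule the_equality)
  fix b assume b: "b \<in> mkeys f \<and> (\<forall>c\<in>mkeys f. c \<noteq> b \<longrightarrow> (c, b) \<in> L)"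
  show "b = a"
  proof (rule ccontr)
    assume "b \<noteq> a"
    then have "(a, b) \<in> L" "(b, a) \<in> L" using assms b by auto
    then show False using less_asym by blast
  qed
qed (use assms in auto)

lemma lead_mon_exists:
  assumes "f \<in> carrier (poly_ring n m)" "f \<noteq> 0"
  shows "lead_mon L f \<in> mkeys f"
    "\<And>b. \<lbrakk>b \<in> mkeys f; b \<noteq> lead_mon L f\<rbrakk> \<Longrightarrow> (b, lead_mon L f) \<in> L"
proof -
  have "\<exists>a\<in>S. \<forall>b\<in>S. b \<noteq> a \<longrightarrow> (b, a) \<in> L" if "finite S" "S \<noteq> {}" "S \<subseteq> mons n m" for S
    using that
  proof (induction S rule: finite_ne_induct)
    case (insert x S)
    then obtain a where a: "a \<in> S" "\<forall>b\<in>S. b \<noteq> a \<longrightarrow> (b, a) \<in> L" by auto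
    show ?case
    proof (cases "(x, a) \<in> L")
      case False
      then have "(a, x) \<in> L" using less_total[of x a] insert a by blast
      then have "\<forall>b\<in>insert x S. b \<noteq> x \<longrightarrow> (b, x) \<in> L"
        using a(2) less_trans by (metis insert_iff)
      then show ?thesis by blast
    qed (use a in blast)
  qed simp
  then obtain a where "a \<in> mkeys f" "\<forall>b\<in>mkeys f. b \<noteq> a \<longrightarrow> (b, a) \<in> L"
    using assms by (metis carrier_iff finite_keys keys_eq_empty)
  moreover from this have "lead_mon L f = a" using lead_mon_eqI by blast
  ultimately show "lead_mon L f \<in> mkeys f" "\<And>b. \<lbrakk>b \<in> mkeys f; b \<noteq> lead_mon L f\<rbrakk> \<Longrightarrow> (b, lead_mon L f) \<in> L"
    by auto
qed

section \<open>Monomials of the initial ideal and induction on monomials\<close>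

text \<open>The polynomials all of whose monomials are divisible by leading monomials of nonzero
  elements of \<open>I\<close> form an ideal that contains the generators of the initial
  ideal.\<close>

lemma initial_ideal_monomial:
  assumes "poly_ideal n m I" "mon_poly u \<in> initial_ideal n m L I"
  obtains f w where "f \<in> I" "f \<noteq> 0" "u = w + lead_mon L f"
proof -
  interpret I: poly_ideal n m I by fact
  let ?J = "{p \<in> carrier (poly_ring n m). \<forall>a\<in>mkeys p. \<exists>f\<in>I. f \<noteq> 0 \<and> (\<exists>w. a = w + lead_mon L f)}"
  have "poly_ideal n m ?J"
    unfolding poly_ideal_def
  proof (rule poly_idealI)
    show "f + g \<in> ?J" if "f \<in> ?J" "g \<in> ?J" for f g
      using that keys_add[of f g] by (auto intro: carrier_add)
    show "Poly_Mapping.single a c * f \<in> ?J" if a: "a \<in> mons n m" and f: "f \<in> ?J" for a c f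
    proof (clarsimp, intro conjI ballI)
      show "Poly_Mapping.single a c * f \<in> carrier (poly_ring n m)"
        using that by (auto intro: carrier_mult carrier_single)
      fix x assume "x \<in> mkeys (Poly_Mapping.single a c * f)"
      then obtain b where b: "b \<in> mkeys f" "x = a + b" by (rule keys_single_mult)
      then obtain g w where "g \<in> I" "g \<noteq> 0" "b = w + lead_mon L g" using f by blast
      then show "\<exists>f\<in>I. f \<noteq> 0 \<and> (\<exists>w. x = w + lead_mon L f)"
        using b(2) by (metis add.assoc)
    qed
  qed auto
  moreover have "{mon_poly (lead_mon L f) | f. f \<in> I \<and> f \<noteq> 0} \<subseteq> ?J"
  proof (clarsimp simp: mon_poly_def)
    fix f assume f: "f \<in> I" "f \<noteq> 0"
    have "f \<in> carrier (poly_ring n m)" using I.in_carrier f(1) by blast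
    then have "lead_mon L f \<in> mons n m" using lead_mon_exists(1)[of f] f(2) by (auto simp: carrier_iff)
    then show "Poly_Mapping.single (lead_mon L f) 1 \<in> carrier (poly_ring n m) \<and>
      (\<exists>fa\<in>I. fa \<noteq> 0 \<and> (\<exists>w. lead_mon L f = w + lead_mon L fa))"
      using f by (auto intro!: carrier_single bexI[of _ f] exI[of _ 0])
  qed
  ultimately have "initial_ideal n m L I \<subseteq> ?J"
    unfolding initial_ideal_def by (rule genideal_subset)
  then have "mon_poly u \<in> ?J" using assms(2) by blast
  then have "\<exists>f\<in>I. f \<noteq> 0 \<and> (\<exists>w. u = w + lead_mon L f)" by (simp add: mon_poly_def)
  then show ?thesis using that by blast
qed

lemma lead_mon_in_initial_ideal:
  assumes "poly_ideal n m I" "f \<in> I" "f \<noteq> 0"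
  shows "mon_poly (lead_mon L f) \<in> initial_ideal n m L I"
  unfolding initial_ideal_def
proof (rule genideal_generator)
  interpret I: poly_ideal n m I by fact
  show "{mon_poly (lead_mon L f) |f. f \<in> I \<and> f \<noteq> 0} \<subseteq> carrier (poly_ring n m)"
    using lead_mon_exists(1) I.in_carrier
    by (fastforce simp: mon_poly_def carrier_iff)
qed (use assms in blast)

text \<open>Infinitely many monomials may lie lexicographically below a given one, but only finitely
  many of the same degree, since the degree bounds their exponents. The induction runs on their
  number, which is enough because the later reductions preserve the degree.\<close>

lemma mons_degree_induct [consumes 1, case_names less]:
  assumes "u \<in> mons n m"
    and step: "\<And>u. \<lbrakk>u \<in> mons n m; \<And>v. \<lbrakk>(v, u) \<in> L; mon_degree v = mon_degree u\<rbrakk> \<Longrightarrow> P v\<rbrakk>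
      \<Longrightarrow> P u"
  shows "P u"
proof -
  define below where "below u = {v. (v, u) \<in> L \<and> mon_degree v = mon_degree u}" for u
  have fin: "finite (below u)" for u
  proof -
    let ?F = "{f. \<forall>x. (x \<in> board n m \<longrightarrow> f x \<in> {0..mon_degree u}) \<and> (x \<notin> board n m \<longrightarrow> f x = (0::nat))}"
    have "Poly_Mapping.lookup v x \<le> mon_degree v" for v x
      by (cases "x \<in> mkeys v") (auto simp: mon_degree_def in_keys_iff intro: member_le_sum)
    then have le: "Poly_Mapping.lookup v x \<in> {0..mon_degree u}" if "v \<in> below u" for v x
      using that by (metis (mono_tags, lifting) atLeast0AtMost atMost_iff below_def mem_Collect_eq)
    have zero: "Poly_Mapping.lookup v x = 0" if "v \<in> below u" "x \<notin> board n m" for v x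
    proof -
      have "v \<in> mons n m" using that(1) less_mons unfolding below_def by blast
      then show ?thesis using that(2) unfolding mons_def by (metis in_keys_iff mem_Collect_eq subsetD)
    qed
    have "Poly_Mapping.lookup ` below u \<subseteq> ?F"
      by (intro image_subsetI CollectI allI conjI impI le zero)
    moreover have "finite ?F" by (rule finite_set_of_finite_funs) (auto simp: board_def)
    ultimately have "finite (Poly_Mapping.lookup ` below u)" by (rule finite_subset)
    then show "finite (below u)"
      by (rule finite_imageD) (auto intro!: inj_onI poly_mapping_eqI)
  qed
  show ?thesis
    using assms(1)
  proof (induction "card (below u)" arbitrary: u rule: less_induct)
    case less
    show ?case
    proof (rule step[OF less.prems])
      fix v assume v: "(v, u) \<in> L" "mon_degree v = mon_degree u"
      have "v \<in> below u" "v \<notin> below v" "below v \<subseteq> below u"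
        using v less_trans less_irrefl unfolding below_def by auto
      then have "below v \<subset> below u" by blast
      then have "card (below v) < card (below u)" using fin by (intro psubset_card_mono)
      then show "P v" using less.hyps less_mons[OF v(1)] by blast
    qed
  qed
qed

end

section \<open>Straightening\<close>

lemma prod_var: "(\<Prod>i\<in>S. var (v i)) = mon_poly (\<Sum>i\<in>S. Poly_Mapping.single (v i) 1)"
  by (induction S rule: infinite_finite_induct) (simp_all add: mon_poly_def var_def mult_single)

context poly_ideal
begin

lemma noninjective_prod:
  assumes "finite A" "\<And>a j. \<lbrakk>a \<in> A; j \<in> J\<rbrakk> \<Longrightarrow> x a j \<in> carrier (poly_ring n m)"
    and "\<And>a a' j. \<lbrakk>a \<in> A; a' \<in> A; j \<in> J\<rbrakk> \<Longrightarrow> x a j * x a' j \<in> I"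
    and "g ` A \<subseteq> J" "\<not> inj_on g A"
  shows "(\<Prod>a\<in>A. x a (g a)) \<in> I"
proof -
  obtain a a' where a: "a \<in> A" "a' \<in> A" "a \<noteq> a'" "g a = g a'"
    using assms(5) by (auto simp: inj_on_def)
  have "x a (g a) * x a' (g a') \<in> I" using a(1,2) assms(4) assms(3)[of a a' "g a'"] a(4) by auto
  then show ?thesis using a(1-3) assms(1,2,4) by (intro prod_pair[of A a a']) auto
qed

text \<open>Pigeonhole after expansion: every term assigns more rows than there are columns, so some
  column is used twice.\<close>

lemma few_columns_prod:
  assumes "finite A" "\<And>a j. \<lbrakk>a \<in> A; j \<in> D\<rbrakk> \<Longrightarrow> x a j \<in> carrier (poly_ring n m)"
    and "\<And>a a' j. \<lbrakk>a \<in> A; a' \<in> A; j \<in> D\<rbrakk> \<Longrightarrow> x a j * x a' j \<in> I"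
    and "finite D" "card D < card A"
  shows "(\<Prod>a\<in>A. \<Sum>j\<in>D. x a j) \<in> I"
proof -
  have "(\<Prod>a\<in>A. x a (g a)) \<in> I" if "g \<in> PiE A (\<lambda>_. D)" for g
  proof (rule noninjective_prod[of A D x g])
    show "g ` A \<subseteq> D" using that by auto
    then show "\<not> inj_on g A"
      using assms(4,5) card_inj_on_le[of g A D] by auto
  qed (use assms in auto)
  then show ?thesis
    using assms(1,4) by (simp add: prod_sum_PiE sum_closed)
qed

text \<open>The factors are exchanged one at a time modulo \<open>I\<close>. The multiplier
  \<open>t\<close> is carried along because the factors agree only after multiplication by
  it.\<close>

lemma mult_prod_cong:
  assumes "finite A" "t \<in> carrier (poly_ring n m)"
    and "\<And>a. a \<in> A \<Longrightarrow> u a \<in> carrier (poly_ring n m)" "\<And>a. a \<in> A \<Longrightarrow> v a \<in> carrier (poly_ring n m)"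
    and "\<And>a. a \<in> A \<Longrightarrow> t * (u a - v a) \<in> I"
  shows "t * (prod u A - prod v A) \<in> I"
  using assms
proof (induction A rule: finite_induct)
  case (insert a A)
  have "t * (prod u (insert a A) - prod v (insert a A)) =
      t * (u a - v a) * prod u A + v a * (t * (prod u A - prod v A))"
    using insert(1,2) by (simp add: algebra_simps)
  also have "\<dots> \<in> I"
  proof (rule add_closed)
    show "t * (u a - v a) * prod u A \<in> I"
      by (rule mult_right_closed) (use insert in \<open>auto intro: carrier_prod\<close>)
    show "v a * (t * (prod u A - prod v A)) \<in> I"
      using insert by (intro mult_closed[of "v a"]) auto
  qed
  finally show ?case .
qed simp

text \<open>
  The \<open>k\<close> row sums over \<open>J = W \<union> D \<union> E\<close> have product in \<open>I\<close>.  The columns in \<open>W\<close> are killed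
  by \<open>t\<close>, and \<open>D\<close> has too few columns to accommodate the remaining rows, so only \<open>E\<close> is left.
\<close>

lemma injective_sum:
  fixes x :: "nat \<Rightarrow> nat \<Rightarrow> mpoly"
  assumes A: "finite A" and J: "finite J" "J = W \<union> D \<union> E" "W \<inter> D = {}" "W \<inter> E = {}" "D \<inter> E = {}"
    and x: "\<And>a j. \<lbrakk>a \<in> A; j \<in> J\<rbrakk> \<Longrightarrow> x a j \<in> carrier (poly_ring n m)"
    and col: "\<And>a a' j. \<lbrakk>a \<in> A; a' \<in> A; j \<in> J\<rbrakk> \<Longrightarrow> x a j * x a' j \<in> I"
    and rows: "\<And>S. \<lbrakk>S \<subseteq> A; card S = k\<rbrakk> \<Longrightarrow> (\<Prod>a\<in>S. \<Sum>j\<in>J. x a j) \<in> I"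
    and card: "k + card D \<le> card A"
    and t: "t \<in> carrier (poly_ring n m)" "\<And>a j. \<lbrakk>a \<in> A; j \<in> W\<rbrakk> \<Longrightarrow> t * x a j \<in> I"
  shows "t * (\<Sum>g\<in>{g \<in> PiE A (\<lambda>_. E). inj_on g A}. \<Prod>a\<in>A. x a (g a)) \<in> I"
proof -
  \<comment> \<open>\<open>\<rho>\<close> is the full row sum, \<open>\<mu>\<close> cancels its part
    over \<open>D\<close>, and \<open>\<Lambda>\<close> is its part over \<open>E\<close>. The rest
    of \<open>\<rho> + \<mu>\<close> is the part over \<open>W\<close>, which \<open>t\<close> sends
    into the ideal.\<close>
  define \<rho> where "\<rho> a = (\<Sum>j\<in>J. x a j)" for a
  define \<mu> where "\<mu> a = (\<Sum>j\<in>D. - x a j)" for a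
  define \<Lambda> where "\<Lambda> a = (\<Sum>j\<in>E. x a j)" for a
  have fin: "finite W" "finite D" "finite E" using J by auto
  have carr: "\<rho> a \<in> carrier (poly_ring n m)" "\<mu> a \<in> carrier (poly_ring n m)"
    "\<Lambda> a \<in> carrier (poly_ring n m)" if "a \<in> A" for a
    using that x J(2) unfolding \<rho>_def \<mu>_def \<Lambda>_def by (auto intro!: carrier_sum carrier_uminus)
  have "(\<Prod>a\<in>A. \<rho> a + \<mu> a) \<in> I"
  proof -
    \<comment> \<open>\<open>S\<close> is the set of rows that contribute \<open>\<rho>\<close> to a
      term of the expansion. With at least \<open>k\<close> such rows a product of row sums in the
      ideal splits off; otherwise more than \<open>card D\<close> rows have to share the columns of
      \<open>D\<close>.\<close>
    have "(\<Prod>a\<in>S. \<rho> a) * (\<Prod>a\<in>A - S. \<mu> a) \<in> I" if S: "S \<subseteq> A" for S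
    proof (cases "k \<le> card S")
      case True
      then obtain S' where S': "S' \<subseteq> S" "card S' = k"
        using obtain_subset_with_card_n by metis
      have "finite S" using S A finite_subset by blast
      then have "prod \<rho> S = prod \<rho> (S - S') * prod \<rho> S'"
        using S'(1) by (rule prod.subset_diff[rotated])
      also have "\<dots> \<in> I"
        using rows[of S'] S S' carr unfolding \<rho>_def[symmetric]
        by (intro mult_closed carrier_prod) auto
      finally show ?thesis using S carr by (intro mult_right_closed carrier_prod) auto
    next
      case False
      have "(\<Prod>a\<in>A - S. \<mu> a) \<in> I"
        unfolding \<mu>_def
      proof (rule few_columns_prod)
        have "card (A - S) = card A - card S"
          using S A finite_subset by (intro card_Diff_subset) auto
        then show "card D < card (A - S)" using False card by linarith
      qed (use A fin x J(2) col in \<open>auto intro: carrier_uminus\<close>)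
      then show ?thesis using S carr by (intro mult_closed carrier_prod) auto
    qed
    then show ?thesis using A by (subst prod_add) (auto intro: sum_closed)
  qed
  note all = this
  have "t * (\<rho> a + \<mu> a - \<Lambda> a) \<in> I" if "a \<in> A" for a
  proof -
    have "\<rho> a = (\<Sum>j\<in>W. x a j) + (\<Sum>j\<in>D. x a j) + (\<Sum>j\<in>E. x a j)"
      using fin J(3-5) unfolding \<rho>_def J(2) by (subst sum.union_disjoint; (subst sum.union_disjoint)?) auto
    then have "t * (\<rho> a + \<mu> a - \<Lambda> a) = (\<Sum>j\<in>W. t * x a j)"
      by (simp add: \<mu>_def \<Lambda>_def sum_negf sum_distrib_left)
    then show ?thesis using t(2)[OF that] by (simp add: sum_closed)
  qed
  then have "t * ((\<Prod>a\<in>A. \<rho> a + \<mu> a) - (\<Prod>a\<in>A. \<Lambda> a)) \<in> I"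
    using A t(1) carr by (intro mult_prod_cong) (auto intro: carrier_add)
  from diff_closed[OF mult_closed[OF t(1) all] this] have 1: "t * (\<Prod>a\<in>A. \<Lambda> a) \<in> I" by (simp add: right_diff_distrib)
  \<comment> \<open>In the expansion of the product of the \<open>\<Lambda> a\<close>, maps that
    repeat a column contribute elements of the ideal, so only the injections remain.\<close>
  let ?P = "PiE A (\<lambda>_. E)" and ?x = "\<lambda>g. \<Prod>a\<in>A. x a (g a)"
  have finP: "finite ?P" using A fin by (intro finite_PiE)
  have "(\<Prod>a\<in>A. \<Lambda> a) = (\<Sum>g\<in>?P. ?x g)"
    unfolding \<Lambda>_def using A fin by (simp add: prod_sum_PiE)
  also have "\<dots> = (\<Sum>g\<in>?P - {g \<in> ?P. inj_on g A}. ?x g) + (\<Sum>g\<in>{g \<in> ?P. inj_on g A}. ?x g)"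
    using finP by (intro sum.subset_diff) auto
  finally have "t * (\<Sum>g\<in>{g \<in> ?P. inj_on g A}. ?x g) =
      t * (\<Prod>a\<in>A. \<Lambda> a) - t * (\<Sum>g\<in>?P - {g \<in> ?P. inj_on g A}. ?x g)"
    by (simp add: algebra_simps)
  also have "\<dots> \<in> I"
  proof (intro diff_closed 1 mult_closed t(1) sum_closed)
    fix g assume g: "g \<in> ?P - {g \<in> ?P. inj_on g A}"
    then have "g ` A \<subseteq> E" "\<not> inj_on g A" by auto
    then show "?x g \<in> I" using A x col J(2) by (intro noninjective_prod[of A E]) auto
  qed
  finally show ?thesis .
qed

end

context diagonal_lex
begin

text \<open>At the smallest row \<open>a\<close> where \<open>f\<close> and \<open>f0\<close>
  differ, \<open>f\<close> goes further right, because the smaller chain columns are taken by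
  earlier rows. Every later variable of either monomial, and that of \<open>f\<close> in row
  \<open>a\<close>, lies on a larger antidiagonal than \<open>h a (f0 a)\<close>, so the order is
  decided at \<open>h a (f0 a)\<close>. \<open>h\<close> stands for either orientation of the board;
  both preserve the coordinate sum.\<close>

lemma chain_dominates:
  fixes h :: "nat \<Rightarrow> nat \<Rightarrow> nat \<times> nat"
  assumes h_inj: "\<And>a j a' j'. h a j = h a' j' \<Longrightarrow> a = a' \<and> j = j'"
    and h_sum: "\<And>a j. fst (h a j) + snd (h a j) = a + j"
    and A: "finite A" "\<And>a. a \<in> A \<Longrightarrow> h a (f a) \<in> board n m" "\<And>a. a \<in> A \<Longrightarrow> h a (f0 a) \<in> board n m"
    and f0: "strict_mono_on A f0" and f: "inj_on f A"
    and outside: "\<And>a a'. \<lbrakk>a \<in> A; a' \<in> A; f a \<notin> f0 ` A\<rbrakk> \<Longrightarrow> f0 a' < f a"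
    and neq: "\<exists>a\<in>A. f a \<noteq> f0 a"
  shows "((\<Sum>a\<in>A. Poly_Mapping.single (h a (f a)) 1), (\<Sum>a\<in>A. Poly_Mapping.single (h a (f0 a)) 1)) \<in> L"
    (is "(?\<sigma> f, ?\<sigma> f0) \<in> L")
proof -
  let ?B = "{a \<in> A. f a \<noteq> f0 a}"
  define a where "a = Min ?B"
  have B: "finite ?B" "?B \<noteq> {}" using A(1) neq by auto
  have a: "a \<in> A" "f a \<noteq> f0 a" using Min_in[OF B] by (auto simp: a_def)
  have before: "f b = f0 b" if "b \<in> A" "b < a" for b
    using that B by (auto simp: a_def)
  have mono: "f0 b \<le> f0 c" if "b \<in> A" "c \<in> A" "b \<le> c" for b c
    using that f0 by (cases "b = c") (auto simp: strict_mono_on_def less_imp_le)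
  have after: "f0 a \<le> f b" if b: "b \<in> A" "a \<le> b" for b
  proof (cases "f b \<in> f0 ` A")
    case True
    then obtain c where c: "c \<in> A" "f b = f0 c" by blast
    have "\<not> c < a"
    proof
      assume "c < a"
      then have "f c = f b" using before c by simp
      then have "c = b" using inj_onD[OF f _ c(1) b(1)] by simp
      then show False using \<open>c < a\<close> b(2) by simp
    qed
    then show ?thesis using mono a(1) c by simp
  qed (use outside[OF b(1) a(1)] in simp)
  have after_lt: "a + f0 a < b + f b" if "b \<in> A" "a \<le> b" for b
  proof (cases "b = a")
    case True
    then show ?thesis using after[OF that] a(2) by simp
  next
    case False
    then show ?thesis using after[OF that] that(2) by simp
  qed
  have after0_lt: "a + f0 a < b + f0 b" if "b \<in> A" "a < b" for b
    using mono[OF a(1) that(1)] that(2) by simp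
  let ?v = "h a (f0 a)"
  have lookup: "Poly_Mapping.lookup (?\<sigma> g) w = (\<Sum>b\<in>A. if h b (g b) = w then 1 else 0)" for g w
    by (simp add: lookup_sum lookup_single when_def del: One_nat_def)
  have mons: "?\<sigma> g \<in> mons n m" if "\<And>b. b \<in> A \<Longrightarrow> h b (g b) \<in> board n m" for g
    using that keys_sum[of "\<lambda>b. Poly_Mapping.single (h b (g b)) (1::nat)" A]
    by (force simp: mons_def in_keys_iff lookup)
  show ?thesis
  proof (rule lessI[of _ _ ?v])
    show "?\<sigma> f \<in> mons n m" "?\<sigma> f0 \<in> mons n m" using mons A by blast+
    show "?v \<in> board n m" using A(3) a(1) .
    have "Poly_Mapping.lookup (?\<sigma> f) ?v = 0"
      unfolding lookup using a(2) by (intro sum.neutral) (auto dest: h_inj)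
    moreover have "Poly_Mapping.lookup (?\<sigma> f0) ?v \<noteq> 0"
      unfolding lookup using A(1) a(1) by (auto simp: sum_eq_0_iff)
    ultimately show "Poly_Mapping.lookup (?\<sigma> f) ?v < Poly_Mapping.lookup (?\<sigma> f0) ?v" by simp
    fix w assume w: "w \<in> board n m" "(?v, w) \<in> V" "w \<noteq> ?v"
    \<comment> \<open>A variable on a larger antidiagonal is smaller in the diagonal order, so it
      cannot be one that exceeds \<open>?v\<close>.\<close>
    have not: "h b j \<noteq> w" if "a + f0 a < b + j" for b j
    proof
      assume hw: "h b j = w"
      have "fst ?v + snd ?v < fst w + snd w" using that h_sum hw by metis
      then have "(w, ?v) \<in> V"
        using diagonal[of "fst ?v" "snd ?v" "fst w" "snd w"] w(1) A(3)[OF a(1)] by simp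
      then show False using V_antisym w by blast
    qed
    show "Poly_Mapping.lookup (?\<sigma> f) w = Poly_Mapping.lookup (?\<sigma> f0) w"
      unfolding lookup
    proof (rule sum.cong[OF refl])
      fix b assume b: "b \<in> A"
      consider "b < a" | "b = a" | "a < b" by linarith
      then show "(if h b (f b) = w then 1 else 0) = (if h b (f0 b) = w then 1 else (0::nat))"
      proof cases
        case 1
        then show ?thesis using before b by simp
      next
        case 2
        then show ?thesis using not after_lt[OF b] w(3) by simp
      next
        case 3
        then show ?thesis using not[OF after_lt[OF b]] not[OF after0_lt[OF b]] by simp
      qed
    qed
  qed
qed

text \<open>Covers both chain bounds: \<open>h\<close> is the usual orientation of the board or the
  exchanged one. A generator has \<open>K + 1\<close> line sums, so a violation of the bound by one
  is enough.\<close>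

lemma straighten:
  fixes h :: "nat \<Rightarrow> nat \<Rightarrow> nat \<times> nat"
  assumes I: "poly_ideal n m I"
    and h_inj: "\<And>a j a' j'. h a j = h a' j' \<Longrightarrow> a = a' \<and> j = j'"
    and h_sum: "\<And>a j. fst (h a j) + snd (h a j) = a + j"
    and h_board: "\<And>a j. \<lbrakk>a \<in> {1..N}; j \<in> {1..M}\<rbrakk> \<Longrightarrow> h a j \<in> board n m"
    and col: "\<And>a a' j. \<lbrakk>a \<in> {1..N}; a' \<in> {1..N}; j \<in> {1..M}\<rbrakk> \<Longrightarrow> var (h a j) * var (h a' j) \<in> I"
    and rows: "\<And>S. \<lbrakk>S \<subseteq> {1..N}; card S = K + 1\<rbrakk> \<Longrightarrow> (\<Prod>a\<in>S. \<Sum>j\<in>{1..M}. var (h a j)) \<in> I"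
    and Q: "Q \<subseteq> {1..N} \<times> {1..M}" "inj_on fst Q" "inj_on snd Q" "\<not> chain_bound K {1..M} Q"
    and u: "u = (\<Sum>p\<in>Q. Poly_Mapping.single (h (fst p) (snd p)) 1)"
  shows "\<exists>g\<in>I. Poly_Mapping.lookup g u \<noteq> 0 \<and> (\<forall>v\<in>mkeys g. v \<noteq> u \<longrightarrow> (v, u) \<in> L)"
proof -
  interpret I: poly_ideal n m I by (rule I)
  obtain C e where C: "C \<subseteq> Q" "increasing_chain C" "e \<in> C" "\<And>p. p \<in> C \<Longrightarrow> snd p \<le> snd e"
    and viol: "K + card {y \<in> {1..M} - snd ` Q. y < snd e} < card C"
    using Q(4) unfolding chain_bound_def not_all not_imp not_le by blast
  have finQ: "finite Q" using Q(1) finite_subset by blast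
  have finC: "finite C" using C(1) finQ finite_subset by blast
  \<comment> \<open>In terms of second coordinates: \<open>W\<close> holds the columns left of the
    endpoint with a rook outside the chain, where the factor \<open>\<tau>\<close> makes any further
    variable a multiple of an element of \<open>I\<close>. \<open>D\<close> holds the free columns
    left of the endpoint, and \<open>E\<close> the columns of the chain and everything right of the
    endpoint.\<close>
  define T where "T = {p \<in> Q - C. snd p < snd e}"
  define W where "W = snd ` T"
  define D where "D = {y \<in> {1..M} - snd ` Q. y < snd e}"
  define E where "E = {1..M} - W - D"
  define A where "A = fst ` C"
  have injC: "inj_on fst C" using Q(2) C(1) inj_on_subset by blast
  define f0 where "f0 = restrict (\<lambda>a. snd (inv_into C fst a)) A"
  have f0: "f0 (fst p) = snd p" if "p \<in> C" for p
    using that injC by (simp add: f0_def A_def)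
  define \<tau> where "\<tau> = (\<Sum>p\<in>Q - C. Poly_Mapping.single (h (fst p) (snd p)) (1::nat))"
  define \<sigma> where "\<sigma> f = (\<Sum>a\<in>A. Poly_Mapping.single (h a (f a)) (1::nat))" for f
  define F where "F = {f \<in> PiE A (\<lambda>_. E). inj_on f A}"
  define g where "g = mon_poly \<tau> * (\<Sum>f\<in>F. \<Prod>a\<in>A. var (h a (f a)))"
  have A: "finite A" "A \<subseteq> {1..N}" "card A = card C"
    using finC C(1) Q(1) injC by (auto simp: A_def card_image)
  have W: "W \<subseteq> {1..M}" using Q(1) by (auto simp: W_def T_def)
  have "h (fst p) (snd p) \<in> board n m" if "p \<in> Q" for p
    using that Q(1) by (intro h_board) auto
  then have \<tau>_mons: "\<tau> \<in> mons n m"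
    using keys_sum[of "\<lambda>p. Poly_Mapping.single (h (fst p) (snd p)) (1::nat)" "Q - C"]
    unfolding \<tau>_def mons_def
    by (auto simp: in_keys_iff lookup_sum lookup_single when_def split: if_splits)
  have sndC: "snd ` C \<subseteq> E"
  proof
    fix j assume "j \<in> snd ` C"
    then obtain p where p: "p \<in> C" "j = snd p" by blast
    have "j \<notin> W"
    proof
      assume "j \<in> W"
      then obtain q where "q \<in> Q" "q \<notin> C" "snd q = snd p" using p(2) by (auto simp: W_def T_def)
      then show False using Q(3) C(1) p(1) by (metis inj_onD subsetD)
    qed
    then show "j \<in> E" using p C(1) Q(1) by (auto simp: E_def D_def)
  qed
  have E_cases: "j \<in> snd ` C \<or> snd e < j" if "j \<in> E" for j
  proof (rule ccontr)
    assume "\<not> (j \<in> snd ` C \<or> snd e < j)"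
    then have j: "j \<notin> snd ` C" "j < snd e" using C(3) by (auto simp: not_less order_le_less)
    then have "j \<in> snd ` Q" using that by (auto simp: E_def D_def)
    then obtain p where "p \<in> Q" "j = snd p" by blast
    then have "j \<in> W" using j by (auto simp: W_def T_def)
    then show False using that by (simp add: E_def)
  qed
  have f0A: "f0 ` A = snd ` C" using f0 by (force simp: A_def)
  have f0_mono: "strict_mono_on A f0"
  proof (rule strict_mono_onI)
    fix a b assume "a \<in> A" "b \<in> A" "a < b"
    then obtain p q where "p \<in> C" "q \<in> C" "a = fst p" "b = fst q" by (auto simp: A_def)
    then show "f0 a < f0 b" using C(2) f0 \<open>a < b\<close> unfolding increasing_chain_def by metis
  qed
  have f0F: "f0 \<in> F"
  proof -
    have "f0 \<in> extensional A" by (simp add: f0_def)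
    then show ?thesis
      using f0A sndC strict_mono_on_imp_inj_on[OF f0_mono] by (auto simp: F_def PiE_def Pi_def)
  qed
  have "g \<in> I"
    unfolding g_def F_def
  proof (rule I.injective_sum[where k = "K + 1" and J = "{1..M}" and W = W and D = D])
    show "{1..M} = W \<union> D \<union> E" using W by (auto simp: E_def D_def)
    show "W \<inter> D = {}" by (auto simp: W_def T_def D_def)
    show "K + 1 + card D \<le> card A" using viol A(3) by (simp add: D_def)
    show "mon_poly \<tau> \<in> carrier (poly_ring n m)" by (simp add: mon_poly_def carrier_single \<tau>_mons)
    show "mon_poly \<tau> * var (h a j) \<in> I" if aj: "a \<in> A" "j \<in> W" for a j
    proof -
      obtain p where p: "p \<in> Q - C" "snd p = j" using aj(2) by (auto simp: W_def T_def)
      let ?t = "\<Prod>q\<in>Q - C - {p}. var (h (fst q) (snd q))"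
      have "mon_poly \<tau> = (\<Prod>q\<in>Q - C. var (h (fst q) (snd q)))" by (simp add: \<tau>_def prod_var)
      also have "\<dots> = var (h (fst p) j) * ?t" using p finQ by (simp add: prod.remove[of "Q - C" p])
      finally have "mon_poly \<tau> * var (h a j) = var (h (fst p) j) * var (h a j) * ?t"
        by (simp add: ac_simps)
      also have "\<dots> \<in> I"
        using p Q(1) aj A(2) W
        by (intro I.mult_right_closed col carrier_prod carrier_var h_board) auto
      finally show ?thesis .
    qed
    show "(\<Prod>a\<in>S. \<Sum>j = 1..M. var (h a j)) \<in> I" if "S \<subseteq> A" "card S = K + 1" for S
      using that A(2) by (intro rows) auto
    show "var (h a j) * var (h a' j) \<in> I" if "a \<in> A" "a' \<in> A" "j \<in> {1..M}" for a a' j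
      using that A(2) by (intro col) auto
    show "var (h a j) \<in> carrier (poly_ring n m)" if "a \<in> A" "j \<in> {1..M}" for a j
      using that A(2) by (intro carrier_var h_board) auto
  qed (use A in \<open>auto simp: E_def\<close>)
  moreover have g_eq: "g = (\<Sum>f\<in>F. Poly_Mapping.single (\<tau> + \<sigma> f) 1)"
    unfolding g_def prod_var \<sigma>_def by (simp add: mon_poly_def mult_single sum_distrib_left)
  have u_eq: "u = \<tau> + \<sigma> f0"
  proof -
    have "\<sigma> f0 = (\<Sum>p\<in>C. Poly_Mapping.single (h (fst p) (snd p)) 1)"
      unfolding \<sigma>_def A_def using injC f0 by (simp add: sum.reindex)
    then show ?thesis
      unfolding u \<tau>_def using finQ C(1) by (simp add: sum.subset_diff)
  qed
  have less: "(\<tau> + \<sigma> f, u) \<in> L" if f: "f \<in> F" "f \<noteq> f0" for f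
    unfolding u_eq \<sigma>_def
  proof (rule less_add[OF chain_dominates[OF h_inj h_sum A(1)] \<tau>_mons])
    have E: "E \<subseteq> {1..M}" by (auto simp: E_def)
    show "h a (f a) \<in> board n m" "h a (f0 a) \<in> board n m" if "a \<in> A" for a
      using that f(1) f0F A(2) E by (auto simp: F_def intro!: h_board)
    show "strict_mono_on A f0" by (rule f0_mono)
    show "inj_on f A" using f by (simp add: F_def)
    show "f0 a' < f a" if "a \<in> A" "a' \<in> A" "f a \<notin> f0 ` A" for a a'
    proof -
      have "f a \<in> E" using f that(1) by (auto simp: F_def)
      then have "snd e < f a" using E_cases that(3) f0A by auto
      moreover have "f0 a' \<in> snd ` C" using that(2) f0A by blast
      then have "f0 a' \<le> snd e" using C(4) by auto
      ultimately show ?thesis by simp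
    qed
    show "\<exists>a\<in>A. f a \<noteq> f0 a"
      using f f0F by (auto simp: F_def intro: PiE_ext)
  qed
  have finF: "finite F"
    by (rule finite_subset[of F "PiE A (\<lambda>_. E)"]) (use A(1) in \<open>auto simp: F_def E_def intro: finite_PiE\<close>)
  \<comment> \<open>Every other injection gives a strictly smaller monomial, so nothing cancels
    against the term of \<open>f0\<close> and \<open>u\<close> has coefficient 1.\<close>
  have "\<tau> + \<sigma> f = u \<longleftrightarrow> f = f0" if "f \<in> F" for f
    using less[OF that] less_irrefl u_eq by metis
  then have "Poly_Mapping.lookup g u = (\<Sum>f\<in>F. if f = f0 then 1 else 0)"
    unfolding g_eq by (auto simp: lookup_sum lookup_single when_def intro!: sum.cong)
  then have "Poly_Mapping.lookup g u \<noteq> 0" using finF f0F by simp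
  moreover have "(v, u) \<in> L" if v: "v \<in> mkeys g" "v \<noteq> u" for v
  proof -
    obtain f where "f \<in> F" "v = \<tau> + \<sigma> f"
      using v(1) keys_sum[of "\<lambda>f. Poly_Mapping.single (\<tau> + \<sigma> f) (1::complex)" F]
      unfolding g_eq by fastforce
    then show ?thesis using less v(2) u_eq by blast
  qed
  ultimately show ?thesis by blast
qed

end

section \<open>Generators of the ideal and vanishing polynomials\<close>

lemma carrier_scalar: "Poly_Mapping.single 0 c \<in> carrier (poly_ring n m)"
  by (simp add: carrier_single)

lemma lookup_scalar_mult [simp]:
  "Poly_Mapping.lookup (Poly_Mapping.single 0 c * f) a = c * Poly_Mapping.lookup f a" for f :: mpoly
  using lookup_single_mult[of 0 c f a] by simp

lemma keys_scalar_mult: "mkeys (Poly_Mapping.single 0 c * f) \<subseteq> mkeys f" for f :: mpoly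
  by (auto simp: in_keys_iff)

lemma scalar_mult_mon_poly: "Poly_Mapping.single 0 c * mon_poly u = Poly_Mapping.single u c"
  by (simp add: mon_poly_def mult_single)

lemma inj_mon_poly: "inj mon_poly"
  by (rule injI) (simp add: mon_poly_def poly_mapping_eq_iff lookup_single fun_eq_iff when_def, metis zero_neq_one)

lemma leading_form_add:
  "leading_form d g q \<Longrightarrow> leading_form d g' q' \<Longrightarrow> leading_form d (g + g') (q + q')"
  using low_degree_add[of d "q - g" "q' - g'"] unfolding leading_form_def
  by (auto intro: homogeneous_add simp: algebra_simps)

text \<open>\<open>S u\<close> carries whatever support constraint is known for the reduction of the
  monomial \<open>u\<close>, such as degree or order; the reductions add up linearly.\<close>

lemma (in poly_ideal) linear_reduction:
  assumes "\<And>u. u \<in> mkeys f \<Longrightarrow> \<exists>h. mkeys h \<subseteq> S u \<and> mon_poly u - h \<in> I"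
  obtains h where "mkeys h \<subseteq> (\<Union>u\<in>mkeys f. S u)" "f - h \<in> I"
proof -
  obtain H where H: "\<And>u. u \<in> mkeys f \<Longrightarrow> mkeys (H u) \<subseteq> S u \<and> mon_poly u - H u \<in> I"
    using assms by metis
  let ?c = "\<lambda>u. Poly_Mapping.single 0 (Poly_Mapping.lookup f u)"
  let ?h = "\<Sum>u\<in>mkeys f. ?c u * H u"
  have "mkeys ?h \<subseteq> (\<Union>u\<in>mkeys f. mkeys (?c u * H u))" by (rule keys_sum)
  also have "\<dots> \<subseteq> (\<Union>u\<in>mkeys f. S u)" using H keys_scalar_mult by fast
  finally have 1: "mkeys ?h \<subseteq> (\<Union>u\<in>mkeys f. S u)" .
  have "f - ?h = (\<Sum>u\<in>mkeys f. ?c u * mon_poly u) - ?h"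
    by (subst (1) sum_monomials[of f]) (simp add: scalar_mult_mon_poly)
  also have "\<dots> = (\<Sum>u\<in>mkeys f. ?c u * (mon_poly u - H u))"
    by (simp add: sum_subtractf right_diff_distrib)
  also have "\<dots> \<in> I" using H by (intro sum_closed mult_closed carrier_scalar) auto
  finally show ?thesis using that[OF 1] by blast
qed

lemma I_gens_carrier: "I_gens n m r \<subseteq> carrier (poly_ring n m)"
proof -
  have "var (i, j) \<in> carrier (poly_ring n m)" if "i \<in> {1..n}" "j \<in> {1..m}" for i j
    using that by (intro carrier_var) (auto simp: board_def)
  then show ?thesis
    unfolding I_gens_def by (auto intro!: carrier_mult carrier_prod carrier_sum)
qed

lemma I_ideal_is_ideal: "poly_ideal n m (I_ideal n m r)"
  unfolding I_ideal_def by (rule genideal_poly_ideal[OF I_gens_carrier])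

lemma I_gens_subset: "I_gens n m r \<subseteq> I_ideal n m r"
  unfolding I_ideal_def using genideal_generator[OF I_gens_carrier] by blast

lemma rook_placementD:
  assumes "rook_placement n m R"
  shows "R \<subseteq> board n m" "finite R" "inj_on fst R" "inj_on snd R" "fst ` R \<subseteq> {1..n}" "snd ` R \<subseteq> {1..m}"
proof -
  show 1: "R \<subseteq> board n m" "inj_on fst R" "inj_on snd R"
    using assms unfolding rook_placement_def by (auto intro!: inj_onI)
  show "finite R" using 1(1) by (rule finite_subset) (simp add: board_def)
  show "fst ` R \<subseteq> {1..n}" "snd ` R \<subseteq> {1..m}" using 1(1) by (auto simp: board_def)
qed

lemma finite_UZ: "finite (UZ n m r)"
  by (rule finite_subset[of _ "Pow (board n m)"]) (auto simp: UZ_def rook_placement_def board_def)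

lemma eval_line_sum:
  assumes "finite J" "j0 \<in> J" "h j0 \<in> R" "\<And>j. \<lbrakk>j \<in> J; h j \<in> R\<rbrakk> \<Longrightarrow> j = j0"
  shows "eval_poly (rook_matrix R) (\<Sum>j\<in>J. var (h j)) = 1"
proof -
  have "eval_poly (rook_matrix R) (\<Sum>j\<in>J. var (h j)) = (\<Sum>j\<in>J. if j = j0 then 1 else 0)"
    unfolding eval_sum eval_var rook_matrix_def
  proof (rule sum.cong[OF refl])
    fix j assume "j \<in> J"
    then have "h j \<in> R \<longleftrightarrow> j = j0" using assms(3,4) by blast
    then show "(if h j \<in> R then 1 else 0) = (if j = j0 then 1 else (0::complex))" by simp
  qed
  then show ?thesis using assms(1,2) by simp
qed

text \<open>Pigeonhole: \<open>n - r + 1\<close> chosen lines and at least \<open>r\<close> occupied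
  ones cannot be disjoint among \<open>n\<close>. This explains the number of factors in the
  generators.\<close>

lemma occupied_line:
  assumes "S \<subseteq> {1..n}" "card S = n - r + 1" "r \<le> n" "L \<subseteq> {1..n::nat}" "r \<le> card L"
  shows "\<exists>i\<in>S. i \<in> L"
proof (rule ccontr)
  assume "\<not> (\<exists>i\<in>S. i \<in> L)"
  then have "card (S \<union> L) = card S + card L"
    using assms(1,4) by (intro card_Un_disjoint) (auto intro: finite_subset)
  moreover have "card (S \<union> L) \<le> n"
    using card_mono[of "{1..n}" "S \<union> L"] assms(1,4) by simp
  ultimately show False using assms(2,3,5) by simp
qed

text \<open>A square of a variable lifts to itself minus the variable, and a product of two distinct
  variables on one line vanishes as it stands. A product of line sums lifts by subtracting 1 from
  each sum: a placement of size at least \<open>r\<close> occupies one of the chosen lines, and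
  there the sum is 1.\<close>

lemma I_gens_leading_form:
  assumes "r \<le> n" "r \<le> m" "g \<in> I_gens n m r"
  shows "\<exists>d. \<exists>q\<in>vanishing_ideal n m (rook_matrix ` UZ n m r). leading_form d g q"
proof -
  let ?VI = "vanishing_ideal n m (rook_matrix ` UZ n m r)"
  have quad: "\<exists>d. \<exists>q\<in>?VI. leading_form d (var v * var w) q"
    if vw: "v \<in> board n m" "w \<in> board n m" "fst v = fst w \<or> snd v = snd w" for v w
  proof (cases "v = w")
    case True
    have hom: "homogeneous 2 (var v * var w)"
      using homogeneous_mult[OF homogeneous_var homogeneous_var, of v w] by (simp add: numeral_2_eq_2)
    have "low_degree 2 (- var v)" by (simp add: low_degree_def var_def)
    then have "leading_form 2 (var v * var w) (var v * var w - var v)"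
      using hom by (simp add: leading_form_def)
    moreover have "var v * var w - var v \<in> ?VI"
      using True vw by (auto simp: vanishing_ideal_def eval_diff eval_mult eval_var rook_matrix_def
        intro!: carrier_diff carrier_mult carrier_var)
    ultimately show ?thesis by blast
  next
    case False
    have "leading_form (1 + 1) (var v * var w) (var v * var w)"
      by (intro leading_form_self homogeneous_mult homogeneous_var)
    moreover have "\<not> (v \<in> R \<and> w \<in> R)" if "R \<in> UZ n m r" for R
      using that False vw(3) by (auto simp: UZ_def rook_placement_def)
    then have "var v * var w \<in> ?VI"
      using vw by (auto simp: vanishing_ideal_def eval_mult eval_var rook_matrix_def
        intro!: carrier_mult carrier_var)
    ultimately show ?thesis by blast
  qed
  have lines: "\<exists>d. \<exists>q\<in>?VI. leading_form d (\<Prod>i\<in>S. \<Sum>j\<in>J. var (h i j)) q"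
    if S: "finite S" and J: "finite J" and h: "\<And>i j. \<lbrakk>i \<in> S; j \<in> J\<rbrakk> \<Longrightarrow> h i j \<in> board n m"
      and hit: "\<And>R. R \<in> UZ n m r \<Longrightarrow> \<exists>i\<in>S. \<exists>j0\<in>J. h i j0 \<in> R \<and> (\<forall>j\<in>J. h i j \<in> R \<longrightarrow> j = j0)"
    for S J :: "nat set" and h
  proof (intro exI bexI)
    have "homogeneous 1 (\<Sum>j\<in>J. var (h i j))" for i
      by (intro homogeneous_sum homogeneous_var)
    then have "leading_form 1 (\<Sum>j\<in>J. var (h i j)) ((\<Sum>j\<in>J. var (h i j)) - 1)" for i
      by (simp add: leading_form_def low_degree_def)
    then show "leading_form (card S) (\<Prod>i\<in>S. \<Sum>j\<in>J. var (h i j)) (\<Prod>i\<in>S. (\<Sum>j\<in>J. var (h i j)) - 1)"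
      using S by (intro leading_form_prod)
    have "eval_poly (rook_matrix R) (\<Prod>i\<in>S. (\<Sum>j\<in>J. var (h i j)) - 1) = 0" if R: "R \<in> UZ n m r" for R
    proof -
      obtain i j0 where i: "i \<in> S" "j0 \<in> J" "h i j0 \<in> R" "\<forall>j\<in>J. h i j \<in> R \<longrightarrow> j = j0"
        using hit[OF R] by blast
      have "eval_poly (rook_matrix R) (\<Sum>j\<in>J. var (h i j)) = 1"
        by (rule eval_line_sum[where h = "h i", OF J i(2,3)]) (use i(4) in auto)
      then have "eval_poly (rook_matrix R) ((\<Sum>j\<in>J. var (h i j)) - 1) = 0"
        by (simp add: eval_diff)
      then show ?thesis unfolding eval_prod using S i(1) by auto
    qed
    then show "(\<Prod>i\<in>S. (\<Sum>j\<in>J. var (h i j)) - 1) \<in> ?VI"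
      using h by (auto simp: vanishing_ideal_def intro!: carrier_prod carrier_diff carrier_sum carrier_var)
  qed
  have R: "r \<le> card (fst ` R)" "r \<le> card (snd ` R)" if "R \<in> UZ n m r" for R
    using that rook_placementD(3,4)[of n m R] by (auto simp: UZ_def card_image)
  consider (row) i j j' where "g = var (i, j) * var (i, j')" "i \<in> {1..n}" "j \<in> {1..m}" "j' \<in> {1..m}"
    | (col) i i' j where "g = var (i, j) * var (i', j)" "i \<in> {1..n}" "i' \<in> {1..n}" "j \<in> {1..m}"
    | (rows) S where "g = (\<Prod>i\<in>S. \<Sum>j\<in>{1..m}. var (i, j))" "S \<subseteq> {1..n}" "card S = n - r + 1"
    | (cols) S where "g = (\<Prod>j\<in>S. \<Sum>i\<in>{1..n}. var (i, j))" "S \<subseteq> {1..m}" "card S = m - r + 1"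
    using assms(3) unfolding I_gens_def by blast
  then show ?thesis
  proof cases
    case row
    then show ?thesis using quad[of "(i, j)" "(i, j')"] by (simp add: board_def)
  next
    case col
    then show ?thesis using quad[of "(i, j)" "(i', j)"] by (simp add: board_def)
  next
    case rows
    show ?thesis
      unfolding rows(1)
    proof (rule lines)
      fix R assume UZ: "R \<in> UZ n m r"
      then have rook: "rook_placement n m R" by (simp add: UZ_def)
      obtain i where i: "i \<in> S" "i \<in> fst ` R"
        using occupied_line[OF rows(2,3) assms(1) rook_placementD(5)[OF rook] R(1)[OF UZ]] by blast
      then obtain j where j: "(i, j) \<in> R" by auto
      then have "\<forall>j'. (i, j') \<in> R \<longrightarrow> j' = j"
        using inj_onD[OF rook_placementD(3)[OF rook] _ _ j] by fastforce
      moreover have "j \<in> {1..m}" using j rook_placementD(6)[OF rook] by force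
      ultimately show "\<exists>i\<in>S. \<exists>j0\<in>{1..m}. (i, j0) \<in> R \<and> (\<forall>j\<in>{1..m}. (i, j) \<in> R \<longrightarrow> j = j0)"
        using i(1) j by blast
    qed (use rows in \<open>auto simp: board_def intro: finite_subset\<close>)
  next
    case cols
    show ?thesis
      unfolding cols(1)
    proof (rule lines[where h = "\<lambda>j i. (i, j)"])
      fix R assume UZ: "R \<in> UZ n m r"
      then have rook: "rook_placement n m R" by (simp add: UZ_def)
      obtain i where i: "i \<in> S" "i \<in> snd ` R"
        using occupied_line[OF cols(2,3) assms(2) rook_placementD(6)[OF rook] R(2)[OF UZ]] by blast
      then obtain j where j: "(j, i) \<in> R" by auto
      then have "\<forall>j'. (j', i) \<in> R \<longrightarrow> j' = j"
        using inj_onD[OF rook_placementD(4)[OF rook] _ _ j] by fastforce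
      moreover have "j \<in> {1..n}" using j rook_placementD(5)[OF rook] by force
      ultimately show "\<exists>i\<in>S. \<exists>j0\<in>{1..n}. (j0, i) \<in> R \<and> (\<forall>j\<in>{1..n}. (j, i) \<in> R \<longrightarrow> j = j0)"
        using i(1) j by blast
    qed (use cols in \<open>auto simp: board_def intro: finite_subset\<close>)
  qed
qed

text \<open>Both properties of the homogeneous components survive addition and multiplication by
  terms, so it suffices to check them on the generators, which are homogeneous. The second one is
  the bridge from the ideal to the vanishing ideal.\<close>

lemma I_ideal_hom_component:
  assumes "r \<le> n" "r \<le> m" "p \<in> I_ideal n m r"
  shows "hom_component d p \<in> I_ideal n m r"
    "\<exists>q\<in>vanishing_ideal n m (rook_matrix ` UZ n m r). leading_form d (hom_component d p) q"
proof -
  let ?I = "I_ideal n m r" and ?VI = "vanishing_ideal n m (rook_matrix ` UZ n m r)"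
  interpret I: poly_ideal n m ?I by (rule I_ideal_is_ideal)
  interpret VI: poly_ideal n m ?VI by (rule vanishing_ideal_is_ideal)
  let ?J = "{p \<in> carrier (poly_ring n m). \<forall>d. hom_component d p \<in> ?I \<and>
    (\<exists>q\<in>?VI. leading_form d (hom_component d p) q)}"
  have zero: "\<exists>q\<in>?VI. leading_form d 0 q" for d
    by (rule bexI[of _ 0]) (simp_all add: leading_form_def)
  have "poly_ideal n m ?J"
    unfolding poly_ideal_def
  proof (rule poly_idealI)
    show "f + g \<in> ?J" if fg: "f \<in> ?J" "g \<in> ?J" for f g
    proof (intro CollectI conjI allI)
      show "f + g \<in> carrier (poly_ring n m)" using fg by (auto intro: carrier_add)
      show "hom_component d (f + g) \<in> ?I" for d
        unfolding hom_component_add using fg by (intro I.add_closed) auto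
      fix d
      obtain q q' where "q \<in> ?VI" "leading_form d (hom_component d f) q"
        "q' \<in> ?VI" "leading_form d (hom_component d g) q'" using fg by blast
      then show "\<exists>q\<in>?VI. leading_form d (hom_component d (f + g)) q"
        unfolding hom_component_add by (blast intro: leading_form_add VI.add_closed)
    qed
    show "Poly_Mapping.single a c * f \<in> ?J" if a: "a \<in> mons n m" and f: "f \<in> ?J" for a c f
    proof (intro CollectI conjI allI)
      let ?a = "Poly_Mapping.single a c"
      have carr: "?a \<in> carrier (poly_ring n m)" using a by (rule carrier_single)
      then show "?a * f \<in> carrier (poly_ring n m)" using f by (auto intro: carrier_mult)
      fix d
      show "hom_component d (?a * f) \<in> ?I"
        unfolding hom_component_single_mult using f carr by (auto intro: I.mult_closed)
      show "\<exists>q\<in>?VI. leading_form d (hom_component d (?a * f)) q"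
      proof (cases "mon_degree a \<le> d")
        case True
        obtain q where q: "q \<in> ?VI" "leading_form (d - mon_degree a) (hom_component (d - mon_degree a) f) q"
          using f by blast
        have "leading_form (mon_degree a) ?a ?a"
          by (intro leading_form_self) (simp add: homogeneous_def)
        from leading_form_mult[OF this q(2)] show ?thesis
          using True q(1) carr VI.mult_closed by (auto simp: hom_component_single_mult)
      qed (simp add: hom_component_single_mult zero)
    qed
  qed (use zero in auto)
  moreover have "I_gens n m r \<subseteq> ?J"
  proof
    fix g assume g: "g \<in> I_gens n m r"
    then obtain e q where q: "q \<in> ?VI" "leading_form e g q"
      using I_gens_leading_form[OF assms(1,2)] by blast
    then have "homogeneous e g" by (simp add: leading_form_def)
    then have "hom_component d g = (if d = e then g else 0)" for d
      by (rule hom_component_homogeneous)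
    moreover have "g \<in> carrier (poly_ring n m)" "g \<in> ?I"
      using g I_gens_carrier I_gens_subset by blast+
    ultimately show "g \<in> ?J" using q zero by auto
  qed
  ultimately have "?I \<subseteq> ?J" unfolding I_ideal_def by (rule genideal_subset)
  then show "hom_component d p \<in> ?I" "\<exists>q\<in>?VI. leading_form d (hom_component d p) q"
    using assms(3) by auto
qed

lemma I_ideal_subset_gr:
  assumes "r \<le> n" "r \<le> m"
  shows "I_ideal n m r \<subseteq> gr_ideal n m (vanishing_ideal n m (rook_matrix ` UZ n m r))"
proof -
  let ?VI = "vanishing_ideal n m (rook_matrix ` UZ n m r)"
  have carr: "{top_component f |f. f \<in> ?VI \<and> f \<noteq> 0} \<subseteq> carrier (poly_ring n m)"
    by (auto simp: vanishing_ideal_def carrier_iff top_component_def hom_component_def[symmetric] keys_hom_component)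
  then have gr: "poly_ideal n m (gr_ideal n m ?VI)"
    unfolding gr_ideal_def by (rule genideal_poly_ideal)
  have "I_gens n m r \<subseteq> gr_ideal n m ?VI"
  proof
    fix g assume g: "g \<in> I_gens n m r"
    then obtain e q where q: "q \<in> ?VI" "leading_form e g q"
      using I_gens_leading_form[OF assms] by blast
    show "g \<in> gr_ideal n m ?VI"
    \<comment> \<open>The generators of the graded ideal come from nonzero polynomials with nonzero
      leading form, so 0 is treated apart.\<close>
    proof (cases "g = 0")
      case True
      then show ?thesis using poly_ideal.zero_closed[OF gr] by simp
    next
      case False
      then show ?thesis
        unfolding gr_ideal_def
        using top_component_leading_form[OF q(2)] q(1) by (intro genideal_generator[OF carr]) blast
    qed
  qed
  then show ?thesis unfolding I_ideal_def by (intro genideal_subset[OF gr])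
qed

section \<open>The standard monomials\<close>

definition indicator_mon :: "(nat \<times> nat) set \<Rightarrow> mon" where
  "indicator_mon Q = (\<Sum>v\<in>Q. Poly_Mapping.single v 1)"

lemma es_eq_mon_poly: "es n m r R = mon_poly (indicator_mon (ES n m r R))"
  using prod_var[of "\<lambda>v. v"] by (simp add: es_def indicator_mon_def)

lemma lookup_indicator_mon:
  "finite Q \<Longrightarrow> Poly_Mapping.lookup (indicator_mon Q) v = (if v \<in> Q then 1 else 0)"
  by (simp add: indicator_mon_def lookup_sum lookup_single when_def)

lemma mon_factor:
  assumes "\<And>v. Poly_Mapping.lookup a v \<le> Poly_Mapping.lookup u v"
  obtains w :: mon where "u = a + w"
proof
  show "u = a + (u - a)"
    using assms by (intro poly_mapping_eqI) (simp add: lookup_add lookup_minus)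
qed

lemma sum_fun_apply: "(\<Sum>i\<in>S. f i) x = (\<Sum>i\<in>S. f i x)"
  by (induction S rule: infinite_finite_induct) simp_all

text \<open>A dimension count in the space of functions on the placements in \<open>UZ n m r\<close>.\<close>

lemma card_UZ_le:
  assumes "finite G"
    and reduce: "\<And>f. f \<in> carrier (poly_ring n m) \<Longrightarrow>
      \<exists>h. mkeys h \<subseteq> G \<and> f - h \<in> vanishing_ideal n m (rook_matrix ` UZ n m r)"
  shows "card (UZ n m r) \<le> card G"
proof -
  interpret vs: vector_space "\<lambda>(c::complex) (f::(nat \<times> nat) set \<Rightarrow> complex) x. c * f x"
    by standard (auto simp: fun_eq_iff algebra_simps)
  let ?U = "UZ n m r"
  \<comment> \<open>\<open>ev f\<close> extends the evaluation of \<open>f\<close> by 0 outside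
    \<open>UZ n m r\<close>, so that functions on the placements sit inside a vector space of total
    functions.\<close>
  define ev where "ev f R = (if R \<in> ?U then eval_poly (rook_matrix R) f else 0)" for f R
  define \<delta> where "\<delta> R R' = (if R' = R then 1 else (0::complex))" for R R' :: "(nat \<times> nat) set"
  let ?B = "(\<lambda>u. ev (mon_poly u)) ` G"
  have span: "ev f \<in> vs.span ?B" if f: "f \<in> carrier (poly_ring n m)" for f
  proof -
    obtain h where h: "mkeys h \<subseteq> G" "f - h \<in> vanishing_ideal n m (rook_matrix ` ?U)"
      using reduce[OF f] by blast
    have "ev f = (\<Sum>u\<in>mkeys h. (\<lambda>R. Poly_Mapping.lookup h u * ev (mon_poly u) R))"
    proof
      fix R
      have "eval_poly (rook_matrix R) h =
          (\<Sum>u\<in>mkeys h. Poly_Mapping.lookup h u * eval_poly (rook_matrix R) (mon_poly u))"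
        by (subst eval_poly_superset[OF finite_keys order.refl]) (simp add: mon_poly_def eval_single)
      then show "ev f R = (\<Sum>u\<in>mkeys h. (\<lambda>R. Poly_Mapping.lookup h u * ev (mon_poly u) R)) R"
        using h(2) by (auto simp: ev_def vanishing_ideal_def eval_diff sum_fun_apply)
    qed
    moreover have "(\<Sum>u\<in>mkeys h. (\<lambda>R. Poly_Mapping.lookup h u * ev (mon_poly u) R)) \<in> vs.span ?B"
    proof (rule vs.span_sum)
      fix u assume "u \<in> mkeys h"
      then have "ev (mon_poly u) \<in> vs.span ?B" using h(1) by (intro vs.span_base) auto
      then show "(\<lambda>R. Poly_Mapping.lookup h u * ev (mon_poly u) R) \<in> vs.span ?B"
        by (rule vs.span_scale)
    qed
    ultimately show ?thesis by simp
  qed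
  have "\<delta> R \<in> vs.span ?B" if R: "R \<in> ?U" for R
  proof -
    \<comment> \<open>Interpolation: on a placement this product is 1 if it agrees with
      \<open>R\<close> in every cell, and 0 otherwise.\<close>
    let ?f = "\<Prod>v\<in>board n m. if v \<in> R then var v else 1 - var v"
    have ev_f: "ev ?f = \<delta> R"
    proof
      fix R'
      show "ev ?f R' = \<delta> R R'"
      proof (cases "R' \<in> ?U")
        case True
        have "eval_poly (rook_matrix R') ?f = (\<Prod>v\<in>board n m. if (v \<in> R) = (v \<in> R') then 1 else 0)"
          unfolding eval_prod
          by (intro prod.cong) (auto simp: eval_var eval_diff rook_matrix_def)
        also have "\<dots> = \<delta> R R'"
        proof (cases "R = R'")
          case False
          moreover have "R \<subseteq> board n m" "R' \<subseteq> board n m"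
            using R True by (auto simp: UZ_def rook_placement_def)
          ultimately have "\<exists>v\<in>board n m. (v \<in> R) \<noteq> (v \<in> R')" by blast
          then have "(\<Prod>v\<in>board n m. if (v \<in> R) = (v \<in> R') then 1 else 0) = (0::complex)"
            by (intro prod_zero) (auto simp: board_def)
          then show ?thesis using False by (simp add: \<delta>_def)
        qed (simp add: \<delta>_def)
        finally show ?thesis using True by (simp add: ev_def)
      next
        case False
        then have "R \<noteq> R'" using R by blast
        then show ?thesis using False by (simp add: ev_def \<delta>_def)
      qed
    qed
    have "?f \<in> carrier (poly_ring n m)"
      by (intro carrier_prod) (auto intro: carrier_diff carrier_var)
    from span[OF this] show ?thesis unfolding ev_f .
  qed
  then have sub: "\<delta> ` ?U \<subseteq> vs.span ?B" by blast
  have inj: "inj_on \<delta> ?U"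
  proof (rule inj_onI)
    fix R R' assume "\<delta> R = \<delta> R'"
    then have "\<delta> R R = \<delta> R' R" by simp
    then show "R = R'" by (simp add: \<delta>_def split: if_splits)
  qed
  have "vs.independent (\<delta> ` ?U)"
  proof (subst vs.dependent_finite)
    show "finite (\<delta> ` ?U)" using finite_UZ by blast
    show "\<not> (\<exists>u. (\<exists>v\<in>\<delta> ` ?U. u v \<noteq> 0) \<and> (\<Sum>v\<in>\<delta> ` ?U. (\<lambda>x. u v * v x)) = 0)"
    proof
      assume "\<exists>u. (\<exists>v\<in>\<delta> ` ?U. u v \<noteq> 0) \<and> (\<Sum>v\<in>\<delta> ` ?U. (\<lambda>x. u v * v x)) = 0"
      then obtain u R where u: "R \<in> ?U" "u (\<delta> R) \<noteq> 0" "(\<Sum>v\<in>\<delta> ` ?U. (\<lambda>x. u v * v x)) = 0" by blast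
      have "0 = (\<Sum>v\<in>\<delta> ` ?U. (\<lambda>x. u v * v x)) R" using u(3) by simp
      also have "\<dots> = (\<Sum>R'\<in>?U. u (\<delta> R') * \<delta> R' R)"
        by (simp add: sum_fun_apply sum.reindex[OF inj])
      also have "\<dots> = u (\<delta> R)"
        using u(1) finite_UZ by (simp add: \<delta>_def if_distrib cong: if_cong)
      finally show False using u(2) by simp
    qed
  qed
  then have "card (\<delta> ` ?U) \<le> card ?B"
    using vs.independent_span_bound[OF _ _ sub] assms(1) by blast
  also have "\<dots> \<le> card G" using assms(1) by (rule card_image_le)
  finally show ?thesis using inj by (simp add: card_image)
qed

locale rook_ideal = diagonal_lex +
  fixes r :: nat
  assumes r_le: "r \<le> n" "r \<le> m"
begin

abbreviation "I \<equiv> I_ideal n m r"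
abbreviation "VI \<equiv> vanishing_ideal n m (rook_matrix ` UZ n m r)"

sublocale I: poly_ideal n m I by (rule I_ideal_is_ideal)
sublocale VI: poly_ideal n m VI by (rule vanishing_ideal_is_ideal)

definition Good :: "mon set" where
  "Good = indicator_mon ` {Q. good_placement n m r Q}"

lemma Good_mons: "Good \<subseteq> mons n m"
proof
  fix u assume "u \<in> Good"
  then obtain Q where Q: "u = indicator_mon Q" "rook_placement n m Q"
    by (auto simp: Good_def good_placement_def)
  then show "u \<in> mons n m"
    using rook_placementD(1,2)[OF Q(2)] by (auto simp: mons_def in_keys_iff lookup_indicator_mon split: if_splits)
qed

lemma finite_Good: "finite Good"
  unfolding Good_def
proof (rule finite_imageI, rule finite_subset)
  show "{Q. good_placement n m r Q} \<subseteq> Pow (board n m)"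
    by (auto simp: good_placement_def rook_placement_def)
qed (simp add: board_def)

text \<open>For now this bounds the number of good monomials by the number of placements; the
  reverse inclusion will follow from cardinalities.\<close>

lemma Good_subset_es: "mon_poly ` Good \<subseteq> es n m r ` UZ n m r"
proof
  fix t assume "t \<in> mon_poly ` Good"
  then obtain Q where Q: "good_placement n m r Q" "t = mon_poly (indicator_mon Q)"
    by (auto simp: Good_def)
  obtain R where "R \<in> UZ n m r" "ES n m r R = Q"
    using good_placement_ES[OF r_le Q(1)] by blast
  then show "t \<in> es n m r ` UZ n m r"
    using Q(2) by (intro image_eqI[of _ _ R]) (simp_all add: es_eq_mon_poly)
qed

lemma card_mon_poly_image: "card (mon_poly ` S) = card S"
  by (rule card_image) (rule inj_on_subset[OF inj_mon_poly subset_UNIV])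

lemma card_Good: "card Good \<le> card (UZ n m r)"
proof -
  have "card Good \<le> card (es n m r ` UZ n m r)"
    using card_mono[OF finite_imageI[OF finite_UZ] Good_subset_es] by (simp add: card_mon_poly_image)
  also have "\<dots> \<le> card (UZ n m r)" by (rule card_image_le[OF finite_UZ])
  finally show ?thesis .
qed

lemma quadratic_in_I:
  assumes "v \<in> board n m" "w \<in> board n m" "fst v = fst w \<or> snd v = snd w"
  shows "var v * var w \<in> I"
proof -
  have "var v * var w \<in> I_gens n m r"
  proof (cases v; cases w)
    fix i j i' j' assume vw: "v = (i, j)" "w = (i', j')"
    then have "i \<in> {1..n}" "i' \<in> {1..n}" "j \<in> {1..m}" "j' \<in> {1..m}" "i = i' \<or> j = j'"
      using assms by (auto simp: board_def)
    then show ?thesis unfolding vw I_gens_def by blast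
  qed
  then show ?thesis using I_gens_subset by blast
qed

lemma mon_poly_in_I:
  assumes "u \<in> mons n m" "v \<in> board n m" "w \<in> board n m" "fst v = fst w \<or> snd v = snd w"
    and "\<And>x. Poly_Mapping.lookup (Poly_Mapping.single v 1 + Poly_Mapping.single w 1) x \<le> Poly_Mapping.lookup u x"
  shows "mon_poly u \<in> I"
proof -
  obtain a where a: "u = Poly_Mapping.single v 1 + Poly_Mapping.single w 1 + a"
    using mon_factor[OF assms(5)] by blast
  then have "mon_poly u = var v * var w * mon_poly a"
    by (simp add: mon_poly_def var_def mult_single)
  moreover have "a \<in> mons n m" using a assms(1) mon_add_iff by blast
  ultimately show ?thesis
    using quadratic_in_I[OF assms(2-4)] by (simp add: I.mult_right_closed mon_poly_def carrier_single)
qed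

text \<open>A monomial with a square or with two variables on one line is itself in the ideal. Any
  other one is the indicator of a rook placement, and not being good then means a violated chain
  bound in one of the two orientations.\<close>

lemma reducible:
  assumes "u \<in> mons n m" "u \<notin> Good"
  shows "\<exists>g\<in>I. Poly_Mapping.lookup g u \<noteq> 0 \<and> (\<forall>v\<in>mkeys g. v \<noteq> u \<longrightarrow> (v, u) \<in> L)"
proof (cases "mon_poly u \<in> I")
  case True
  then show ?thesis by (intro bexI[of _ "mon_poly u"]) (auto simp: mon_poly_def)
next
  case False
  have keys: "mkeys u \<subseteq> board n m" using assms(1) by (simp add: mons_def)
  have sqfree: "Poly_Mapping.lookup u v \<le> 1" for v
  proof (rule ccontr)
    assume "\<not> ?thesis"
    then have 2: "2 \<le> Poly_Mapping.lookup u v" by simp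
    then have "v \<in> board n m" using keys by (auto simp: in_keys_iff)
    then have "mon_poly u \<in> I"
      using 2 by (intro mon_poly_in_I[OF assms(1), of v v]) (auto simp: lookup_add lookup_single when_def)
    then show False using False by simp
  qed
  have rook: "rook_placement n m (mkeys u)"
    unfolding rook_placement_def
  proof (intro conjI keys ballI impI)
    fix v w assume vw: "v \<in> mkeys u" "w \<in> mkeys u" "v \<noteq> w"
    have "\<not> (fst v = fst w \<or> snd v = snd w)"
    proof
      assume "fst v = fst w \<or> snd v = snd w"
      moreover have "Poly_Mapping.lookup (Poly_Mapping.single v 1 + Poly_Mapping.single w 1) x \<le> Poly_Mapping.lookup u x" for x
        using vw by (auto simp: lookup_add lookup_single when_def in_keys_iff)
      ultimately have "mon_poly u \<in> I"
        using vw keys by (intro mon_poly_in_I[OF assms(1), of v w]) auto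
      then show False using False by simp
    qed
    then show "fst v \<noteq> fst w" "snd v \<noteq> snd w" by auto
  qed
  note rookD = rook_placementD[OF rook]
  have u: "u = indicator_mon (mkeys u)"
  proof (rule poly_mapping_eqI)
    fix v
    show "Poly_Mapping.lookup u v = Poly_Mapping.lookup (indicator_mon (mkeys u)) v"
      using sqfree[of v] by (cases "Poly_Mapping.lookup u v") (simp_all add: lookup_indicator_mon in_keys_iff)
  qed
  then have "\<not> good_placement n m r (mkeys u)" using assms(2) unfolding Good_def by blast
  then consider "\<not> chain_bound (n - r) {1..m} (mkeys u)"
    | "\<not> chain_bound (m - r) {1..n} (prod.swap ` mkeys u)"
    using rook by (auto simp: good_placement_def)
  then show ?thesis
  proof cases
    case 1
    show ?thesis
    proof (rule straighten[OF I.poly_ideal_axioms, where h = Pair and Q = "mkeys u" and K = "n - r"])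
      show "(\<Prod>a\<in>S. \<Sum>j = 1..m. var (a, j)) \<in> I" if "S \<subseteq> {1..n}" "card S = n - r + 1" for S
        using I_gens_subset that unfolding I_gens_def by blast
      show "var (a, j) * var (a', j) \<in> I" if "a \<in> {1..n}" "a' \<in> {1..n}" "j \<in> {1..m}" for a a' j
        using that by (intro quadratic_in_I) (auto simp: board_def)
      show "mkeys u \<subseteq> {1..n} \<times> {1..m}" using keys by (simp add: board_def)
      show "u = (\<Sum>p\<in>mkeys u. Poly_Mapping.single (fst p, snd p) 1)"
        by (subst (1) u) (simp add: indicator_mon_def)
    qed (use 1 rookD in \<open>auto simp: board_def\<close>)
  next
    case 2
    show ?thesis
    proof (rule straighten[OF I.poly_ideal_axioms, where h = "\<lambda>a j. (j, a)" and Q = "prod.swap ` mkeys u" and K = "m - r"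
          and N = m and M = n])
      show "(\<Prod>a\<in>S. \<Sum>j = 1..n. var (j, a)) \<in> I" if "S \<subseteq> {1..m}" "card S = m - r + 1" for S
        using I_gens_subset that unfolding I_gens_def by blast
      show "var (j, a) * var (j, a') \<in> I" if "a \<in> {1..m}" "a' \<in> {1..m}" "j \<in> {1..n}" for a a' j
        using that by (intro quadratic_in_I) (auto simp: board_def)
      show "prod.swap ` mkeys u \<subseteq> {1..m} \<times> {1..n}" using keys by (auto simp: board_def)
      show "u = (\<Sum>p\<in>prod.swap ` mkeys u. Poly_Mapping.single (snd p, fst p) 1)"
        by (subst (1) u) (simp add: indicator_mon_def sum.reindex)
      show "inj_on fst (prod.swap ` mkeys u)" "inj_on snd (prod.swap ` mkeys u)"
        using rookD(3,4) by (auto simp: inj_on_def)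
    qed (use 2 in \<open>auto simp: board_def\<close>)
  qed
qed

section \<open>Normal forms in the good monomials\<close>

abbreviation lower :: "mon \<Rightarrow> mon set" where
  "lower u \<equiv> {v. v = u \<or> (v, u) \<in> L}"

lemma normal_form:
  assumes "u \<in> mons n m"
  shows "\<exists>h. mkeys h \<subseteq> {v \<in> Good \<inter> lower u. mon_degree v = mon_degree u} \<and> mon_poly u - h \<in> I"
  using assms
proof (induction u rule: mons_degree_induct)
  case (less u)
  show ?case
  proof (cases "u \<in> Good")
    case True
    then show ?thesis by (intro exI[of _ "mon_poly u"]) (simp add: mon_poly_def)
  next
    case False
    obtain g0 where g0: "g0 \<in> I" "Poly_Mapping.lookup g0 u \<noteq> 0" "\<forall>v\<in>mkeys g0. v \<noteq> u \<longrightarrow> (v, u) \<in> L"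
      using reducible[OF less(1) False] by blast
    \<comment> \<open>Taking the component of degree \<open>mon_degree u\<close> stays in the ideal,
      keeps \<open>u\<close> leading, and leaves only tail monomials to which the induction
      hypothesis applies.\<close>
    define g where "g = hom_component (mon_degree u) g0"
    define c where "c = Poly_Mapping.lookup g u"
    define t where "t = g - Poly_Mapping.single u c"
    have g: "g \<in> I" "c \<noteq> 0"
      using I_ideal_hom_component(1)[OF r_le g0(1)] g0(2) by (auto simp: g_def c_def lookup_hom_component)
    have t: "(v, u) \<in> L \<and> mon_degree v = mon_degree u" if "v \<in> mkeys t" for v
    proof -
      have "v \<noteq> u" using that by (auto simp: t_def in_keys_iff lookup_minus c_def)
      then have "v \<in> mkeys g"
        using that by (auto simp: t_def in_keys_iff lookup_minus lookup_single when_def)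
      then show ?thesis using g0(3) \<open>v \<noteq> u\<close> by (auto simp: g_def keys_hom_component)
    qed
    let ?S = "\<lambda>v. {x \<in> Good \<inter> lower v. mon_degree x = mon_degree v}"
    obtain h where h: "mkeys h \<subseteq> (\<Union>v\<in>mkeys t. ?S v)" "t - h \<in> I"
      using I.linear_reduction[of t ?S] less(2) t by blast
    \<comment> \<open>As \<open>g\<close>, the sum of \<open>c\<close> times \<open>u\<close> and
      \<open>t\<close>, lies in the ideal, \<open>u\<close> is congruent to \<open>- (1 / c)\<close>
      times the reduction \<open>h\<close> of \<open>t\<close>.\<close>
    let ?h = "Poly_Mapping.single 0 (- (1 / c)) * h"
    have "mkeys ?h \<subseteq> ?S u"
    proof
      fix x assume "x \<in> mkeys ?h"
      then obtain v where "v \<in> mkeys t" "x \<in> ?S v" using h(1) keys_scalar_mult by blast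
      then show "x \<in> ?S u" using t[of v] less_trans[of x v u] by auto
    qed
    moreover have eq: "mon_poly u - ?h = Poly_Mapping.single 0 (1 / c) * (g - (t - h))"
    proof (rule poly_mapping_eqI)
      fix k
      show "Poly_Mapping.lookup (mon_poly u - ?h) k =
        Poly_Mapping.lookup (Poly_Mapping.single 0 (1 / c) * (g - (t - h))) k"
        unfolding t_def lookup_minus lookup_scalar_mult
        using g(2) by (simp add: mon_poly_def lookup_single when_def field_simps)
    qed
    have "mon_poly u - ?h \<in> I"
      unfolding eq by (rule I.mult_closed[OF carrier_scalar I.diff_closed[OF g(1) h(2)]])
    ultimately show ?thesis by blast
  qed
qed

lemma reduce_homogeneous:
  assumes "f \<in> carrier (poly_ring n m)" "homogeneous d f"
  obtains h where "mkeys h \<subseteq> Good" "homogeneous d h" "f - h \<in> I"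
proof -
  let ?S = "\<lambda>v. {x \<in> Good \<inter> lower v. mon_degree x = mon_degree v}"
  have "\<exists>h. mkeys h \<subseteq> ?S u \<and> mon_poly u - h \<in> I" if "u \<in> mkeys f" for u
    using normal_form[of u] that assms(1) by (auto simp: carrier_iff)
  then obtain h where h: "mkeys h \<subseteq> (\<Union>u\<in>mkeys f. ?S u)" "f - h \<in> I"
    using I.linear_reduction[of f ?S] by blast
  show ?thesis
  proof (rule that)
    show "mkeys h \<subseteq> Good" using h(1) by blast
    show "homogeneous d h"
      unfolding homogeneous_def
    proof
      fix a assume "a \<in> mkeys h"
      then obtain v where "v \<in> mkeys f" "a \<in> ?S v" using h(1) by blast
      then show "mon_degree a = d" using assms(2) by (simp add: homogeneous_def)
    qed
  qed (rule h(2))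
qed

lemma Good_carrier: "mkeys h \<subseteq> Good \<Longrightarrow> h \<in> carrier (poly_ring n m)"
  using Good_mons by (auto simp: carrier_iff)

text \<open>The component of degree \<open>d\<close> is reduced modulo the ideal. What was
  subtracted is the leading form of a vanishing polynomial \<open>q\<close>, so working modulo
  \<open>VI\<close> instead leaves an error of lower degree, which the induction absorbs.\<close>

lemma reduce_low_degree:
  assumes "f \<in> carrier (poly_ring n m)" "low_degree d f"
  shows "\<exists>h. mkeys h \<subseteq> Good \<and> low_degree d h \<and> f - h \<in> VI"
  using assms
proof (induction d arbitrary: f)
  case 0
  then have "f = 0" by (auto simp: low_degree_def)
  then show ?case by (intro exI[of _ 0]) simp
next
  case (Suc d)
  have fd: "hom_component d f \<in> carrier (poly_ring n m)"
    using Suc.prems(1) by (auto simp: carrier_iff keys_hom_component)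
  obtain h1 where h1: "mkeys h1 \<subseteq> Good" "homogeneous d h1" "hom_component d f - h1 \<in> I"
    using reduce_homogeneous[OF fd homogeneous_hom_component] by blast
  let ?p = "hom_component d f - h1"
  have "homogeneous d ?p"
    using homogeneous_add[of d "hom_component d f" "- h1"] h1(2) by (simp add: homogeneous_def keys_hom_component)
  then have "hom_component d ?p = ?p" by (simp add: hom_component_homogeneous)
  then obtain q where q: "q \<in> VI" "leading_form d ?p q"
    using I_ideal_hom_component(2)[OF r_le h1(3), of d] by auto
  let ?f = "(f - hom_component d f) - (q - ?p)"
  have "low_degree d (f - hom_component d f)"
    using Suc.prems(2) by (auto simp: low_degree_def in_keys_iff lookup_minus lookup_hom_component
        less_Suc_eq split: if_splits)
  then have "low_degree d ?f"
    by (rule low_degree_diff) (use q(2) in \<open>simp add: leading_form_def\<close>)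
  moreover have "?f \<in> carrier (poly_ring n m)"
    using Suc.prems(1) fd q(1) Good_carrier[OF h1(1)] VI.in_carrier by (intro carrier_diff) auto
  ultimately obtain h2 where h2: "mkeys h2 \<subseteq> Good" "low_degree d h2" "?f - h2 \<in> VI"
    using Suc.IH by blast
  have "mkeys (h1 + h2) \<subseteq> Good" using keys_add[of h1 h2] h1(1) h2(1) by blast
  moreover have "low_degree (Suc d) (h1 + h2)"
    using h1(2) h2(2) by (intro low_degree_add) (auto simp: low_degree_def homogeneous_def)
  moreover have "f - (h1 + h2) = (?f - h2) + q" by simp
  then have "f - (h1 + h2) \<in> VI" using VI.add_closed[OF h2(3) q(1)] by (simp only:)
  ultimately show ?case by blast
qed

lemma reduce_vanishing:
  assumes "f \<in> carrier (poly_ring n m)"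
  shows "\<exists>h. mkeys h \<subseteq> Good \<and> f - h \<in> VI"
proof -
  have "low_degree (Suc (Max (insert 0 (mon_degree ` mkeys f)))) f"
    by (auto simp: low_degree_def less_Suc_eq_le)
  then show ?thesis using reduce_low_degree[OF assms] by blast
qed

section \<open>Independence of the good monomials by counting\<close>

lemma card_Good_eq: "card Good = card (UZ n m r)"
  using card_Good card_UZ_le[OF finite_Good reduce_vanishing] by simp

text \<open>A nontrivial relation would allow one good monomial to be eliminated from every
  reduction, leaving fewer spanning monomials than there are placements.\<close>

lemma Good_independent_VI:
  assumes "mkeys h \<subseteq> Good" "h \<in> VI"
  shows "h = 0"
proof (rule ccontr)
  assume "h \<noteq> 0"
  then obtain u where u: "u \<in> mkeys h" using keys_eq_empty by blast
  define c where "c = Poly_Mapping.lookup h u"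
  have "c \<noteq> 0" using u by (simp add: c_def in_keys_iff)
  have "card (UZ n m r) \<le> card (Good - {u})"
  proof (rule card_UZ_le)
    fix f assume f: "f \<in> carrier (poly_ring n m)"
    obtain h' where h': "mkeys h' \<subseteq> Good" "f - h' \<in> VI" using reduce_vanishing[OF f] by blast
    let ?e = "Poly_Mapping.single 0 (Poly_Mapping.lookup h' u / c) * h"
    have "f - (h' - ?e) = (f - h') + ?e" by simp
    also have "\<dots> \<in> VI" using h'(2) assms(2) by (intro VI.add_closed VI.mult_closed carrier_scalar)
    finally have "f - (h' - ?e) \<in> VI" .
    moreover have "mkeys (h' - ?e) \<subseteq> Good - {u}"
    proof -
      have "u \<notin> mkeys (h' - ?e)" using \<open>c \<noteq> 0\<close> by (simp add: in_keys_iff lookup_minus c_def)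
      moreover have "mkeys (h' - ?e) \<subseteq> mkeys h' \<union> mkeys h"
        by (auto simp: in_keys_iff lookup_minus)
      ultimately show ?thesis using h'(1) assms(1) by blast
    qed
    ultimately show "\<exists>h. mkeys h \<subseteq> Good - {u} \<and> f - h \<in> VI" by blast
  qed (use finite_Good in simp)
  also have "\<dots> < card Good"
    using u assms(1) by (intro card_Diff1_less finite_Good) auto
  finally show False using card_Good_eq by simp
qed

text \<open>The lower part \<open>q - g\<close> reduces to a combination \<open>h\<close> of good
  monomials of lower degree. Then \<open>g + h\<close> vanishes on all placements, hence is 0, and
  the summands cannot cancel since their degrees differ.\<close>

lemma hom_component_VI:
  assumes "mkeys g \<subseteq> Good" "homogeneous d g" "q \<in> VI" "low_degree d (q - g)"
  shows "g = 0"
proof -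
  have "q - g \<in> carrier (poly_ring n m)"
    using assms(3) VI.in_carrier Good_carrier[OF assms(1)] by (intro carrier_diff)
  then obtain h where h: "mkeys h \<subseteq> Good" "low_degree d h" "q - g - h \<in> VI"
    using reduce_low_degree[OF _ assms(4)] by blast
  have "g + h = q - (q - g - h)" by simp
  also have "\<dots> \<in> VI" by (rule VI.diff_closed[OF assms(3) h(3)])
  finally have "g + h = 0"
    using keys_add[of g h] assms(1) h(1) by (intro Good_independent_VI) auto
  then have "g = - h" by (simp add: eq_neg_iff_add_eq_0)
  then have "mkeys g = mkeys h" by simp
  then have "mkeys g = {}"
    using assms(2) h(2) by (fastforce simp: homogeneous_def low_degree_def)
  then show ?thesis by simp
qed

text \<open>Each homogeneous component of \<open>p\<close> is again supported on good monomials and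
  is the leading form of a vanishing polynomial, so independence over the placements applies degree
  by degree.\<close>

lemma Good_independent_I:
  assumes "mkeys p \<subseteq> Good" "p \<in> I"
  shows "p = 0"
proof -
  have "hom_component d p = 0" for d
  proof -
    obtain q where "q \<in> VI" "leading_form d (hom_component d p) q"
      using I_ideal_hom_component(2)[OF r_le assms(2)] by blast
    then show ?thesis
      using assms(1) by (intro hom_component_VI[of _ d q]) (auto simp: leading_form_def keys_hom_component)
  qed
  then show ?thesis
    by (intro poly_mapping_eqI) (metis lookup_hom_component lookup_zero)
qed

text \<open>Let \<open>h\<close> be the reduction of the top component of \<open>f\<close>. Their
  difference is the leading form of a vanishing \<open>q\<close>, so \<open>f - q\<close> vanishes
  with leading form \<open>h\<close>, which forces \<open>h = 0\<close>.\<close>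

lemma gr_subset_I: "gr_ideal n m VI \<subseteq> I"
  unfolding gr_ideal_def
proof (rule genideal_subset[OF I.poly_ideal_axioms], clarify)
  fix f assume f: "f \<in> VI" "f \<noteq> 0"
  define d where "d = Max (mon_degree ` mkeys f)"
  have top: "top_component f = hom_component d f"
    by (simp add: top_component_def hom_component_def d_def)
  have "low_degree d (f - hom_component d f)"
    unfolding low_degree_def
  proof
    fix a assume "a \<in> mkeys (f - hom_component d f)"
    then have a: "a \<in> mkeys f" "mon_degree a \<noteq> d"
      by (auto simp: in_keys_iff lookup_minus lookup_hom_component split: if_splits)
    then have "mon_degree a \<le> d" unfolding d_def by (intro Max_ge) auto
    then show "mon_degree a < d" using a(2) by simp
  qed
  note low = this
  have fd: "hom_component d f \<in> carrier (poly_ring n m)"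
    using VI.in_carrier[OF f(1)] by (auto simp: carrier_iff keys_hom_component)
  obtain h where h: "mkeys h \<subseteq> Good" "homogeneous d h" "hom_component d f - h \<in> I"
    using reduce_homogeneous[OF fd homogeneous_hom_component] by blast
  let ?p = "hom_component d f - h"
  have "homogeneous d ?p"
    using homogeneous_add[of d "hom_component d f" "- h"] h(2) by (simp add: homogeneous_def keys_hom_component)
  then have "hom_component d ?p = ?p" by (simp add: hom_component_homogeneous)
  then obtain q where q: "q \<in> VI" "leading_form d ?p q"
    using I_ideal_hom_component(2)[OF r_le h(3), of d] by auto
  have "low_degree d ((f - hom_component d f) - (q - ?p))"
    by (rule low_degree_diff[OF low]) (use q(2) in \<open>simp add: leading_form_def\<close>)
  then have "low_degree d (f - q - h)" by (simp add: algebra_simps)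
  then have "h = 0"
    using hom_component_VI[OF h(1,2) VI.diff_closed[OF f(1) q(1)]] by simp
  then show "top_component f \<in> I" using h(3) top by simp
qed

text \<open>If \<open>u\<close> were a multiple of a leading monomial, it would lead some element of
  the ideal. Reducing the smaller monomials of that element would then give a nonzero element of the
  ideal supported on good monomials, with \<open>u\<close> still present.\<close>

lemma Good_standard:
  assumes "u \<in> Good"
  shows "mon_poly u \<notin> initial_ideal n m L I"
proof
  assume "mon_poly u \<in> initial_ideal n m L I"
  then obtain f w where f: "f \<in> I" "f \<noteq> 0" and u: "u = w + lead_mon L f"
    using initial_ideal_monomial[OF I.poly_ideal_axioms] by blast
  have w: "w \<in> mons n m" using assms Good_mons u mon_add_iff by blast
  note lead = lead_mon_exists[OF I.in_carrier[OF f(1)] f(2)]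
  define g where "g = mon_poly w * f"
  define c where "c = Poly_Mapping.lookup g u"
  define t where "t = g - Poly_Mapping.single u c"
  have g: "g \<in> I" using f(1) w by (simp add: g_def mon_poly_def carrier_single I.mult_closed)
  have "c \<noteq> 0" using lead(1) by (simp add: c_def g_def u mon_poly_def in_keys_iff)
  have t: "(v, u) \<in> L" if v: "v \<in> mkeys t" for v
  proof -
    have "v \<noteq> u" using v by (auto simp: t_def in_keys_iff lookup_minus c_def)
    then have "v \<in> mkeys g"
      using v by (auto simp: t_def in_keys_iff lookup_minus lookup_single when_def)
    then obtain b where "b \<in> mkeys f" "v = w + b"
      unfolding g_def mon_poly_def by (rule keys_single_mult)
    then show ?thesis using lead(2)[of b] less_add[OF _ w] \<open>v \<noteq> u\<close> u by blast
  qed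
  let ?S = "\<lambda>v. Good \<inter> lower v"
  have "\<exists>h. mkeys h \<subseteq> ?S v \<and> mon_poly v - h \<in> I" if "v \<in> mkeys t" for v
    using normal_form[of v] less_mons[OF t[OF that]] by blast
  then obtain h where h: "mkeys h \<subseteq> (\<Union>v\<in>mkeys t. ?S v)" "t - h \<in> I"
    using I.linear_reduction[of t ?S] by blast
  have hL: "(x, u) \<in> L" if "x \<in> mkeys h" for x
    using that h(1) t less_trans by blast
  have "Poly_Mapping.single u c + h = g - (t - h)" by (simp add: t_def)
  also have "\<dots> \<in> I" by (rule I.diff_closed[OF g h(2)])
  finally have "Poly_Mapping.single u c + h = 0"
    using keys_add[of "Poly_Mapping.single u c" h] h(1) assms
    by (intro Good_independent_I) (auto split: if_splits)
  then have "Poly_Mapping.lookup (Poly_Mapping.single u c + h) u = 0" by simp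
  moreover have "Poly_Mapping.lookup h u = 0" using hL less_irrefl in_keys_iff by metis
  ultimately show False using \<open>c \<noteq> 0\<close> by (simp add: lookup_add)
qed

lemma nonGood_initial:
  assumes "u \<in> mons n m" "u \<notin> Good"
  shows "mon_poly u \<in> initial_ideal n m L I"
proof -
  obtain g where g: "g \<in> I" "Poly_Mapping.lookup g u \<noteq> 0" "\<forall>v\<in>mkeys g. v \<noteq> u \<longrightarrow> (v, u) \<in> L"
    using reducible[OF assms] by blast
  then have "lead_mon L g = u" by (intro lead_mon_eqI) (auto simp: in_keys_iff)
  moreover have "g \<noteq> 0" using g(2) by auto
  ultimately show ?thesis using lead_mon_in_initial_ideal[OF I.poly_ideal_axioms g(1)] by simp
qed

text \<open>The image of \<open>es\<close> has at most as many elements as there are placements, and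
  the good monomials it contains are already that many.\<close>

lemma es_eq_Good: "es n m r ` UZ n m r = mon_poly ` Good"
proof (rule card_seteq[symmetric, OF _ Good_subset_es])
  show "card (es n m r ` UZ n m r) \<le> card (mon_poly ` Good)"
    using card_image_le[OF finite_UZ, of "es n m r"] card_Good_eq by (simp add: card_mon_poly_image)
qed (use finite_UZ in blast)

theorem standard_monomials:
  "es n m r ` UZ n m r = {t \<in> mon_poly ` mons n m. t \<notin> initial_ideal n m L I}"
  unfolding es_eq_Good using Good_mons Good_standard nonGood_initial by blast

theorem gr_eq_I: "gr_ideal n m VI = I"
  using gr_subset_I I_ideal_subset_gr[OF r_le] by blast

end

theorem theorem4p12:
  fixes n m r :: nat and L :: "(mon \<times> mon) set"
  assumes "n > 0" and "m > 0" and "r \<le> min n m"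
    and "diagonal_order n m L"
  shows "es n m r ` UZ n m r =
           {t \<in> mon_poly ` mons n m. t \<notin> initial_ideal n m L (I_ideal n m r)}
         \<and> gr_ideal n m (vanishing_ideal n m (rook_matrix ` UZ n m r)) = I_ideal n m r"
proof -
  obtain V where V: "linear_order_on (board n m) V"
    "\<forall>(i, j)\<in>board n m. \<forall>(i', j')\<in>board n m. i + j < i' + j' \<longrightarrow> ((i', j'), (i, j)) \<in> V"
    "L = lex_order n m V"
    using assms(4) unfolding diagonal_order_def by blast
  interpret rook_ideal n m V L r
    using V assms(3) by unfold_locales auto
  show ?thesis using standard_monomials gr_eq_I by blast
qed

end
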